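(* Let $F$ be a free group of finite rank $k\ge 3$. Then there does not exist a continuous $Out(F)$-equivariant (or $Out(F)$-anti-equivariant) map $\mathcal{M}^{\mathbb{P}Curr}\to\partial CV(F)$. Hence there does not exist a continuous $Out(F)$-equivariant (or $Out(F)$-anti-equivariant) map $\mathbb{P}Curr(F)\to\partial CV(F)$.
   Context: Currents. $\partial F$ is the hyperbolic (Gromov) boundary of $F$, and $\partial^2F=\{(\zeta,\xi): \zeta,\xi\in\partial F,\ \zeta\neq\xi\}$, with flip map $\sigma(\zeta,\xi)=(\xi,\zeta)$. A geodesic current on $F$ is a positive Radon measure on $\partial^2F$ that is $F$-invariant and $\sigma$-invariant. $Curr(F)$ is the space of all geodesic currents with the weak topology: $\nu_n\to\nu$ iff $\nu_n(S\times S')\to\nu(S\times S')$ for all disjoint closed-open $S,S'\subseteq\partial F$. $\mathbb{P}Curr(F)$ is the set of non-zero currents modulo multiplication by non-zero (necessarily positive) scalars, with the quotient topology; the class of $\nu$ is $[\nu]$. An automorphism $\phi\in Aut(F)$ induces a homeomorphism $\hat\phi$ of $\partial^2F$, and $(\phi\nu)(S)=\nu(\hat\phi^{-1}(S))$; this induces a continuous left action of $Out(F)$ on $\mathbb{P}Curr(F)$. Rational currents. For $g\in F$ non-trivial and not a proper power, let $g_\pm=\lim_{n\to\infty}g^{\pm n}\in\partial F$ and $\mu_g=\sum_{h\in[g]}(\delta_{(h_-,h_+)}+\delta_{(h_+,h_-)})$, where $[g]$ is the conjugacy class of $g$. If $g=f^m$ with $m>1$ and $f$ not a proper power, $\mu_g=m\mu_f$.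 An element of $F$ is primitive if it belongs to some free basis of $F$. $\mathcal{M}^{\mathbb{P}Curr}$ is the closure in $\mathbb{P}Curr(F)$ of $\{[\mu_g]: g\in F \text{ primitive}\}$; it is a closed $Out(F)$-invariant set, and carries the subspace topology. Outer space. $cv(F)$ is the space of $\mathbb{R}$-trees $T$ with a minimal, free and discrete isometric action of $F$, up to $F$-equivariant isometry, identified with the set of their translation length functions $\|\cdot\|_T\in\mathbb{R}^F$ (topology of pointwise convergence). $CV(F)=\mathbb{P}cv(F)\subset\mathbb{P}\mathbb{R}^F=(\mathbb{R}^F\setminus\{0\})/\text{scaling}$ is its projectivization, $\overline{CV(F)}$ is its (compact) closure in $\mathbb{P}\mathbb{R}^F$, and $\partial CV(F)=\overline{CV(F)}\setminus CV(F)$. $Out(F)$ acts on the left by homeomorphisms via $\|w\|_{\phi T}=\|\phi^{-1}(w)\|_T$. A map $\tau:X\to Z$ between spaces with left $Out(F)$-actions is equivariant if $\tau(\phi x)=\phi\,\tau(x)$, and anti-equivariant if $\tau(\phi x)=\phi^{-1}\tau(x)$, for all $\phi\in Out(F)$ and $x\in X$. *)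

theory Defs
  imports "HOL-Analysis.Analysis" "HOL-Algebra.Group_Action"
begin

section \<open>Free bases and word length\<close>

text \<open>A word is a list of letters \<open>(b, e)\<close>; the letter stands for \<open>b\<close> if \<open>e\<close> holds and for
  the inverse of \<open>b\<close> otherwise.\<close>

definition words :: "'a set \<Rightarrow> ('a \<times> bool) list set" where
  "words B = lists (B \<times> UNIV)"

definition eval_letter :: "('a, 'b) monoid_scheme \<Rightarrow> 'a \<times> bool \<Rightarrow> 'a" where
  "eval_letter F l = (if snd l then fst l else inv\<^bsub>F\<^esub> (fst l))"

definition eval_word :: "('a, 'b) monoid_scheme \<Rightarrow> ('a \<times> bool) list \<Rightarrow> 'a" where
  "eval_word F w = foldr (\<lambda>l g. eval_letter F l \<otimes>\<^bsub>F\<^esub> g) w \<one>\<^bsub>F\<^esub>"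

definition reduced :: "('a \<times> bool) list \<Rightarrow> bool" where
  "reduced w \<longleftrightarrow>
     (\<forall>i. Suc i < length w \<longrightarrow> w ! Suc i \<noteq> (fst (w ! i), \<not> snd (w ! i)))"

definition free_basis :: "('a, 'b) monoid_scheme \<Rightarrow> 'a set \<Rightarrow> bool" where
  "free_basis F B \<longleftrightarrow>
     B \<subseteq> carrier F \<and> bij_betw (eval_word F) {w \<in> words B. reduced w} (carrier F)"

definition primitive_elt :: "('a, 'b) monoid_scheme \<Rightarrow> 'a \<Rightarrow> bool" where
  "primitive_elt F g \<longleftrightarrow> (\<exists>A. free_basis F A \<and> g \<in> A)"

definition proper_power :: "('a, 'b) monoid_scheme \<Rightarrow> 'a \<Rightarrow> bool" where
  "proper_power F g \<longleftrightarrow> (\<exists>f \<in> carrier F. \<exists>m > (1::nat). g = f [^]\<^bsub>F\<^esub> m)"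

definition conj_class :: "('a, 'b) monoid_scheme \<Rightarrow> 'a \<Rightarrow> 'a set" where
  "conj_class F g = {h \<otimes>\<^bsub>F\<^esub> g \<otimes>\<^bsub>F\<^esub> inv\<^bsub>F\<^esub> h | h. h \<in> carrier F}"

definition word_length :: "('a, 'b) monoid_scheme \<Rightarrow> 'a set \<Rightarrow> 'a \<Rightarrow> nat" where
  "word_length F B g = (LEAST n. \<exists>w \<in> words B. length w = n \<and> eval_word F w = g)"

definition word_dist :: "('a, 'b) monoid_scheme \<Rightarrow> 'a set \<Rightarrow> 'a \<Rightarrow> 'a \<Rightarrow> real" where
  "word_dist F B g h = real (word_length F B (inv\<^bsub>F\<^esub> g \<otimes>\<^bsub>F\<^esub> h))"


section \<open>Outer automorphisms\<close>

definition inner_auts :: "('a, 'b) monoid_scheme \<Rightarrow> ('a \<Rightarrow> 'a) set" where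
  "inner_auts F =
     {(\<lambda>x \<in> carrier F. h \<otimes>\<^bsub>F\<^esub> x \<otimes>\<^bsub>F\<^esub> inv\<^bsub>F\<^esub> h) | h. h \<in> carrier F}"

definition Out :: "('a, 'b) monoid_scheme \<Rightarrow> ('a \<Rightarrow> 'a) set monoid" where
  "Out F = AutoGroup F Mod inner_auts F"

text \<open>If automorphisms act on \<open>'x\<close>, compatibly with an equivalence relation for which inner
  automorphisms act trivially on classes, then an outer class \<open>\<Phi>\<close> sends the equivalence class
  \<open>X\<close> to the set of all \<open>\<phi> x\<close> with \<open>\<phi> \<in> \<Phi>\<close> and \<open>x \<in> X\<close>.\<close>

definition class_action :: "(('a \<Rightarrow> 'a) \<Rightarrow> 'x \<Rightarrow> 'x) \<Rightarrow> ('a \<Rightarrow> 'a) set \<Rightarrow> 'x set \<Rightarrow> 'x set" where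
  "class_action act \<Phi> X = (\<Union>\<phi> \<in> \<Phi>. act \<phi> ` X)"

definition equivariant ::
  "'g monoid \<Rightarrow> ('g \<Rightarrow> 'x \<Rightarrow> 'x) \<Rightarrow> ('g \<Rightarrow> 'z \<Rightarrow> 'z) \<Rightarrow> 'x set \<Rightarrow> ('x \<Rightarrow> 'z) \<Rightarrow> bool" where
  "equivariant G actX actZ X \<tau> \<longleftrightarrow>
     (\<forall>\<phi> \<in> carrier G. \<forall>x \<in> X. \<tau> (actX \<phi> x) = actZ \<phi> (\<tau> x))"

definition anti_equivariant ::
  "'g monoid \<Rightarrow> ('g \<Rightarrow> 'x \<Rightarrow> 'x) \<Rightarrow> ('g \<Rightarrow> 'z \<Rightarrow> 'z) \<Rightarrow> 'x set \<Rightarrow> ('x \<Rightarrow> 'z) \<Rightarrow> bool" where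
  "anti_equivariant G actX actZ X \<tau> \<longleftrightarrow>
     (\<forall>\<phi> \<in> carrier G. \<forall>x \<in> X. \<tau> (actX \<phi> x) = actZ (inv\<^bsub>G\<^esub> \<phi>) (\<tau> x))"


section \<open>Quotient topology and Borel sets of an abstract topology\<close>

definition quotient_topology :: "'x topology \<Rightarrow> ('x \<Rightarrow> 'y) \<Rightarrow> 'y topology" where
  "quotient_topology X q =
     topology (\<lambda>U. U \<subseteq> q ` topspace X \<and> openin X {x \<in> topspace X. q x \<in> U})"

lemma openin_quotient_topology:
  "openin (quotient_topology X q) U \<longleftrightarrow>
     U \<subseteq> q ` topspace X \<and> openin X {x \<in> topspace X. q x \<in> U}"
proof -
  have "istopology (\<lambda>U. U \<subseteq> q ` topspace X \<and> openin X {x \<in> topspace X. q x \<in> U})"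
    unfolding istopology_def
  proof (intro conjI allI impI)
    fix S T
    assume S: "S \<subseteq> q ` topspace X \<and> openin X {x \<in> topspace X. q x \<in> S}"
      and T: "T \<subseteq> q ` topspace X \<and> openin X {x \<in> topspace X. q x \<in> T}"
    have "{x \<in> topspace X. q x \<in> S \<inter> T} =
        {x \<in> topspace X. q x \<in> S} \<inter> {x \<in> topspace X. q x \<in> T}" by auto
    with S T show "openin X {x \<in> topspace X. q x \<in> S \<inter> T}" by auto
    from S show "S \<inter> T \<subseteq> q ` topspace X" by auto
  next
    fix K
    assume K: "\<forall>S\<in>K. S \<subseteq> q ` topspace X \<and> openin X {x \<in> topspace X. q x \<in> S}"
    have "{x \<in> topspace X. q x \<in> \<Union>K} = (\<Union>S\<in>K. {x \<in> topspace X. q x \<in> S})" by auto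
    with K show "openin X {x \<in> topspace X. q x \<in> \<Union>K}" by auto
    from K show "\<Union>K \<subseteq> q ` topspace X" by auto
  qed
  then show ?thesis by (simp add: quotient_topology_def)
qed

definition borel_sets :: "'x topology \<Rightarrow> 'x set set" where
  "borel_sets X = sigma_sets (topspace X) {U. openin X U}"

definition borel_space :: "'x topology \<Rightarrow> 'x measure" where
  "borel_space X = sigma (topspace X) {U. openin X U}"


section \<open>The Gromov boundary\<close>

definition gromov_product :: "('a, 'b) monoid_scheme \<Rightarrow> 'a set \<Rightarrow> 'a \<Rightarrow> 'a \<Rightarrow> real" where
  "gromov_product F B g h =
     (word_dist F B \<one>\<^bsub>F\<^esub> g + word_dist F B \<one>\<^bsub>F\<^esub> h - word_dist F B g h) / 2"

definition gromov_asymp ::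
  "('a, 'b) monoid_scheme \<Rightarrow> 'a set \<Rightarrow> (nat \<Rightarrow> 'a) \<Rightarrow> (nat \<Rightarrow> 'a) \<Rightarrow> bool" where
  "gromov_asymp F B x y \<longleftrightarrow>
     filterlim (\<lambda>(i, j). gromov_product F B (x i) (y j)) at_top (sequentially \<times>\<^sub>F sequentially)"

definition gromov_seqs :: "('a, 'b) monoid_scheme \<Rightarrow> 'a set \<Rightarrow> (nat \<Rightarrow> 'a) set" where
  "gromov_seqs F B = {x. range x \<subseteq> carrier F \<and> gromov_asymp F B x x}"

definition boundary_rel ::
  "('a, 'b) monoid_scheme \<Rightarrow> 'a set \<Rightarrow> ((nat \<Rightarrow> 'a) \<times> (nat \<Rightarrow> 'a)) set" where
  "boundary_rel F B =
     {(x, y). x \<in> gromov_seqs F B \<and> y \<in> gromov_seqs F B \<and> gromov_asymp F B x y}"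

type_synonym 'a bpoint = "(nat \<Rightarrow> 'a) set"

definition gboundary :: "('a, 'b) monoid_scheme \<Rightarrow> 'a set \<Rightarrow> 'a bpoint set" where
  "gboundary F B = gromov_seqs F B // boundary_rel F B"

definition boundary_limit ::
  "('a, 'b) monoid_scheme \<Rightarrow> 'a set \<Rightarrow> (nat \<Rightarrow> 'a) \<Rightarrow> 'a bpoint" where
  "boundary_limit F B x = boundary_rel F B `` {x}"

definition boundary_product ::
  "('a, 'b) monoid_scheme \<Rightarrow> 'a set \<Rightarrow> 'a bpoint \<Rightarrow> 'a bpoint \<Rightarrow> ereal" where
  "boundary_product F B p q =
     (SUP x \<in> p. SUP y \<in> q.
        Liminf (sequentially \<times>\<^sub>F sequentially)
          (\<lambda>(i, j). ereal (gromov_product F B (x i) (y j))))"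

text \<open>The sets of all \<open>q\<close> with \<open>(p|q) \<ge> r\<close>, for real \<open>r\<close>, are a neighbourhood basis at \<open>p\<close>.\<close>

definition boundary_open :: "('a, 'b) monoid_scheme \<Rightarrow> 'a set \<Rightarrow> 'a bpoint set \<Rightarrow> bool" where
  "boundary_open F B U \<longleftrightarrow>
     U \<subseteq> gboundary F B \<and>
     (\<forall>p \<in> U. \<exists>r::real. {q \<in> gboundary F B. boundary_product F B p q \<ge> ereal r} \<subseteq> U)"

definition boundary_top :: "('a, 'b) monoid_scheme \<Rightarrow> 'a set \<Rightarrow> 'a bpoint topology" where
  "boundary_top F B = topology (boundary_open F B)"

lemma openin_boundary_top: "openin (boundary_top F B) U \<longleftrightarrow> boundary_open F B U"
proof -
  have "istopology (boundary_open F B)"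
    unfolding istopology_def
  proof (intro conjI allI impI)
    fix S T
    assume S: "boundary_open F B S" and T: "boundary_open F B T"
    show "boundary_open F B (S \<inter> T)"
      unfolding boundary_open_def
    proof (intro conjI ballI)
      show "S \<inter> T \<subseteq> gboundary F B" using S unfolding boundary_open_def by auto
      fix p assume "p \<in> S \<inter> T"
      then obtain r s :: real
        where r: "{q \<in> gboundary F B. boundary_product F B p q \<ge> ereal r} \<subseteq> S"
          and s: "{q \<in> gboundary F B. boundary_product F B p q \<ge> ereal s} \<subseteq> T"
        using S T unfolding boundary_open_def by blast
      have "{q \<in> gboundary F B. boundary_product F B p q \<ge> ereal (max r s)} \<subseteq> S \<inter> T"
      proof
        fix q assume q: "q \<in> {q \<in> gboundary F B. boundary_product F B p q \<ge> ereal (max r s)}"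
        have "ereal r \<le> ereal (max r s)" "ereal s \<le> ereal (max r s)" by auto
        with q have "boundary_product F B p q \<ge> ereal r" "boundary_product F B p q \<ge> ereal s"
          by (auto intro: order_trans)
        with q r s show "q \<in> S \<inter> T" by blast
      qed
      then show "\<exists>r::real. {q \<in> gboundary F B. boundary_product F B p q \<ge> ereal r} \<subseteq> S \<inter> T"
        by blast
    qed
  next
    fix K assume K: "\<forall>S\<in>K. boundary_open F B S"
    show "boundary_open F B (\<Union>K)"
      unfolding boundary_open_def
    proof (intro conjI ballI)
      show "\<Union>K \<subseteq> gboundary F B" using K unfolding boundary_open_def by blast
      fix p assume "p \<in> \<Union>K"
      then obtain S where S: "S \<in> K" "p \<in> S" by blast
      then obtain r :: real
        where "{q \<in> gboundary F B. boundary_product F B p q \<ge> ereal r} \<subseteq> S"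
        using K unfolding boundary_open_def by blast
      then show "\<exists>r::real. {q \<in> gboundary F B. boundary_product F B p q \<ge> ereal r} \<subseteq> \<Union>K"
        using S by blast
    qed
  qed
  then show ?thesis by (simp add: boundary_top_def)
qed

definition double_boundary_top ::
  "('a, 'b) monoid_scheme \<Rightarrow> 'a set \<Rightarrow> ('a bpoint \<times> 'a bpoint) topology" where
  "double_boundary_top F B =
     subtopology (prod_topology (boundary_top F B) (boundary_top F B)) {(p, q). p \<noteq> q}"

text \<open>The extension to the boundary of a self-map \<open>f\<close> of \<open>F\<close>, used for automorphisms and
  for left translations.\<close>

definition boundary_map ::
  "('a, 'b) monoid_scheme \<Rightarrow> 'a set \<Rightarrow> ('a \<Rightarrow> 'a) \<Rightarrow> 'a bpoint \<Rightarrow> 'a bpoint" where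
  "boundary_map F B f p = (\<Union>x \<in> p. boundary_limit F B (f \<circ> x))"

definition double_boundary_map ::
  "('a, 'b) monoid_scheme \<Rightarrow> 'a set \<Rightarrow> ('a \<Rightarrow> 'a) \<Rightarrow>
     'a bpoint \<times> 'a bpoint \<Rightarrow> 'a bpoint \<times> 'a bpoint" where
  "double_boundary_map F B f = map_prod (boundary_map F B f) (boundary_map F B f)"


section \<open>Geodesic currents\<close>

type_synonym 'a current = "('a bpoint \<times> 'a bpoint) measure"

definition radon_measure :: "'x topology \<Rightarrow> 'x measure \<Rightarrow> bool" where
  "radon_measure X \<nu> \<longleftrightarrow>
     space \<nu> = topspace X \<and> sets \<nu> = borel_sets X \<and>
     (\<forall>K. compactin X K \<longrightarrow> emeasure \<nu> K < \<infinity>) \<and>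
     (\<forall>S \<in> borel_sets X. emeasure \<nu> S = (SUP K \<in> {K. compactin X K \<and> K \<subseteq> S}. emeasure \<nu> K))"

definition currents :: "('a, 'b) monoid_scheme \<Rightarrow> 'a set \<Rightarrow> 'a current set" where
  "currents F B =
     {\<nu>. radon_measure (double_boundary_top F B) \<nu> \<and>
         (\<forall>h \<in> carrier F. \<forall>S \<in> sets \<nu>.
            emeasure \<nu> (double_boundary_map F B (\<lambda>x. h \<otimes>\<^bsub>F\<^esub> x) ` S) = emeasure \<nu> S) \<and>
         (\<forall>S \<in> sets \<nu>. emeasure \<nu> (prod.swap ` S) = emeasure \<nu> S)}"

definition disjoint_clopens ::
  "('a, 'b) monoid_scheme \<Rightarrow> 'a set \<Rightarrow> ('a bpoint set \<times> 'a bpoint set) set" where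
  "disjoint_clopens F B =
     {(S, S'). openin (boundary_top F B) S \<and> closedin (boundary_top F B) S \<and>
               openin (boundary_top F B) S' \<and> closedin (boundary_top F B) S' \<and> S \<inter> S' = {}}"

text \<open>The coarsest topology for which \<open>\<nu> \<mapsto> \<nu>(S \<times> S')\<close> is continuous for all disjoint
  closed-open \<open>S\<close>, \<open>S'\<close>.\<close>

definition Curr :: "('a, 'b) monoid_scheme \<Rightarrow> 'a set \<Rightarrow> 'a current topology" where
  "Curr F B =
     pullback_topology (currents F B)
       (\<lambda>\<nu>. \<lambda>(S, S') \<in> disjoint_clopens F B. measure \<nu> (S \<times> S'))
       (product_topology (\<lambda>_. euclideanreal) (disjoint_clopens F B))"

definition nonzero_measure :: "'x measure \<Rightarrow> bool" where
  "nonzero_measure \<nu> \<longleftrightarrow> emeasure \<nu> (space \<nu>) \<noteq> 0"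

definition proj_measure :: "'x measure \<Rightarrow> 'x measure set" where
  "proj_measure \<nu> = {scale_measure (ennreal c) \<nu> | c::real. c > 0}"

definition PCurr :: "('a, 'b) monoid_scheme \<Rightarrow> 'a set \<Rightarrow> 'a current set topology" where
  "PCurr F B = quotient_topology (subtopology (Curr F B) {\<nu>. nonzero_measure \<nu>}) proj_measure"

definition aut_current ::
  "('a, 'b) monoid_scheme \<Rightarrow> 'a set \<Rightarrow> ('a \<Rightarrow> 'a) \<Rightarrow> 'a current \<Rightarrow> 'a current" where
  "aut_current F B \<phi> \<nu> =
     distr \<nu> (borel_space (double_boundary_top F B)) (double_boundary_map F B \<phi>)"

definition out_PCurr ::
  "('a, 'b) monoid_scheme \<Rightarrow> 'a set \<Rightarrow> ('a \<Rightarrow> 'a) set \<Rightarrow>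
     'a current set \<Rightarrow> 'a current set" where
  "out_PCurr F B = class_action (aut_current F B)"


section \<open>Rational currents\<close>

definition pos_end :: "('a, 'b) monoid_scheme \<Rightarrow> 'a set \<Rightarrow> 'a \<Rightarrow> 'a bpoint" where
  "pos_end F B g = boundary_limit F B (\<lambda>n. g [^]\<^bsub>F\<^esub> n)"

definition neg_end :: "('a, 'b) monoid_scheme \<Rightarrow> 'a set \<Rightarrow> 'a \<Rightarrow> 'a bpoint" where
  "neg_end F B g = pos_end F B (inv\<^bsub>F\<^esub> g)"

text \<open>The integral against counting measure is the (possibly infinite) sum over the conjugacy
  class; the two indicators are the Dirac masses at \<open>(h_-, h_+)\<close> and \<open>(h_+, h_-)\<close>.\<close>

definition counting_current :: "('a, 'b) monoid_scheme \<Rightarrow> 'a set \<Rightarrow> 'a \<Rightarrow> 'a current" where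
  "counting_current F B g =
     measure_of (topspace (double_boundary_top F B)) (borel_sets (double_boundary_top F B))
       (\<lambda>S. \<integral>\<^sup>+ h. (indicator S (neg_end F B h, pos_end F B h)
                    + indicator S (pos_end F B h, neg_end F B h)) \<partial>count_space (conj_class F g))"

definition rational_current :: "('a, 'b) monoid_scheme \<Rightarrow> 'a set \<Rightarrow> 'a \<Rightarrow> 'a current" where
  "rational_current F B g =
     (if \<not> proper_power F g then counting_current F B g
      else let (f, m) = (SOME (f, m). f \<in> carrier F \<and> \<not> proper_power F f \<and> m > (1::nat) \<and>
                                      g = f [^]\<^bsub>F\<^esub> m)
           in scale_measure (of_nat m) (counting_current F B f))"

definition M_PCurr :: "('a, 'b) monoid_scheme \<Rightarrow> 'a set \<Rightarrow> 'a current set set" where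
  "M_PCurr F B =
     PCurr F B closure_of {proj_measure (rational_current F B g) | g. primitive_elt F g}"


section \<open>Outer space and its boundary\<close>

text \<open>A real tree is a metric space in which any two points \<open>x\<close>, \<open>y\<close> are joined by an isometric
  copy \<open>\<gamma>\<close> of an interval, which is the image of every arc from \<open>x\<close> to \<open>y\<close>.\<close>

definition real_tree :: "'p set \<Rightarrow> ('p \<Rightarrow> 'p \<Rightarrow> real) \<Rightarrow> bool" where
  "real_tree T d \<longleftrightarrow>
     Metric_space T d \<and> T \<noteq> {} \<and>
     (\<forall>x \<in> T. \<forall>y \<in> T. \<exists>\<gamma>.
        \<gamma> ` {0..d x y} \<subseteq> T \<and> \<gamma> 0 = x \<and> \<gamma> (d x y) = y \<and>
        (\<forall>s \<in> {0..d x y}. \<forall>t \<in> {0..d x y}. d (\<gamma> s) (\<gamma> t) = \<bar>s - t\<bar>) \<and>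
        (\<forall>c. pathin (Metric_space.mtopology T d) c \<and> inj_on c {0..1} \<and> c 0 = x \<and> c 1 = y
             \<longrightarrow> c ` {0..1} = \<gamma> ` {0..d x y}))"

definition isometric_action ::
  "('a, 'b) monoid_scheme \<Rightarrow> 'p set \<Rightarrow> ('p \<Rightarrow> 'p \<Rightarrow> real) \<Rightarrow> ('a \<Rightarrow> 'p \<Rightarrow> 'p) \<Rightarrow> bool" where
  "isometric_action F T d \<rho> \<longleftrightarrow>
     group_action F T \<rho> \<and>
     (\<forall>g \<in> carrier F. \<forall>x \<in> T. \<forall>y \<in> T. d (\<rho> g x) (\<rho> g y) = d x y)"

definition minimal_action ::
  "('a, 'b) monoid_scheme \<Rightarrow> 'p set \<Rightarrow> ('p \<Rightarrow> 'p \<Rightarrow> real) \<Rightarrow> ('a \<Rightarrow> 'p \<Rightarrow> 'p) \<Rightarrow> bool" where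
  "minimal_action F T d \<rho> \<longleftrightarrow>
     (\<forall>S. S \<subseteq> T \<and> S \<noteq> {} \<and> connectedin (Metric_space.mtopology T d) S \<and>
          (\<forall>g \<in> carrier F. \<rho> g ` S \<subseteq> S) \<longrightarrow> S = T)"

definition free_action :: "('a, 'b) monoid_scheme \<Rightarrow> 'p set \<Rightarrow> ('a \<Rightarrow> 'p \<Rightarrow> 'p) \<Rightarrow> bool" where
  "free_action F T \<rho> \<longleftrightarrow> (\<forall>g \<in> carrier F. \<forall>x \<in> T. \<rho> g x = x \<longrightarrow> g = \<one>\<^bsub>F\<^esub>)"

text \<open>Discreteness means that every orbit is a discrete subset of the tree.\<close>

definition discrete_action ::
  "('a, 'b) monoid_scheme \<Rightarrow> 'p set \<Rightarrow> ('p \<Rightarrow> 'p \<Rightarrow> real) \<Rightarrow> ('a \<Rightarrow> 'p \<Rightarrow> 'p) \<Rightarrow> bool" where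
  "discrete_action F T d \<rho> \<longleftrightarrow>
     (\<forall>x \<in> T. \<exists>\<epsilon> > 0. \<forall>g \<in> carrier F. \<rho> g x \<noteq> x \<longrightarrow> \<epsilon> \<le> d x (\<rho> g x))"

definition translation_length ::
  "('a, 'b) monoid_scheme \<Rightarrow> 'p set \<Rightarrow> ('p \<Rightarrow> 'p \<Rightarrow> real) \<Rightarrow> ('a \<Rightarrow> 'p \<Rightarrow> 'p) \<Rightarrow> 'a \<Rightarrow> real" where
  "translation_length F T d \<rho> = (\<lambda>g \<in> carrier F. INF x \<in> T. d x (\<rho> g x))"

text \<open>The points of the trees are taken from the type \<open>real\<close>. This is no restriction for a
  nontrivial finitely generated free group: a minimal free tree is the union of the countably
  many axes of its nontrivial elements, so it has the cardinality of the continuum.\<close>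

definition cv :: "('a, 'b) monoid_scheme \<Rightarrow> ('a \<Rightarrow> real) set" where
  "cv F =
     {translation_length F T d \<rho> | (T :: real set) d \<rho>.
        real_tree T d \<and> isometric_action F T d \<rho> \<and> minimal_action F T d \<rho> \<and>
        free_action F T \<rho> \<and> discrete_action F T d \<rho>}"

definition proj_function :: "('a, 'b) monoid_scheme \<Rightarrow> ('a \<Rightarrow> real) \<Rightarrow> ('a \<Rightarrow> real) set" where
  "proj_function F l = {(\<lambda>w \<in> carrier F. c * l w) | c::real. c \<noteq> 0}"

definition PR :: "('a, 'b) monoid_scheme \<Rightarrow> ('a \<Rightarrow> real) set topology" where
  "PR F =
     quotient_topology
       (subtopology (product_topology (\<lambda>_. euclideanreal) (carrier F))
          (- {\<lambda>w \<in> carrier F. 0}))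
       (proj_function F)"

definition CV :: "('a, 'b) monoid_scheme \<Rightarrow> ('a \<Rightarrow> real) set set" where
  "CV F = proj_function F ` cv F"

definition boundary_CV :: "('a, 'b) monoid_scheme \<Rightarrow> ('a \<Rightarrow> real) set set" where
  "boundary_CV F = (PR F closure_of CV F) - CV F"

definition aut_function ::
  "('a, 'b) monoid_scheme \<Rightarrow> ('a \<Rightarrow> 'a) \<Rightarrow> ('a \<Rightarrow> real) \<Rightarrow> ('a \<Rightarrow> real)" where
  "aut_function F \<phi> l = (\<lambda>w \<in> carrier F. l (inv_into (carrier F) \<phi> w))"

definition out_PR ::
  "('a, 'b) monoid_scheme \<Rightarrow> ('a \<Rightarrow> 'a) set \<Rightarrow> ('a \<Rightarrow> real) set \<Rightarrow> ('a \<Rightarrow> real) set" where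
  "out_PR F = class_action (aut_function F)"

end

theory Submission
  imports Defs "HOL-Algebra.Elementary_Groups"
begin

text \<open>
  An equivariant or anti-equivariant map carries a point fixed by a subgroup of the outer
  automorphism group to a point fixed by the same subgroup. The class of the rational current
  \<open>\<mu>\<^sub>a\<close> of a basis element \<open>a\<close> is fixed by every outer class that has a representative fixing
  \<open>a\<close>. The theorem holds because this stabiliser is too large to fix a point in the closure of
  outer space.

  For suppose that the projective class of a function \<open>f \<noteq> 0\<close> in the closure is fixed, so that
  \<open>f (\<phi> w) = c\<^sub>\<phi> f w\<close> for all automorphisms \<open>\<phi>\<close> with \<open>\<phi> a = a\<close>. Let \<open>y\<close> be any basis
  element. As the rank is at least three, there is a basis element \<open>b\<close> different from \<open>a\<close> and
  \<open>y\<close>, and the transvection \<open>b \<mapsto> b y\<close> fixes both \<open>a\<close> and \<open>y\<close>. If \<open>f y \<noteq> 0\<close>, its factor must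
  be \<open>1\<close>, hence \<open>f (b y) = f b = f (b y\<^sup>-\<^sup>1)\<close>. But translation lengths of a free action on a tree
  satisfy \<open>\<parallel>g\<parallel> + \<parallel>h\<parallel> \<le> max \<parallel>g h\<parallel> \<parallel>g h\<^sup>-\<^sup>1\<parallel>\<close> (\<open>tlen_product_max_if_free\<close>), an inequality that
  survives limits and scaling and contradicts \<open>f y \<noteq> 0\<close>. So \<open>f\<close> vanishes on the basis. A second
  use of transvections makes it vanish on the product, in one of the two orders, of any two distinct
  basis elements. By a quantitative form of Serre's fixed point lemma (\<open>tlen_word_bound\<close>),
  translation lengths on words of length \<open>n\<close> are at most \<open>4 n\<close> times the maximum over such elements
  and products; this too survives limits, and gives \<open>f = 0\<close>, a contradiction
  (\<open>no_invariant_function\<close>).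

  Both inequalities are proved with Gromov products. A real tree satisfies the four point
  inequality, so for a fixed base point \<open>p\<close> the Gromov products of the orbit points \<open>g p\<close> form an
  ultrametric; whenever the directions from \<open>p\<close> to both \<open>g p\<close> and \<open>g\<^sup>-\<^sup>1 p\<close> coincide, moving \<open>p\<close> that way
  shortens the displacement of \<open>g\<close>. A base point that almost minimises the relevant displacements
  leaves little room for this, and so the paths that belong to products have almost no
  backtracking.

  It remains to see that \<open>\<mu>\<^sub>a\<close> is a geodesic current and that its class is fixed
  (\<open>counting_current_in_currents\<close>, \<open>counting_current_automorphism_invariant\<close>). In the Cayley tree
  of a basis, the Gromov product of two elements is the length of the common prefix of their
  reduced words. The boundary is therefore an ultrametric space on which translations and
  automorphisms act by homeomorphisms, and only finitely many translates of the axis of \<open>a\<close> pass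
  near the identity, so that the atoms of \<open>\<mu>\<^sub>a\<close> are locally finite.
\<close>

section \<open>Real trees\<close>

text \<open>The two geodesics together form an arc. In a real tree every arc between two points is the
  geodesic between them, so the common point lies on that geodesic.\<close>

lemma concat_geodesics:
  assumes T: "real_tree T d"
    and eta: "\<eta> ` {0..a} \<subseteq> T" "\<And>s t. s \<in> {0..a} \<Longrightarrow> t \<in> {0..a} \<Longrightarrow> d (\<eta> s) (\<eta> t) = \<bar>s - t\<bar>"
    and gam: "\<gamma> ` {0..b} \<subseteq> T" "\<And>s t. s \<in> {0..b} \<Longrightarrow> t \<in> {0..b} \<Longrightarrow> d (\<gamma> s) (\<gamma> t) = \<bar>s - t\<bar>"
    and ab: "0 \<le> a" "0 \<le> b" and meet: "\<eta> a = \<gamma> 0"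
    and only: "\<And>s t. 0 \<le> s \<Longrightarrow> s < a \<Longrightarrow> t \<in> {0..b} \<Longrightarrow> \<eta> s \<noteq> \<gamma> t"
  shows "d (\<eta> 0) (\<gamma> b) = a + b"
proof (cases "a + b = 0")
  case True
  then have "a = 0" "b = 0" using ab by auto
  then show ?thesis using meet gam(2)[of 0 0] by auto
next
  case False
  then have pos: "a + b > 0" using ab by linarith
  interpret Metric_space T d using T by (simp add: real_tree_def)
  define c where "c u = (if u * (a + b) \<le> a then \<eta> (u * (a + b)) else \<gamma> (u * (a + b) - a))" for u
  have rng: "0 \<le> u * (a + b) \<and> u * (a + b) \<le> a + b" if "u \<in> {0..1}" for u
    using that pos by (auto simp: mult_left_le_one_le)
  have cT: "c u \<in> T" if "u \<in> {0..1}" for u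
    using rng[OF that] eta(1) gam(1) by (auto simp: c_def image_subset_iff)
  have etaT: "\<eta> s \<in> T" if "s \<in> {0..a}" for s using eta(1) that by auto
  have gamT: "\<gamma> s \<in> T" if "s \<in> {0..b}" for s using gam(1) that by auto
  have lip1: "d (c u) (c v) \<le> (a + b) * (v - u)"
    if u: "u \<in> {0..1}" and v: "v \<in> {0..1}" and "u \<le> v" for u v
  proof -
    have uv: "u * (a + b) \<le> v * (a + b)" using that(3) pos by (simp add: mult_right_mono)
    consider "v * (a + b) \<le> a" | "u * (a + b) \<le> a" "v * (a + b) > a" | "u * (a + b) > a"
      using uv by linarith
    then show ?thesis
    proof cases
      case 1
      then show ?thesis using rng[OF u] rng[OF v] uv
        by (simp add: c_def eta(2) algebra_simps)
    next
      case 2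
      have "d (c u) (c v) \<le> d (c u) (\<eta> a) + d (\<eta> a) (c v)"
        by (rule triangle) (use cT u v etaT ab in auto)
      also have "\<dots> = (a - u * (a + b)) + (v * (a + b) - a)"
        using 2 rng[OF u] rng[OF v] ab by (simp add: c_def eta(2)) (simp add: meet gam(2))
      finally show ?thesis by (simp add: algebra_simps)
    next
      case 3
      then show ?thesis using rng[OF u] rng[OF v] uv
        by (simp add: c_def gam(2) algebra_simps)
    qed
  qed
  have lip: "d (c u) (c v) \<le> (a + b) * \<bar>u - v\<bar>" if "u \<in> {0..1}" "v \<in> {0..1}" for u v
    using lip1[of u v] lip1[of v u] that commute[of "c u" "c v"] by (cases "u \<le> v") auto
  have path: "pathin mtopology c"
    unfolding pathin_def continuous_map_to_metric
  proof (intro ballI allI impI)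
    fix u :: real and \<epsilon> :: real assume u: "u \<in> topspace (top_of_set {0..1})" and "0 < \<epsilon>"
    let ?U = "{0..1} \<inter> ball u (\<epsilon> / (a + b))"
    have "c v \<in> mball (c u) \<epsilon>" if "v \<in> ?U" for v
    proof -
      have "\<bar>u - v\<bar> < \<epsilon> / (a + b)" using that by (simp add: dist_real_def)
      then have "(a + b) * \<bar>u - v\<bar> < \<epsilon>" using pos by (simp add: field_simps)
      then have "d (c u) (c v) < \<epsilon>" using lip[of u v] u that by auto
      then show ?thesis using cT u that by auto
    qed
    moreover have "openin (top_of_set {0..1}) ?U" by auto
    moreover have "u \<in> ?U" using u \<open>0 < \<epsilon>\<close> pos by auto
    ultimately show "\<exists>U. openin (top_of_set {0..1}) U \<and> u \<in> U \<and> (\<forall>y\<in>U. c y \<in> mball (c u) \<epsilon>)"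
      by blast
  qed
  have ne1: "c u \<noteq> c v" if u: "u \<in> {0..1}" and v: "v \<in> {0..1}" and "u < v" for u v
  proof -
    have uv: "u * (a + b) < v * (a + b)" using that(3) pos by simp
    consider "v * (a + b) \<le> a" | "u * (a + b) < a" "v * (a + b) > a" | "u * (a + b) = a" "v * (a + b) > a"
      | "u * (a + b) > a"
      using uv by linarith
    then show ?thesis
    proof cases
      case 1
      then have "d (c u) (c v) \<noteq> 0" using rng[OF u] rng[OF v] uv that(3) by (simp add: c_def eta(2))
      then show ?thesis using cT[OF u] by auto
    next
      case 2
      then show ?thesis using rng[OF u] rng[OF v] by (simp add: c_def only)
    next
      case 3
      then have "d (c u) (c v) \<noteq> 0" using rng[OF u] rng[OF v] uv that(3) ab by (simp add: c_def gam(2) meet)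
      then show ?thesis using cT[OF u] by auto
    next
      case 4
      then have "d (c u) (c v) \<noteq> 0" using rng[OF u] rng[OF v] uv that(3) by (simp add: c_def gam(2))
      then show ?thesis using cT[OF u] by auto
    qed
  qed
  have inj: "inj_on c {0..1}"
  proof (rule inj_onI)
    fix u v assume "u \<in> {0..1}" "v \<in> {0..1}" "c u = c v"
    then show "u = v" using ne1[of u v] ne1[of v u] by (cases u v rule: linorder_cases) auto
  qed
  have c0: "c 0 = \<eta> 0" using ab by (simp add: c_def)
  have c1: "c 1 = \<gamma> b" using ab meet by (auto simp: c_def)
  obtain \<delta> where del: "\<delta> 0 = \<eta> 0" "\<delta> (d (\<eta> 0) (\<gamma> b)) = \<gamma> b"
      "\<forall>s\<in>{0..d (\<eta> 0) (\<gamma> b)}. \<forall>t\<in>{0..d (\<eta> 0) (\<gamma> b)}. d (\<delta> s) (\<delta> t) = \<bar>s - t\<bar>"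
      "c ` {0..1} = \<delta> ` {0..d (\<eta> 0) (\<gamma> b)}"
    using T etaT[of 0] gamT[of b] ab path inj c0 c1 unfolding real_tree_def by (meson atLeastAtMost_iff order_refl)
  have "c (a / (a + b)) = \<eta> a" using pos by (simp add: c_def)
  moreover have "a / (a + b) \<in> {0..1}" using ab pos by auto
  ultimately have "\<eta> a \<in> \<delta> ` {0..d (\<eta> 0) (\<gamma> b)}" using del(4) by (metis imageI)
  then obtain t where t: "t \<in> {0..d (\<eta> 0) (\<gamma> b)}" "\<eta> a = \<delta> t" by auto
  have "d (\<eta> 0) (\<eta> a) = t" using del(1,3) t by (metis abs_minus_commute abs_of_nonneg atLeastAtMost_iff diff_zero nonneg order_refl)
  moreover have "d (\<eta> a) (\<gamma> b) = d (\<eta> 0) (\<gamma> b) - t" using del(2,3) t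
    by (metis abs_minus_commute abs_of_nonneg atLeastAtMost_iff diff_ge_0_iff_ge nonneg order_refl)
  moreover have "d (\<eta> 0) (\<eta> a) = a" using eta(2)[of 0 a] ab by auto
  moreover have "d (\<eta> a) (\<gamma> b) = b" using gam(2)[of 0 b] ab meet by auto
  ultimately show ?thesis by linarith
qed

text \<open>A point \<open>\<gamma> t\<close> of the segment that is closest to \<open>z\<close> is the only point that the geodesic from
  \<open>z\<close> to \<open>\<gamma> t\<close> shares with the segment, so this geodesic can be prolonged along the segment in
  both directions.\<close>

lemma real_tree_projection:
  assumes T: "real_tree T d" and z: "z \<in> T" and D: "0 \<le> D"
    and gam: "\<gamma> ` {0..D} \<subseteq> T" "\<And>s t. s \<in> {0..D} \<Longrightarrow> t \<in> {0..D} \<Longrightarrow> d (\<gamma> s) (\<gamma> t) = \<bar>s - t\<bar>"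
  shows "\<exists>t\<in>{0..D}. \<forall>s\<in>{0..D}. d z (\<gamma> s) = d z (\<gamma> t) + \<bar>s - t\<bar>"
proof -
  interpret Metric_space T d using T by (simp add: real_tree_def)
  have gT: "\<gamma> s \<in> T" if "s \<in> {0..D}" for s using gam(1) that by auto
  have "continuous_on {0..D} (\<lambda>s. d z (\<gamma> s))"
    unfolding continuous_on_iff
  proof (intro ballI allI impI)
    fix s e :: real assume s: "s \<in> {0..D}" and "0 < e"
    have "dist (d z (\<gamma> t)) (d z (\<gamma> s)) < e" if "t \<in> {0..D}" "dist t s < e" for t
    proof -
      have "d z (\<gamma> t) \<le> d z (\<gamma> s) + d (\<gamma> s) (\<gamma> t)" "d z (\<gamma> s) \<le> d z (\<gamma> t) + d (\<gamma> t) (\<gamma> s)"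
        using triangle z gT s that by blast+
      then show ?thesis using gam(2) s that by (auto simp: dist_real_def)
    qed
    then show "\<exists>da>0. \<forall>x'\<in>{0..D}. dist x' s < da \<longrightarrow> dist (d z (\<gamma> x')) (d z (\<gamma> s)) < e"
      using \<open>0 < e\<close> by blast
  qed
  then obtain t where t: "t \<in> {0..D}" and min: "\<And>s. s \<in> {0..D} \<Longrightarrow> d z (\<gamma> t) \<le> d z (\<gamma> s)"
    using continuous_attains_inf[of "{0..D}" "\<lambda>s. d z (\<gamma> s)"] D by auto
  define a where "a = d z (\<gamma> t)"
  obtain \<eta> where eta: "\<eta> ` {0..a} \<subseteq> T" "\<eta> 0 = z" "\<eta> a = \<gamma> t"
      "\<And>s t. s \<in> {0..a} \<Longrightarrow> t \<in> {0..a} \<Longrightarrow> d (\<eta> s) (\<eta> t) = \<bar>s - t\<bar>"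
    using T z gT[OF t] unfolding real_tree_def a_def by meson
  have away: "\<eta> s \<noteq> \<gamma> r" if "0 \<le> s" "s < a" "r \<in> {0..D}" for s r
  proof
    assume "\<eta> s = \<gamma> r"
    moreover have "d z (\<eta> s) = s" using eta(2) eta(4)[of 0 s] that by auto
    ultimately show False using min[OF that(3)] that a_def by auto
  qed
  have "d z (\<gamma> s) = d z (\<gamma> t) + \<bar>s - t\<bar>" if s: "s \<in> {0..D}" for s
  proof (cases "t \<le> s")
    case True
    have "d (\<eta> 0) ((\<lambda>r. \<gamma> (t + r)) (s - t)) = a + (s - t)"
    proof (rule concat_geodesics[OF T])
      show "(\<lambda>r. \<gamma> (t + r)) ` {0..s - t} \<subseteq> T" using gT t s by auto
      show "d (\<gamma> (t + x)) (\<gamma> (t + y)) = \<bar>x - y\<bar>" if "x \<in> {0..s - t}" "y \<in> {0..s - t}" for x y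
        using that t s by (subst gam(2)) auto
    qed (use eta a_def True t s away in auto)
    then show ?thesis using eta True by (auto simp: a_def)
  next
    case False
    have "d (\<eta> 0) ((\<lambda>r. \<gamma> (t - r)) (t - s)) = a + (t - s)"
    proof (rule concat_geodesics[OF T])
      show "(\<lambda>r. \<gamma> (t - r)) ` {0..t - s} \<subseteq> T" using gT t s by auto
      show "d (\<gamma> (t - x)) (\<gamma> (t - y)) = \<bar>x - y\<bar>" if "x \<in> {0..t - s}" "y \<in> {0..t - s}" for x y
        using that t s by (subst gam(2)) auto
    qed (use eta a_def False t s away in auto)
    then show ?thesis using eta False by (auto simp: a_def)
  qed
  then show ?thesis using t by blast
qed

lemma real_tree_geodesic:
  assumes T: "real_tree T d" and xy: "x \<in> T" "y \<in> T"
  obtains \<gamma> where "\<gamma> ` {0..d x y} \<subseteq> T" "\<gamma> 0 = x" "\<gamma> (d x y) = y"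
      "\<And>s t. s \<in> {0..d x y} \<Longrightarrow> t \<in> {0..d x y} \<Longrightarrow> d (\<gamma> s) (\<gamma> t) = \<bar>s - t\<bar>"
  using T xy unfolding real_tree_def by meson

text \<open>Project \<open>z\<close> and \<open>w\<close> to the segment from \<open>x\<close> to \<open>y\<close>. The path from \<open>z\<close> to \<open>w\<close> through the
  two projections is no longer than the order of the projections along the segment allows.\<close>

lemma real_tree_four_point:
  assumes T: "real_tree T d" and xyzw: "x \<in> T" "y \<in> T" "z \<in> T" "w \<in> T"
  shows "d x y + d z w \<le> max (d x z + d y w) (d x w + d y z)"
proof -
  interpret Metric_space T d using T by (simp add: real_tree_def)
  obtain \<gamma> where gam: "\<gamma> ` {0..d x y} \<subseteq> T" "\<gamma> 0 = x" "\<gamma> (d x y) = y"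
      "\<And>s t. s \<in> {0..d x y} \<Longrightarrow> t \<in> {0..d x y} \<Longrightarrow> d (\<gamma> s) (\<gamma> t) = \<bar>s - t\<bar>"
    using real_tree_geodesic[OF T xyzw(1,2)] by blast
  note pr = real_tree_projection[OF T _ nonneg gam(1) gam(4)]
  obtain s where s: "s \<in> {0..d x y}" "\<And>r. r \<in> {0..d x y} \<Longrightarrow> d z (\<gamma> r) = d z (\<gamma> s) + \<bar>r - s\<bar>"
    using pr[OF xyzw(3)] by blast
  obtain t where t: "t \<in> {0..d x y}" "\<And>r. r \<in> {0..d x y} \<Longrightarrow> d w (\<gamma> r) = d w (\<gamma> t) + \<bar>r - t\<bar>"
    using pr[OF xyzw(4)] by blast
  have z: "d x z = d z (\<gamma> s) + s" "d y z = d z (\<gamma> s) + (d x y - s)"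
    using s(1) s(2)[of 0] s(2)[of "d x y"] gam(2,3) commute by auto
  have w: "d x w = d w (\<gamma> t) + t" "d y w = d w (\<gamma> t) + (d x y - t)"
    using t(1) t(2)[of 0] t(2)[of "d x y"] gam(2,3) commute by auto
  have "d z w \<le> d z (\<gamma> t) + d (\<gamma> t) w"
    by (rule triangle) (use xyzw t gam(1) in auto)
  also have "\<dots> = d z (\<gamma> s) + \<bar>t - s\<bar> + d w (\<gamma> t)" using s(2) t(1) commute by auto
  finally show ?thesis using z w by linarith
qed

lemma real_tree_point_between:
  assumes T: "real_tree T d" and xy: "x \<in> T" "y \<in> T" and s: "0 \<le> s" "s \<le> d x y"
  obtains q where "q \<in> T" "d x q = s" "d q y = d x y - s"
proof -
  obtain \<gamma> where gam: "\<gamma> ` {0..d x y} \<subseteq> T" "\<gamma> 0 = x" "\<gamma> (d x y) = y"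
      "\<And>s t. s \<in> {0..d x y} \<Longrightarrow> t \<in> {0..d x y} \<Longrightarrow> d (\<gamma> s) (\<gamma> t) = \<bar>s - t\<bar>"
    using real_tree_geodesic[OF T xy] by blast
  show ?thesis
    by (rule that[of "\<gamma> s"]) (use gam(1) gam(4)[of 0 s] gam(4)[of s "d x y"] gam(2,3) s in auto)
qed

section \<open>Isometric actions on real trees\<close>

locale tree_action = group F for F (structure) +
  fixes T :: "'p set" and d :: "'p \<Rightarrow> 'p \<Rightarrow> real" and \<rho> :: "'a \<Rightarrow> 'p \<Rightarrow> 'p"
  assumes tree: "real_tree T d" and isom: "isometric_action F T d \<rho>"
begin

sublocale Metric_space T d using tree by (simp add: real_tree_def)

definition disp :: "'p \<Rightarrow> 'a \<Rightarrow> real" where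
  "disp p g = d p (\<rho> g p)"

text \<open>The Gromov product of \<open>g p\<close> and \<open>h p\<close> with respect to \<open>p\<close>: the length of the initial part that
  the segments from \<open>p\<close> to \<open>g p\<close> and to \<open>h p\<close> have in common.\<close>

definition gromov :: "'p \<Rightarrow> 'a \<Rightarrow> 'a \<Rightarrow> real" where
  "gromov p g h = (disp p g + disp p h - disp p (inv g \<otimes> h)) / 2"

lemma act_closed [simp]: "g \<in> carrier F \<Longrightarrow> p \<in> T \<Longrightarrow> \<rho> g p \<in> T"
  using isom group_action.element_image unfolding isometric_action_def by fast

lemma act_mult: "g \<in> carrier F \<Longrightarrow> h \<in> carrier F \<Longrightarrow> p \<in> T \<Longrightarrow> \<rho> (g \<otimes> h) p = \<rho> g (\<rho> h p)"
  using isom group_action.composition_rule unfolding isometric_action_def by fast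

lemma act_isom: "g \<in> carrier F \<Longrightarrow> p \<in> T \<Longrightarrow> q \<in> T \<Longrightarrow> d (\<rho> g p) (\<rho> g q) = d p q"
  using isom unfolding isometric_action_def by blast

lemma act_one [simp]: "p \<in> T \<Longrightarrow> \<rho> \<one> p = p"
  using isom group_action.id_eq_one unfolding isometric_action_def
  by (metis restrict_apply')

lemma dist_orbit:
  assumes "p \<in> T" "g \<in> carrier F" "h \<in> carrier F"
  shows "d (\<rho> g p) (\<rho> h p) = disp p (inv g \<otimes> h)"
proof -
  have "d (\<rho> g p) (\<rho> h p) = d (\<rho> (inv g) (\<rho> g p)) (\<rho> (inv g) (\<rho> h p))"
    using assms by (simp add: act_isom)
  also have "\<rho> (inv g) (\<rho> g p) = p" using assms by (simp flip: act_mult)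
  finally show ?thesis using assms by (simp add: disp_def act_mult)
qed

lemma disp_nonneg [simp]: "disp p g \<ge> 0"
  by (simp add: disp_def)

lemma disp_inv:
  assumes "p \<in> T" "g \<in> carrier F"
  shows "disp p (inv g) = disp p g"
  using dist_orbit[of p g \<one>] assms commute by (simp add: disp_def)

lemma disp_triangle:
  assumes "p \<in> T" "g \<in> carrier F" "h \<in> carrier F"
  shows "disp p (g \<otimes> h) \<le> disp p g + disp p h"
proof -
  have "d p (\<rho> g (\<rho> h p)) \<le> d p (\<rho> g p) + d (\<rho> g p) (\<rho> g (\<rho> h p))"
    using assms by (intro triangle) auto
  then show ?thesis using assms by (simp add: disp_def act_mult act_isom)
qed

lemma gromov_commute:
  assumes "p \<in> T" "g \<in> carrier F" "h \<in> carrier F"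
  shows "gromov p g h = gromov p h g"
  using disp_inv[of p "inv g \<otimes> h"] assms by (simp add: gromov_def inv_mult_group)

lemma gromov_ultrametric:
  assumes p: "p \<in> T" and ghk: "g \<in> carrier F" "h \<in> carrier F" "k \<in> carrier F"
  shows "min (gromov p g h) (gromov p h k) \<le> gromov p g k"
proof -
  have "d (\<rho> g p) (\<rho> k p) + d (\<rho> h p) p
      \<le> max (d (\<rho> g p) (\<rho> h p) + d (\<rho> k p) p) (d (\<rho> g p) p + d (\<rho> k p) (\<rho> h p))"
    using assms by (intro real_tree_four_point[OF tree]) auto
  moreover have "disp p (inv k \<otimes> h) = disp p (inv h \<otimes> k)"
    using disp_inv[of p "inv h \<otimes> k"] assms by (simp add: inv_mult_group)
  moreover have "d (\<rho> g p) p = disp p g" "d (\<rho> h p) p = disp p h" "d (\<rho> k p) p = disp p k"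
    using commute by (auto simp: disp_def)
  ultimately show ?thesis using assms by (simp add: gromov_def dist_orbit min_def max_def split: if_splits)
qed

text \<open>A local-to-global principle. The hypotheses say that the path from \<open>p\<close> through \<open>g p\<close>, \<open>g h p\<close>
  and \<open>g h g p\<close> to \<open>g h g h p\<close> backtracks by less than \<open>\<epsilon>\<close> at each of its corners while its edges
  have length at least \<open>2 \<epsilon>\<close>, hence it is almost geodesic. The right-hand side of the conclusion is
  a lower bound for the translation length of \<open>g h\<close>.\<close>

lemma disp_square_product:
  assumes p: "p \<in> T" and gh: "g \<in> carrier F" "h \<in> carrier F"
    and small: "gromov p (inv g) h < \<epsilon>" "gromov p g (inv h) < \<epsilon>"
    and large: "2 * \<epsilon> \<le> disp p g" "2 * \<epsilon> \<le> disp p h"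
  shows "disp p g + disp p h - 4 * \<epsilon> < disp p ((g \<otimes> h) \<otimes> (g \<otimes> h)) - disp p (g \<otimes> h)"
proof -
  define u where "u = g \<otimes> h"
  have u: "u \<in> carrier F" using gh u_def by auto
  have len2: "gromov p (inv g) h = (disp p g + disp p h - disp p u) / 2"
    using p gh by (simp add: gromov_def u_def disp_inv)
  then have len: "disp p u = disp p g + disp p h - 2 * gromov p (inv g) h" by simp
  have ug: "inv u \<otimes> g = inv h" using gh by (simp add: u_def inv_mult_group m_assoc)
  have uh: "u \<otimes> inv h = g" using gh by (simp add: u_def m_assoc)
  have "gromov p g u = (disp p u + disp p g - disp p h) / 2"
    using p gh u ug by (subst gromov_commute) (auto simp: gromov_def disp_inv)
  then have 1: "gromov p g u > \<epsilon>"
    using len small large by simp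
  have "gromov p (inv u) (inv h) = (disp p u + disp p h - disp p g) / 2"
    using p gh u uh by (auto simp: gromov_def disp_inv)
  then have 2: "gromov p (inv u) (inv h) > \<epsilon>"
    using len small large by simp
  have "min (gromov p g u) (gromov p u (inv u)) \<le> gromov p g (inv u)"
       "min (gromov p g (inv u)) (gromov p (inv u) (inv h)) \<le> gromov p g (inv h)"
    using gromov_ultrametric[OF p] gh u by auto
  then have "gromov p u (inv u) < \<epsilon>" using 1 2 small by linarith
  moreover have "gromov p u (inv u) = disp p u - disp p (u \<otimes> u) / 2"
  proof -
    have "inv u \<otimes> inv u = inv (u \<otimes> u)" using u by (simp add: inv_mult_group)
    then show ?thesis using p u by (simp add: gromov_def disp_inv)
  qed
  ultimately show ?thesis using len small unfolding u_def by linarith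
qed

text \<open>Once the displacement of \<open>g\<^sup>2\<close> exceeds that of \<open>g\<close>, the four point inequality for \<open>p\<close>, \<open>g p\<close>,
  \<open>g\<^sup>n\<^sup>+\<^sup>1 p\<close>, \<open>g\<^sup>n\<^sup>+\<^sup>2 p\<close> makes the displacements of the powers convex in the exponent.\<close>

lemma disp_pow_growth:
  assumes p: "p \<in> T" and g: "g \<in> carrier F" and hyp: "disp p g < disp p (g \<otimes> g)"
  shows "disp p (g [^] (n + 2 :: nat)) \<ge> disp p (g [^] (n + 1 :: nat)) + (disp p (g \<otimes> g) - disp p g)"
proof (induction n rule: less_induct)
  case (less n)
  show ?case
  proof (cases n)
    case 0
    then show ?thesis using g by (simp add: numeral_2_eq_2)
  next
    case (Suc m)
    have ge: "disp p (g [^] Suc k) \<ge> disp p g" if "k \<le> n" for k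
      using that
    proof (induction k)
      case (Suc k)
      have "k < n" using Suc.prems by simp
      then show ?case using less.IH[of k] Suc.IH Suc.prems hyp g by (simp add: numeral_2_eq_2)
    qed (use g in simp)
    have pw: "inv g \<otimes> g [^] Suc j = g [^] j" for j :: nat
      using g by (subst nat_pow_Suc2) (auto simp flip: m_assoc)
    have step: "disp p (g [^] (n + 1)) \<ge> disp p (g [^] n) + (disp p (g \<otimes> g) - disp p g)"
      using less.IH[of m] Suc by simp
    have "d p (\<rho> (g [^] (n + 1)) p) + d (\<rho> g p) (\<rho> (g [^] (n + 2)) p)
       \<le> max (d p (\<rho> g p) + d (\<rho> (g [^] (n + 1)) p) (\<rho> (g [^] (n + 2)) p))
             (d p (\<rho> (g [^] (n + 2)) p) + d (\<rho> (g [^] (n + 1)) p) (\<rho> g p))"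
      using p g by (intro real_tree_four_point[OF tree]) auto
    moreover have "d (\<rho> g p) (\<rho> (g [^] (n + 2)) p) = disp p (g [^] (n + 1))"
      using p g pw[of "n + 1"] by (simp add: dist_orbit)
    moreover have "d (\<rho> (g [^] (n + 1)) p) (\<rho> g p) = disp p (g [^] n)"
      using p g pw[of n] commute by (simp add: dist_orbit)
    moreover have "d (\<rho> (g [^] (n + 1)) p) (\<rho> (g [^] (n + 2)) p) = disp p g"
    proof -
      have "inv (g [^] (n + 1)) \<otimes> g [^] (n + 2) = g"
        using g by (simp add: inv_solve_left' m_assoc)
      then show ?thesis using p g by (simp only: dist_orbit nat_pow_closed)
    qed
    moreover have "disp p g \<le> disp p (g [^] n)" using ge[of m] Suc by simp
    ultimately show ?thesis
      using step hyp by (auto simp: disp_def[symmetric] max_def split: if_splits)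
  qed
qed

lemma disp_pow_le:
  assumes p: "p \<in> T" and g: "g \<in> carrier F"
  shows "disp p (g [^] (n :: nat)) \<le> n * disp p g"
proof (induction n)
  case 0
  then show ?case using p by (simp add: disp_def)
next
  case (Suc n)
  then show ?case using disp_triangle[of p "g [^] n" g] p g by (simp add: algebra_simps)
qed

lemma disp_change_point:
  assumes p: "p \<in> T" "q \<in> T" and g: "g \<in> carrier F"
  shows "disp p g \<le> 2 * d p q + disp q g"
proof -
  have "d p (\<rho> g p) \<le> d p q + d q (\<rho> g p)" "d q (\<rho> g p) \<le> d q (\<rho> g q) + d (\<rho> g q) (\<rho> g p)"
    using assms by (auto intro: triangle)
  then show ?thesis using assms commute by (simp add: disp_def act_isom)
qed

text \<open>If the left-hand side is positive, the displacement of \<open>g\<^sup>n\<close> at \<open>p\<close> grows in \<open>n\<close> at least at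
  this rate. At \<open>q\<close> it is at most \<open>n\<close> times the right-hand side, and displacements at \<open>p\<close> and \<open>q\<close>
  differ by a bounded amount.\<close>

lemma translation_le_disp:
  assumes p: "p \<in> T" and q: "q \<in> T" and g: "g \<in> carrier F"
  shows "disp p (g \<otimes> g) - disp p g \<le> disp q g"
proof (cases "disp p g < disp p (g \<otimes> g)")
  case True
  let ?t = "disp p (g \<otimes> g) - disp p g"
  have low: "n * ?t \<le> disp p (g [^] Suc n)" for n :: nat
  proof (induction n)
    case (Suc n)
    then show ?case using disp_pow_growth[OF p g True, of n] by (simp add: algebra_simps)
  qed simp
  have "n * (?t - disp q g) \<le> 2 * d p q + disp q g" for n :: nat
    using low[of n] disp_change_point[OF p q, of "g [^] Suc n"] disp_pow_le[OF q g, of "Suc n"] g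
    by (simp add: algebra_simps del: nat_pow_Suc)
  then have "?t - disp q g \<le> 0"
    by (metis not_le reals_Archimedean3)
  then show ?thesis by simp
qed (use disp_nonneg[of q g] in linarith)

definition tlen :: "'a \<Rightarrow> real" where "tlen = translation_length F T d \<rho>"

lemma tlen_le: "q \<in> T \<Longrightarrow> g \<in> carrier F \<Longrightarrow> tlen g \<le> disp q g"
  unfolding tlen_def translation_length_def disp_def
  by (auto intro!: cINF_lower bdd_belowI[of _ 0])

lemma tlen_ge:
  assumes "g \<in> carrier F" "\<And>q. q \<in> T \<Longrightarrow> t \<le> disp q g" shows "t \<le> tlen g"
  using assms tree unfolding tlen_def translation_length_def disp_def real_tree_def
  by (auto intro!: cINF_greatest)

lemma tlen_ge_square: "p \<in> T \<Longrightarrow> g \<in> carrier F \<Longrightarrow> disp p (g \<otimes> g) - disp p g \<le> tlen g"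
  by (auto intro: tlen_ge translation_le_disp)

lemma tlen_nonneg: "g \<in> carrier F \<Longrightarrow> 0 \<le> tlen g"
  by (auto intro: tlen_ge)

text \<open>When the segments from \<open>p\<close> to \<open>g p\<close> and to \<open>h p\<close> agree up to distance \<open>s\<close>, the point \<open>q\<close> at
  distance \<open>s\<close> towards \<open>g p\<close> is also on the way to \<open>h p\<close>.\<close>

lemma move_closer:
  assumes p: "p \<in> T" and gh: "g \<in> carrier F" "h \<in> carrier F" and q: "q \<in> T"
    and dq: "d p q = s" "d q (\<rho> g p) = disp p g - s" and s: "0 \<le> s" "s \<le> gromov p g h"
  shows "d q (\<rho> h p) \<le> disp p h - s"
proof -
  have "d q (\<rho> h p) + d p (\<rho> g p)
      \<le> max (d q p + d (\<rho> h p) (\<rho> g p)) (d q (\<rho> g p) + d (\<rho> h p) p)"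
    using assms by (intro real_tree_four_point[OF tree]) auto
  then show ?thesis using assms commute[of q p] commute[of p "\<rho> h p"] commute[of "\<rho> g p" "\<rho> h p"]
    by (auto simp: gromov_def dist_orbit disp_def[symmetric] max_def field_simps split: if_splits)
qed

lemma disp_move_one_side:
  assumes p: "p \<in> T" and h: "h \<in> carrier F" and q: "q \<in> T"
    and dq: "d p q = s" "d q (\<rho> h p) \<le> disp p h - s"
  shows "disp q h \<le> disp p h"
proof -
  have "d q (\<rho> h q) \<le> d q (\<rho> h p) + d (\<rho> h p) (\<rho> h q)" using assms by (intro triangle) auto
  then show ?thesis using assms by (simp add: act_isom disp_def)
qed

lemma disp_move_inv:
  assumes p: "p \<in> T" and h: "h \<in> carrier F" and q: "q \<in> T"
  shows "d q (\<rho> (inv h) p) = d (\<rho> h q) p"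
proof -
  have "d (\<rho> h q) (\<rho> h (\<rho> (inv h) p)) = d q (\<rho> (inv h) p)" using assms by (intro act_isom) auto
  moreover have "\<rho> h (\<rho> (inv h) p) = p" using assms by (simp flip: act_mult)
  ultimately show ?thesis by simp
qed

text \<open>If \<open>q\<close> lies both on the way to \<open>h p\<close> and on the way to \<open>h\<^sup>-\<^sup>1 p\<close>, then \<open>q\<close> is closer
  than \<open>p\<close> by \<open>s\<close> to the axis or to the fixed points of \<open>h\<close>.\<close>

lemma disp_move_both_sides:
  assumes p: "p \<in> T" and h: "h \<in> carrier F" and q: "q \<in> T"
    and dq: "d p q = s" "d q (\<rho> h p) \<le> disp p h - s" "d q (\<rho> (inv h) p) \<le> disp p h - s"
    and s: "2 * s \<le> disp p h"
  shows "disp q h \<le> disp p h - 2 * s"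
proof -
  have "d q (\<rho> h q) + d p (\<rho> h p) \<le> max (d q p + d (\<rho> h q) (\<rho> h p)) (d q (\<rho> h p) + d (\<rho> h q) p)"
    using assms by (intro real_tree_four_point[OF tree]) auto
  moreover have "d q p = s" using dq commute by simp
  moreover have "d (\<rho> h q) (\<rho> h p) = s" using \<open>d q p = s\<close> p h q by (simp add: act_isom)
  moreover have "d (\<rho> h q) p \<le> disp p h - s" using dq(3) disp_move_inv[OF p h q] by simp
  ultimately show ?thesis using dq(2) s by (simp add: disp_def)
qed

lemma point_towards:
  assumes p: "p \<in> T" and g: "g \<in> carrier F" and s: "0 \<le> s" "s \<le> disp p g"
  obtains q where "q \<in> T" "d p q = s" "d q (\<rho> g p) = disp p g - s"
  using real_tree_point_between[OF tree p act_closed[OF g p] s(1)] s(2) unfolding disp_def by metis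

text \<open>If the directions from \<open>p\<close> to \<open>g p\<close>, to \<open>g\<^sup>-\<^sup>1 p\<close> and to \<open>k p\<close> coincide, then moving in this
  direction shortens the displacement of \<open>g\<close> at both ends and does not lengthen that of \<open>k\<close>.\<close>

lemma sum_disp_decreases:
  assumes p: "p \<in> T" and gk: "g \<in> carrier F" "k \<in> carrier F"
    and s: "0 \<le> s" "s \<le> gromov p k g" "s \<le> gromov p k (inv g)" "2 * s \<le> disp p g" "2 * s \<le> disp p k"
  obtains q where "q \<in> T" "disp q g + disp q k \<le> disp p g + disp p k - 2 * s"
proof -
  obtain q where q: "q \<in> T" "d p q = s" "d q (\<rho> k p) = disp p k - s"
    using point_towards[OF p gk(2), of s] s by auto
  have "d q (\<rho> g p) \<le> disp p g - s" "d q (\<rho> (inv g) p) \<le> disp p g - s"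
    using move_closer[OF p gk(2,1) q s(1,2)] move_closer[OF p gk(2) _ q s(1,3)] gk disp_inv[OF p gk(1)]
    by auto
  then have "disp q g \<le> disp p g - 2 * s"
    using disp_move_both_sides[OF p gk(1) q(1,2)] s by auto
  moreover have "disp q k \<le> disp p k"
    using disp_move_one_side[OF p gk(2) q(1,2)] q(3) by simp
  ultimately show ?thesis using that q(1) by force
qed

lemma disp_pos_if_free:
  assumes free: "free_action F T \<rho>" and g: "g \<in> carrier F" "g \<noteq> \<one>" and p: "p \<in> T"
  shows "0 < disp p g"
  using assms unfolding free_action_def disp_def by (metis act_closed mdist_pos_eq)

text \<open>Otherwise \<open>p\<close> would be carried to \<open>g p\<close> and \<open>g\<^sup>-\<^sup>1 p\<close> in the same direction for half of the way,
  and the midpoint of \<open>p\<close> and \<open>g p\<close> would be fixed by \<open>g\<close>.\<close>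

lemma disp_square_gt_if_free:
  assumes free: "free_action F T \<rho>" and g: "g \<in> carrier F" "g \<noteq> \<one>" and p: "p \<in> T"
  shows "disp p g < disp p (g \<otimes> g)"
proof (rule ccontr)
  assume "\<not> ?thesis"
  then have le: "disp p (g \<otimes> g) \<le> disp p g" by simp
  let ?s = "disp p g / 2"
  obtain q where q: "q \<in> T" "d p q = ?s" "d q (\<rho> g p) = disp p g - ?s"
    using point_towards[OF p g(1), of ?s] by auto
  have "gromov p g (inv g) \<ge> ?s"
  proof -
    have "inv g \<otimes> inv g = inv (g \<otimes> g)" using g by (simp add: inv_mult_group)
    then show ?thesis using le p g by (simp add: gromov_def disp_inv)
  qed
  then have "d q (\<rho> (inv g) p) \<le> disp p g - ?s"
    using move_closer[OF p g(1) _ q, of "inv g"] g disp_inv[OF p g(1)] by simp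
  then have "disp q g \<le> disp p g - 2 * ?s"
    using disp_move_both_sides[OF p g(1) q(1,2)] q(3) by simp
  then show False using disp_pos_if_free[OF free g q(1)] by simp
qed

text \<open>Choose \<open>p\<close> such that the sum of the displacements of \<open>g\<close> and \<open>h\<close> is almost minimal. No
  three of the directions to \<open>g p\<close>, \<open>g\<^sup>-\<^sup>1 p\<close>, \<open>h p\<close>, \<open>h\<^sup>-\<^sup>1 p\<close> can coincide for long, and so the path
  for \<open>g h\<close> or that for \<open>g h\<^sup>-\<^sup>1\<close> has almost no backtracking.\<close>

theorem tlen_product_max_if_free:
  assumes free: "free_action F T \<rho>" and gh: "g \<in> carrier F" "h \<in> carrier F"
  shows "tlen g + tlen h \<le> max (tlen (g \<otimes> h)) (tlen (g \<otimes> inv h))"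
proof -
  have one: "tlen \<one> = 0"
  proof -
    obtain p where "p \<in> T" using tree by (auto simp: real_tree_def)
    then have "tlen \<one> \<le> 0" using tlen_le[of p \<one>] by (simp add: disp_def)
    then show ?thesis using tlen_nonneg[of \<one>] by simp
  qed
  have tinv: "tlen (inv h) = tlen h"
    unfolding tlen_def translation_length_def using gh disp_inv
    by (auto simp: disp_def intro!: INF_cong)
  show ?thesis
  proof (cases "g = \<one> \<or> h = \<one>")
    case True
    then show ?thesis using one gh tinv by auto
  next
    case False
    have ex: "\<exists>p\<in>T. True" using tree by (auto simp: real_tree_def)
    have pos: "0 < tlen g" "0 < tlen h"
    proof -
      obtain p where "p \<in> T" using ex by blast
      then show "0 < tlen g" "0 < tlen h"
        using disp_square_gt_if_free[OF free _ _ \<open>p \<in> T\<close>] tlen_ge_square[OF \<open>p \<in> T\<close>] False gh by fastforce+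
    qed
    have main: "tlen g + tlen h - 4 * \<epsilon> \<le> max (tlen (g \<otimes> h)) (tlen (g \<otimes> inv h))"
      if eps: "0 < \<epsilon>" "2 * \<epsilon> \<le> tlen g" "2 * \<epsilon> \<le> tlen h" for \<epsilon>
    proof -
      define S where "S p = disp p g + disp p h" for p
      have bdd: "bdd_below (S ` T)" by (auto simp: S_def intro!: bdd_belowI[of _ 0])
      obtain p where p: "p \<in> T" "S p < (INF p\<in>T. S p) + \<epsilon>"
      proof -
        have "(INF p\<in>T. S p) < (INF p\<in>T. S p) + \<epsilon>" "S ` T \<noteq> {}" using eps(1) ex by auto
        from cInf_lessD[OF this(2,1)] show ?thesis using that by blast
      qed
      have near: "S p < S q + \<epsilon>" if "q \<in> T" for q
        using p(2) cINF_lower[OF bdd that] by linarith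
      have big: "2 * \<epsilon> \<le> disp p g" "2 * \<epsilon> \<le> disp p h" using eps tlen_le[OF p(1) gh(1)] tlen_le[OF p(1) gh(2)] by linarith+
      \<comment> \<open>the directions to \<open>k p\<close>, \<open>x p\<close> and \<open>x\<^sup>-\<^sup>1 p\<close> cannot coincide up to distance \<open>\<epsilon>\<close>\<close>
      have no: False
        if a: "x \<in> carrier F" "k \<in> carrier F" "\<epsilon> \<le> gromov p k x" "\<epsilon> \<le> gromov p k (inv x)"
          "2 * \<epsilon> \<le> disp p x" "2 * \<epsilon> \<le> disp p k" "\<And>q. q \<in> T \<Longrightarrow> disp q x + disp q k = S q" for x k
      proof -
        obtain q where "q \<in> T" "disp q x + disp q k \<le> disp p x + disp p k - 2 * \<epsilon>"
          using sum_disp_decreases[OF p(1) a(1,2) less_imp_le[OF eps(1)] a(3-6)] by blast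
        then show False using a(7)[of q] a(7)[OF p(1)] near[of q] eps(1) by linarith
      qed
      have com: "gromov p x k = gromov p k x" if "x \<in> carrier F" "k \<in> carrier F" for x k
        using gromov_commute p that by blast
      have "\<not> (\<epsilon> \<le> gromov p h g \<and> \<epsilon> \<le> gromov p h (inv g))"
        using no[of g h] gh big by (auto simp: S_def)
      moreover have "\<not> (\<epsilon> \<le> gromov p (inv g) h \<and> \<epsilon> \<le> gromov p (inv g) (inv h))"
        using no[of h "inv g"] gh big by (auto simp: S_def disp_inv p)
      moreover have "\<not> (\<epsilon> \<le> gromov p g h \<and> \<epsilon> \<le> gromov p g (inv h))"
        using no[of h g] gh big by (auto simp: S_def)
      moreover have "\<not> (\<epsilon> \<le> gromov p (inv h) g \<and> \<epsilon> \<le> gromov p (inv h) (inv g))"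
        using no[of g "inv h"] gh big by (auto simp: S_def disp_inv p)
      ultimately have "gromov p (inv g) h < \<epsilon> \<and> gromov p g (inv h) < \<epsilon>
          \<or> gromov p (inv g) (inv h) < \<epsilon> \<and> gromov p g (inv (inv h)) < \<epsilon>"
        using com[OF gh] com[OF inv_closed[OF gh(1)] gh(2)] com[OF gh(1) inv_closed[OF gh(2)]]
          com[OF inv_closed[OF gh(1)] inv_closed[OF gh(2)]] inv_inv[OF gh(2)] by (smt (verit))
      then consider "gromov p (inv g) h < \<epsilon>" "gromov p g (inv h) < \<epsilon>"
        | "gromov p (inv g) (inv h) < \<epsilon>" "gromov p g (inv (inv h)) < \<epsilon>"
        by blast
      then show ?thesis
      proof cases
        case 1
        have "disp p g + disp p h - 4 * \<epsilon> < tlen (g \<otimes> h)"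
          using disp_square_product[OF p(1) gh 1 big] tlen_ge_square[OF p(1), of "g \<otimes> h"] gh by simp
        then show ?thesis using tlen_le[OF p(1) gh(1)] tlen_le[OF p(1) gh(2)] by linarith
      next
        case 2
        have "disp p g + disp p h - 4 * \<epsilon> < tlen (g \<otimes> inv h)"
          using disp_square_product[OF p(1) gh(1) inv_closed[OF gh(2)] 2] big
            tlen_ge_square[OF p(1), of "g \<otimes> inv h"] gh by (simp add: disp_inv p)
        then show ?thesis using tlen_le[OF p(1) gh(1)] tlen_le[OF p(1) gh(2)] by linarith
      qed
    qed
    show ?thesis
    proof (rule field_le_epsilon)
      fix e :: real assume "0 < e"
      define \<epsilon> where "\<epsilon> = min (e / 4) (min (tlen g / 2) (tlen h / 2))"
      have "0 < \<epsilon>" "2 * \<epsilon> \<le> tlen g" "2 * \<epsilon> \<le> tlen h" "4 * \<epsilon> \<le> e"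
        using pos \<open>0 < e\<close> by (auto simp: \<epsilon>_def)
      then show "tlen g + tlen h \<le> max (tlen (g \<otimes> h)) (tlen (g \<otimes> inv h)) + e"
        using main[of \<epsilon>] by linarith
    qed
  qed
qed

text \<open>A quantitative form of Serre's lemma that a group has a global fixed point if its generators and
  their pairwise products have fixed points. Let \<open>M\<close> be the largest displacement of an element of
  \<open>B\<close> at a point \<open>p\<close>, and suppose \<open>M > 4 \<eta>\<close>. Because the translation lengths are small, all elements
  of \<open>B\<close> with displacement at least \<open>M / 2\<close> move \<open>p\<close> in the same direction, forwards as well as
  backwards. Moving \<open>p\<close> by \<open>M / 8\<close> in this direction brings all displacements down to
  \<open>3 M / 4\<close>, so the infimum of the largest displacement is at most \<open>4 \<eta>\<close>.\<close>

lemma nearly_fixed_point: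
  assumes B: "finite B" "B \<subseteq> carrier F" and eta: "0 \<le> \<eta>"
    and single: "\<And>x. x \<in> B \<Longrightarrow> tlen x \<le> \<eta>"
    and pairs: "\<And>x y. x \<in> B \<Longrightarrow> y \<in> B \<Longrightarrow> x \<noteq> y \<Longrightarrow> tlen (x \<otimes> y) \<le> \<eta> \<or> tlen (y \<otimes> x) \<le> \<eta>"
    and e: "0 < e"
  shows "\<exists>q\<in>T. \<forall>x\<in>B. disp q x \<le> 4 * \<eta> + e"
proof (cases "B = {}")
  case True
  then show ?thesis using tree by (auto simp: real_tree_def)
next
  case False
  define f where "f p = Max (disp p ` B)" for p
  define I where "I = (INF p\<in>T. f p)"
  have T: "T \<noteq> {}" using tree by (simp add: real_tree_def)
  have f_ge: "disp p x \<le> f p" if "x \<in> B" for p x using that B by (auto simp: f_def)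
  have f_at: "\<exists>x\<in>B. f p = disp p x" for p
  proof -
    have "f p \<in> disp p ` B" unfolding f_def using B False by (intro Max_in) auto
    then show ?thesis by auto
  qed
  have f0: "0 \<le> f p" for p using f_at[of p] by auto
  have bdd: "bdd_below (f ` T)" using f0 by (auto intro!: bdd_belowI[of _ 0])
  have I_le: "I \<le> f p" if "p \<in> T" for p using that bdd by (auto simp: I_def intro: cINF_lower)
  have near: "\<exists>p\<in>T. f p < c" if "I < c" for c
    using cInf_lessD[of "f ` T" c] T that unfolding I_def by blast
  have "I \<le> 4 * \<eta>"
  proof (rule ccontr)
    assume "\<not> I \<le> 4 * \<eta>"
    then have I: "4 * \<eta> < I" "0 < I" using eta by auto
    then obtain p where p: "p \<in> T" "f p < 4 / 3 * I" using near[of "4 / 3 * I"] by auto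
    define M where "M = f p"
    \<comment> \<open>the largest step for which elements of displacement below \<open>M / 2\<close> stay below \<open>3 M / 4\<close>\<close>
    define s where "s = M / 8"
    have M: "4 * \<eta> < M" "0 < M" "3 / 4 * M < I" using I I_le[OF p(1)] p(2) by (auto simp: M_def)
    obtain x where x: "x \<in> B" "disp p x = M" using f_at[of p] M_def by auto
    have xF: "x \<in> carrier F" using x B by auto
    have turn: "s \<le> gromov p y (inv y)" if "y \<in> B" "M / 2 \<le> disp p y" for y
    proof -
      have y: "y \<in> carrier F" using that B by auto
      have "disp p (y \<otimes> y) - disp p y \<le> \<eta>" using tlen_ge_square[OF p(1) y] single[OF that(1)] by simp
      moreover have "inv y \<otimes> inv y = inv (y \<otimes> y)" using y by (simp add: inv_mult_group)
      ultimately show ?thesis using that M p y by (simp add: gromov_def disp_inv s_def)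
    qed
    obtain q where q: "q \<in> T" "d p q = s" "d q (\<rho> x p) = disp p x - s"
      using point_towards[OF p(1) xF, of s] x M s_def by auto
    have ultra: "s \<le> gromov p u w" if "s \<le> gromov p u v" "s \<le> gromov p v w"
        "u \<in> carrier F" "v \<in> carrier F" "w \<in> carrier F" for u v w
      using gromov_ultrametric[OF p(1) that(3-5)] that(1,2) by linarith
    have com: "gromov p u v = gromov p v u" if "u \<in> carrier F" "v \<in> carrier F" for u v
      using gromov_commute p that by blast
    have both: "s \<le> gromov p x y \<and> s \<le> gromov p x (inv y)" if y: "y \<in> B" "M / 2 \<le> disp p y" for y
    proof (cases "y = x")
      case True
      then show ?thesis using turn[OF y] x M p xF
        by (auto simp: gromov_def s_def disp_def)
    next
      case False
      have yF: "y \<in> carrier F" using y B by auto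
      have big: "2 * s \<le> disp p x" "2 * s \<le> disp p y" using x y M s_def by auto
      have "s \<le> gromov p (inv x) y \<or> s \<le> gromov p x (inv y)"
      proof (rule ccontr)
        assume neg: "\<not> ?thesis"
        have c1: "gromov p (inv x) y < s" "gromov p x (inv y) < s" using neg by auto
        then have c2: "gromov p (inv y) x < s" "gromov p y (inv x) < s" using com xF yF by auto
        have "disp p x + disp p y - 4 * s < tlen (x \<otimes> y)"
          using disp_square_product[OF p(1) xF yF c1 big] tlen_ge_square[OF p(1), of "x \<otimes> y"] xF yF by simp
        moreover have "disp p x + disp p y - 4 * s < tlen (y \<otimes> x)"
          using disp_square_product[OF p(1) yF xF c2 big(2,1)] tlen_ge_square[OF p(1), of "y \<otimes> x"] xF yF by simp
        ultimately show False using pairs[OF x(1) y(1)] False x y M s_def by auto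
      qed
      moreover have "s \<le> gromov p x (inv x)" "s \<le> gromov p y (inv y)" "s \<le> gromov p (inv y) y"
        using turn[OF x(1)] turn[OF y] x M com[of y "inv y"] yF by auto
      ultimately show ?thesis
        using ultra[of x "inv x" y] ultra[of x y "inv y"] ultra[of x "inv y" y] xF yF by auto
    qed
    have "disp q y \<le> 3 / 4 * M" if y: "y \<in> B" for y
    proof (cases "M / 2 \<le> disp p y")
      case True
      have yF: "y \<in> carrier F" using y B by auto
      have s0: "0 \<le> s" using M s_def by simp
      have "d q (\<rho> y p) \<le> disp p y - s" "d q (\<rho> (inv y) p) \<le> disp p y - s"
        using move_closer[OF p(1) xF yF q s0] move_closer[OF p(1) xF inv_closed[OF yF] q s0]
          both[OF y True] disp_inv[OF p(1) yF] by auto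
      then have "disp q y \<le> disp p y - 2 * s"
        using disp_move_both_sides[OF p(1) yF q(1,2)] True s_def s0 by auto
      then show ?thesis using f_ge[OF y, of p] by (simp add: s_def M_def)
    next
      case False
      then show ?thesis
        using disp_change_point[OF q(1) p(1), of y] q(2) commute[of q p] y B by (auto simp: s_def)
    qed
    then have "f q \<le> 3 / 4 * M" using f_at[of q] by auto
    then show False using I_le[OF q(1)] M by simp
  qed
  then obtain q where "q \<in> T" "f q < 4 * \<eta> + e" using near[of "4 * \<eta> + e"] e by auto
  then show ?thesis using f_ge by (meson less_imp_le order_trans)
qed

lemma disp_eval_word:
  fixes C :: real
  assumes q: "q \<in> T" and B: "B \<subseteq> carrier F" and C: "\<And>x. x \<in> B \<Longrightarrow> disp q x \<le> C" and w: "w \<in> words B"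
  shows "eval_word F w \<in> carrier F \<and> disp q (eval_word F w) \<le> length w * C"
  using w
proof (induction w)
  case Nil
  then show ?case using q by (simp add: eval_word_def disp_def)
next
  case (Cons l w)
  then have l: "fst l \<in> B" and w: "w \<in> words B" by (auto simp: words_def)
  have lF: "eval_letter F l \<in> carrier F" using l B by (auto simp: eval_letter_def)
  have "disp q (eval_letter F l) \<le> C" using C[OF l] l B q by (auto simp: eval_letter_def disp_inv)
  moreover have "eval_word F (l # w) = eval_letter F l \<otimes> eval_word F w" by (simp add: eval_word_def)
  ultimately show ?case using Cons.IH[OF w] disp_triangle[OF q lF, of "eval_word F w"] lF
    by (auto simp: algebra_simps)
qed

theorem tlen_word_bound:
  fixes \<eta> :: real
  assumes B: "finite B" "B \<subseteq> carrier F" and eta: "0 \<le> \<eta>"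
    and single: "\<And>x. x \<in> B \<Longrightarrow> tlen x \<le> \<eta>"
    and pairs: "\<And>x y. x \<in> B \<Longrightarrow> y \<in> B \<Longrightarrow> x \<noteq> y \<Longrightarrow> tlen (x \<otimes> y) \<le> \<eta> \<or> tlen (y \<otimes> x) \<le> \<eta>"
    and w: "w \<in> words B"
  shows "tlen (eval_word F w) \<le> 4 * length w * \<eta>"
proof (rule field_le_epsilon)
  fix e :: real assume e: "0 < e"
  then obtain q where q: "q \<in> T" "\<And>x. x \<in> B \<Longrightarrow> disp q x \<le> 4 * \<eta> + e / (length w + 1)"
    using nearly_fixed_point[OF B eta single pairs, of "e / (length w + 1)"] by auto
  have "tlen (eval_word F w) \<le> length w * (4 * \<eta> + e / (length w + 1))"
    using disp_eval_word[OF q(1) B(2) q(2) w] tlen_le[OF q(1)] by force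
  also have "\<dots> = 4 * length w * \<eta> + (length w / (length w + 1)) * e" by (simp add: algebra_simps)
  also have "\<dots> \<le> 4 * length w * \<eta> + 1 * e"
    using e by (intro add_left_mono mult_right_mono) auto
  finally show "tlen (eval_word F w) \<le> 4 * length w * \<eta> + e" by simp
qed

end

section \<open>Reduced words\<close>

definition flip :: "'a \<times> bool \<Rightarrow> 'a \<times> bool" where "flip l = (fst l, \<not> snd l)"

definition inv_word :: "('a \<times> bool) list \<Rightarrow> ('a \<times> bool) list" where
  "inv_word w = rev (map flip w)"

lemma flip_flip [simp]: "flip (flip l) = l" by (simp add: flip_def)
lemma fst_flip [simp]: "fst (flip l) = fst l" by (simp add: flip_def)

lemma flip_eq_iff: "flip l = m \<longleftrightarrow> l = flip m" by (auto simp: flip_def)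

lemma reduced_successively: "reduced w \<longleftrightarrow> successively (\<lambda>x y. y \<noteq> flip x) w"
  unfolding reduced_def successively_conv_nth flip_def by blast

lemma reduced_append:
  "reduced (u @ v) \<longleftrightarrow> reduced u \<and> reduced v \<and> (u = [] \<or> v = [] \<or> hd v \<noteq> flip (last u))"
  by (auto simp: reduced_successively successively_append_iff)

lemma reduced_inv_word [simp]: "reduced (inv_word w) \<longleftrightarrow> reduced w"
  by (auto simp: reduced_successively inv_word_def successively_map flip_eq_iff
      intro: successively_mono)

lemma reduced_replicate [simp]: "reduced (replicate n l)"
  by (auto simp: reduced_successively successively_conv_nth flip_def prod_eq_iff)

lemma inv_word_Nil [simp]: "inv_word w = [] \<longleftrightarrow> w = []" "inv_word [] = []"
  by (auto simp: inv_word_def)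

lemma length_inv_word [simp]: "length (inv_word w) = length w"
  by (simp add: inv_word_def)

lemma hd_inv_word: "w \<noteq> [] \<Longrightarrow> hd (inv_word w) = flip (last w)"
  by (simp add: inv_word_def hd_rev last_map)

lemma last_inv_word: "w \<noteq> [] \<Longrightarrow> last (inv_word w) = flip (hd w)"
  by (simp add: inv_word_def last_rev hd_map)

lemma words_append [simp]: "u @ v \<in> words B \<longleftrightarrow> u \<in> words B \<and> v \<in> words B"
  by (auto simp: words_def)

lemma words_Cons [simp]: "l # v \<in> words B \<longleftrightarrow> fst l \<in> B \<and> v \<in> words B"
  by (cases l) (auto simp: words_def)

lemma words_Nil [simp]: "[] \<in> words B" by (simp add: words_def)

lemma words_inv_word [simp]: "inv_word w \<in> words B \<longleftrightarrow> w \<in> words B"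
  by (induction w) (auto simp: inv_word_def)

lemma words_replicate [simp]: "fst l \<in> B \<Longrightarrow> replicate n l \<in> words B"
  by (induction n) auto

lemma not_reducedE:
  assumes "\<not> reduced w"
  obtains u l v where "w = u @ [l, flip l] @ v"
proof -
  obtain i where i: "Suc i < length w" "w ! Suc i = flip (w ! i)"
    using assms by (auto simp: reduced_def flip_def)
  have "w = take i w @ [w ! i, w ! Suc i] @ drop (Suc (Suc i)) w"
    using i(1) by (metis Cons_nth_drop_Suc Suc_lessD append_Cons append_Nil append_take_drop_id)
  then show ?thesis using that i(2) by metis
qed

context group
begin

lemma eval_letter_closed [simp]: "fst l \<in> carrier G \<Longrightarrow> eval_letter G l \<in> carrier G"
  by (simp add: eval_letter_def)

lemma eval_letter_flip: "fst l \<in> carrier G \<Longrightarrow> eval_letter G (flip l) = inv (eval_letter G l)"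
  by (simp add: eval_letter_def flip_def)

lemma eval_word_Nil [simp]: "eval_word G [] = \<one>" by (simp add: eval_word_def)

lemma eval_word_Cons [simp]: "eval_word G (l # w) = eval_letter G l \<otimes> eval_word G w"
  by (simp add: eval_word_def)

lemma eval_word_closed: "w \<in> words (carrier G) \<Longrightarrow> eval_word G w \<in> carrier G"
  by (induction w) auto

lemma eval_word_append:
  "u \<in> words (carrier G) \<Longrightarrow> v \<in> words (carrier G) \<Longrightarrow>
    eval_word G (u @ v) = eval_word G u \<otimes> eval_word G v"
  by (induction u) (auto simp: m_assoc eval_word_closed)

lemma eval_inv_word:
  "w \<in> words (carrier G) \<Longrightarrow> eval_word G (inv_word w) = inv (eval_word G w)"
proof (induction w)
  case (Cons l w)
  have "inv_word (l # w) = inv_word w @ [flip l]" by (simp add: inv_word_def)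
  then show ?case using Cons
    by (simp add: eval_word_append eval_letter_flip inv_mult_group eval_word_closed del: append.simps)
qed simp

lemma eval_word_cancel:
  "u @ [l, flip l] @ v \<in> words (carrier G) \<Longrightarrow>
    eval_word G (u @ [l, flip l] @ v) = eval_word G (u @ v)"
  by (simp add: eval_word_append eval_letter_flip eval_word_closed flip: m_assoc)

end

lemma words_mono: "A \<subseteq> C \<Longrightarrow> w \<in> words A \<Longrightarrow> w \<in> words C"
  by (auto simp: words_def)

definition map_word :: "('a \<Rightarrow> 'c) \<Rightarrow> ('a \<times> bool) list \<Rightarrow> ('c \<times> bool) list" where
  "map_word f = map (apfst f)"

lemma map_word_append [simp]: "map_word f (u @ v) = map_word f u @ map_word f v"
  by (simp add: map_word_def)

lemma map_word_simps [simp]: "map_word f [] = []" "map_word f (l # w) = (f (fst l), snd l) # map_word f w"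
  by (auto simp: map_word_def apfst_def map_prod_def split: prod.split)

lemma map_word_words: "f ` A \<subseteq> C \<Longrightarrow> w \<in> words A \<Longrightarrow> map_word f w \<in> words C"
  by (induction w) auto

text \<open>Cancelling inverse pairs does not change the value of a word, neither in \<open>F\<close> nor after a
  substitution of elements of any other group \<open>G\<close> for its letters. The latter is what extends maps
  on a basis to homomorphisms.\<close>

lemma reduce_word:
  assumes F: "group F" and G: "group G" and B: "B \<subseteq> carrier F" and f: "f ` B \<subseteq> carrier G"
    and w: "w \<in> words B"
  shows "\<exists>w'\<in>words B. reduced w' \<and> length w' \<le> length w \<and> eval_word F w' = eval_word F w \<and>
    eval_word G (map_word f w') = eval_word G (map_word f w)"
  using w
proof (induction "length w" arbitrary: w rule: less_induct)
  case less
  show ?case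
  proof (cases "reduced w")
    case False
    then obtain u l v where uv: "w = u @ [l, flip l] @ v" by (rule not_reducedE)
    have uv': "u @ v \<in> words B" "length (u @ v) < length w" using less.prems uv by auto
    have "eval_word F w = eval_word F (u @ v)"
      unfolding uv using words_mono[OF B less.prems] uv by (intro group.eval_word_cancel[OF F]) auto
    moreover have "eval_word G (map_word f w) = eval_word G (map_word f (u @ v))"
    proof -
      have "map_word f w = map_word f u @ [(f (fst l), snd l), flip (f (fst l), snd l)] @ map_word f v"
        unfolding uv by (simp add: flip_def)
      then show ?thesis using group.eval_word_cancel[OF G] map_word_words[OF f less.prems]
        by (metis map_word_append)
    qed
    ultimately show ?thesis using less.hyps[OF uv'(2,1)] uv'(2) by fastforce
  qed (use less.prems in auto)
qed

fun common_prefix_length :: "'x list \<Rightarrow> 'x list \<Rightarrow> nat" where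
  "common_prefix_length (x # xs) (y # ys) = (if x = y then Suc (common_prefix_length xs ys) else 0)"
| "common_prefix_length _ _ = 0"

lemma common_prefix_length_commute: "common_prefix_length xs ys = common_prefix_length ys xs"
  by (induction xs ys rule: common_prefix_length.induct) auto

lemma common_prefix_length_ultrametric: "min (common_prefix_length xs ys) (common_prefix_length ys zs) \<le> common_prefix_length xs zs"
proof (induction xs ys arbitrary: zs rule: common_prefix_length.induct)
  case (1 x xs y ys)
  show ?case
  proof (cases zs)
    case (Cons z zs')
    then show ?thesis using "1.IH"[of zs'] by (auto simp: min_def split: if_splits)
  qed auto
qed auto

lemma common_prefix_length_self [simp]: "common_prefix_length xs xs = length xs" by (induction xs) auto

lemma common_prefix_length_le: "common_prefix_length xs ys \<le> length xs" by (induction xs ys rule: common_prefix_length.induct) auto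

lemma common_prefix_length_append [simp]: "common_prefix_length (p @ xs) (p @ ys) = length p + common_prefix_length xs ys" by (induction p) auto

lemma common_prefix_length_split:
  obtains p s s' where "xs = p @ s" "ys = p @ s'" "common_prefix_length xs ys = length p" "s = [] \<or> s' = [] \<or> hd s \<noteq> hd s'"
proof -
  have "\<exists>p s s'. xs = p @ s \<and> ys = p @ s' \<and> common_prefix_length xs ys = length p \<and> (s = [] \<or> s' = [] \<or> hd s \<noteq> hd s')"
  proof (induction xs ys rule: common_prefix_length.induct)
    case (1 x xs y ys)
    show ?case
    proof (cases "x = y")
      case True
      then obtain p s s' where "xs = p @ s \<and> ys = p @ s' \<and> common_prefix_length xs ys = length p \<and> (s = [] \<or> s' = [] \<or> hd s \<noteq> hd s')"
        using 1 by blast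
      then show ?thesis using True by (intro exI[of _ "x # p"] exI[of _ s] exI[of _ s']) auto
    next
      case False
      then show ?thesis by (intro exI[of _ "[]"] exI[of _ "x # xs"] exI[of _ "y # ys"]) auto
    qed
  qed auto
  then show ?thesis using that by blast
qed

section \<open>The Cayley tree of a free group\<close>

locale free_group = group F for F :: "('a, 'b) monoid_scheme" (structure) +
  fixes B :: "'a set"
  assumes basis: "free_basis F B"
begin

lemma B_carrier: "B \<subseteq> carrier F" using basis by (simp add: free_basis_def)

lemma B_closed [simp]: "b \<in> B \<Longrightarrow> b \<in> carrier F" using B_carrier by blast

lemma eval_bij: "bij_betw (eval_word F) {w \<in> words B. reduced w} (carrier F)"
  using basis by (simp add: free_basis_def)

definition nf :: "'a \<Rightarrow> ('a \<times> bool) list" where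
  "nf = inv_into {w \<in> words B. reduced w} (eval_word F)"

lemma words_F: "w \<in> words B \<Longrightarrow> w \<in> words (carrier F)"
  by (rule words_mono[OF B_carrier])

lemma eval_closed [simp]: "w \<in> words B \<Longrightarrow> eval_word F w \<in> carrier F"
  by (rule eval_word_closed[OF words_F])

lemma nf_props:
  assumes "g \<in> carrier F"
  shows "nf g \<in> words B" "reduced (nf g)" "eval_word F (nf g) = g"
proof -
  have "g \<in> eval_word F ` {w \<in> words B. reduced w}" using eval_bij assms by (simp add: bij_betw_def)
  from inv_into_into[OF this] f_inv_into_f[OF this]
  show "nf g \<in> words B" "reduced (nf g)" "eval_word F (nf g) = g" by (auto simp: nf_def)
qed

lemma nf_eval: "w \<in> words B \<Longrightarrow> reduced w \<Longrightarrow> nf (eval_word F w) = w"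
  unfolding nf_def using eval_bij by (simp add: bij_betw_def inv_into_f_f)

abbreviation wl :: "'a \<Rightarrow> nat" where "wl \<equiv> word_length F B"

abbreviation gprod :: "'a \<Rightarrow> 'a \<Rightarrow> real" where "gprod \<equiv> gromov_product F B"

lemma word_length_nf:
  assumes g: "g \<in> carrier F"
  shows "wl g = length (nf g)"
  unfolding word_length_def
proof (rule Least_equality)
  show "\<exists>w\<in>words B. length w = length (nf g) \<and> eval_word F w = g" using nf_props[OF g] by blast
next
  fix n assume "\<exists>w\<in>words B. length w = n \<and> eval_word F w = g"
  then obtain w where w: "w \<in> words B" "length w = n" "eval_word F w = g" by blast
  obtain w' where "w' \<in> words B" "reduced w'" "length w' \<le> length w" "eval_word F w' = eval_word F w"
    using reduce_word[OF is_group is_group B_carrier _ w(1), of id] B_carrier by auto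
  then show "length (nf g) \<le> n" using nf_eval w by metis
qed

text \<open>In \<open>g\<^sup>-\<^sup>1 h\<close> the common prefix cancels, and nothing else does.\<close>

lemma nf_mult_inv:
  assumes gh: "g \<in> carrier F" "h \<in> carrier F" and p: "nf g = p @ s" "nf h = p @ s'"
    and ne: "s = [] \<or> s' = [] \<or> hd s \<noteq> hd s'"
  shows "nf (inv g \<otimes> h) = inv_word s @ s'"
proof -
  have w: "p \<in> words B" "s \<in> words B" "s' \<in> words B"
    using nf_props(1)[OF gh(1)] nf_props(1)[OF gh(2)] p by auto
  have r: "reduced s" "reduced s'"
    using nf_props(2)[OF gh(1)] nf_props(2)[OF gh(2)] p by (auto simp: reduced_append)
  have g: "g = eval_word F p \<otimes> eval_word F s" and h: "h = eval_word F p \<otimes> eval_word F s'"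
    using nf_props(3)[OF gh(1)] nf_props(3)[OF gh(2)] p w by (auto simp: eval_word_append words_F)
  have "inv g \<otimes> h = inv (eval_word F s) \<otimes> eval_word F s'"
    unfolding g h using w by (simp add: inv_mult_group m_assoc inv_solve_left')
  also have "\<dots> = eval_word F (inv_word s @ s')" using w by (simp add: eval_word_append eval_inv_word words_F)
  finally show ?thesis
    using w r ne by (auto intro!: nf_eval simp: reduced_append last_inv_word)
qed

lemma gprod_cpl:
  assumes gh: "g \<in> carrier F" "h \<in> carrier F"
  shows "gprod g h = common_prefix_length (nf g) (nf h)"
proof -
  obtain p s s' where ps: "nf g = p @ s" "nf h = p @ s'" "common_prefix_length (nf g) (nf h) = length p"
      "s = [] \<or> s' = [] \<or> hd s \<noteq> hd s'" by (rule common_prefix_length_split)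
  have "wl (inv g \<otimes> h) = length s + length s'"
    using nf_mult_inv[OF gh ps(1,2,4)] gh by (simp add: word_length_nf)
  then show ?thesis using ps gh by (simp add: gromov_product_def word_dist_def word_length_nf)
qed

lemma gprod_commute: "g \<in> carrier F \<Longrightarrow> h \<in> carrier F \<Longrightarrow> gprod g h = gprod h g"
  by (simp add: gprod_cpl common_prefix_length_commute)

lemma gprod_ultrametric:
  assumes "g \<in> carrier F" "h \<in> carrier F" "k \<in> carrier F"
  shows "min (gprod g h) (gprod h k) \<le> gprod g k"
  using common_prefix_length_ultrametric[of "nf g" "nf h" "nf k"] assms by (simp add: gprod_cpl)

lemma gprod_self: "g \<in> carrier F \<Longrightarrow> gprod g g = wl g"
  by (simp add: gprod_cpl word_length_nf)

lemma gprod_nonneg: "g \<in> carrier F \<Longrightarrow> h \<in> carrier F \<Longrightarrow> 0 \<le> gprod g h"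
  by (simp add: gprod_cpl)

lemma wl_inv: "g \<in> carrier F \<Longrightarrow> wl (inv g) = wl g"
  using nf_mult_inv[of g \<one> "[]" "nf g" "[]"] nf_eval[of "[]"]
  by (simp add: word_length_nf reduced_def)

lemma gprod_alt: "g \<in> carrier F \<Longrightarrow> h \<in> carrier F \<Longrightarrow>
    gprod g h = (real (wl g) + real (wl h) - real (wl (inv g \<otimes> h))) / 2"
  by (simp add: gromov_product_def word_dist_def)

lemma wl_mult:
  assumes "g \<in> carrier F" "h \<in> carrier F"
  shows "wl (g \<otimes> h) \<le> wl g + wl h"
  using gprod_nonneg[of "inv g" h] gprod_alt[of "inv g" h] assms by (simp add: wl_inv)

lemma wl_basis: "b \<in> B \<Longrightarrow> wl b = 1"
  using nf_eval[of "[(b, True)]"] by (simp add: word_length_nf reduced_def eval_letter_def)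

section \<open>Homomorphisms on a free group\<close>

definition extend_hom :: "('c, 'd) monoid_scheme \<Rightarrow> ('a \<Rightarrow> 'c) \<Rightarrow> 'a \<Rightarrow> 'c" where
  "extend_hom G f g = eval_word G (map_word f (nf g))"

lemma extend_hom_eval:
  assumes G: "group G" and f: "f ` B \<subseteq> carrier G" and w: "w \<in> words B"
  shows "extend_hom G f (eval_word F w) = eval_word G (map_word f w)"
proof -
  obtain w' where w': "w' \<in> words B" "reduced w'" "eval_word F w' = eval_word F w"
      "eval_word G (map_word f w') = eval_word G (map_word f w)"
    using reduce_word[OF is_group G B_carrier f w] by blast
  have "nf (eval_word F w) = w'" using nf_eval[OF w'(1,2)] w'(3) by simp
  then show ?thesis using w'(4) by (simp add: extend_hom_def)
qed

lemma extend_hom_hom: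
  assumes G: "group G" and f: "f ` B \<subseteq> carrier G"
  shows "extend_hom G f \<in> hom F G"
proof (rule homI)
  note m = map_word_words[OF f]
  show "extend_hom G f g \<in> carrier G" if "g \<in> carrier F" for g
    unfolding extend_hom_def by (intro group.eval_word_closed[OF G] m nf_props(1)[OF that])
  fix g h assume gh: "g \<in> carrier F" "h \<in> carrier F"
  have "g \<otimes> h = eval_word F (nf g @ nf h)"
    using gh nf_props words_F by (simp add: eval_word_append)
  then show "extend_hom G f (g \<otimes> h) = extend_hom G f g \<otimes>\<^bsub>G\<^esub> extend_hom G f h"
    using gh nf_props(1) m by (simp add: extend_hom_eval[OF G f] group.eval_word_append[OF G]) (simp add: extend_hom_def)
qed

lemma extend_hom_basis:
  assumes G: "group G" and f: "f ` B \<subseteq> carrier G" and b: "b \<in> B"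
  shows "extend_hom G f b = f b"
  using extend_hom_eval[OF G f, of "[(b, True)]"] b f
  by (simp add: eval_letter_def group.eval_word_Cons[OF G] group.eval_word_Nil[OF G] monoid.r_one group.is_monoid[OF G] image_subset_iff)

lemma hom_eval:
  assumes G: "group G" and h: "h \<in> hom F G" and w: "w \<in> words B"
  shows "h (eval_word F w) = eval_word G (map_word h w)"
proof -
  interpret G: group G by (rule G)
  interpret group_hom F G h using h is_group G by (simp add: group_hom_def group_hom_axioms_def)
  show ?thesis using w
    by (induction w) (auto simp: eval_letter_def)
qed

lemma hom_eqI:
  assumes G: "group G" and h: "h \<in> hom F G" "h' \<in> hom F G" and eq: "\<And>b. b \<in> B \<Longrightarrow> h b = h' b"
    and g: "g \<in> carrier F"
  shows "h g = h' g"
proof -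
  have "map_word h w = map_word h' w" if "w \<in> words B" for w
    using that by (induction w) (auto simp: eq)
  then show ?thesis using hom_eval[OF G h(1), of "nf g"] hom_eval[OF G h(2), of "nf g"] nf_props[OF g] by simp
qed

text \<open>The function is restricted to the carrier because elements of \<open>auto F\<close> are extensional.\<close>

definition transvection :: "'a \<Rightarrow> 'a \<Rightarrow> 'a \<Rightarrow> 'a" where
  "transvection b c = restrict (extend_hom F (\<lambda>x. if x = b then b \<otimes> c else x)) (carrier F)"

lemma transvection_hom:
  assumes "b \<in> B" "c \<in> carrier F"
  shows "transvection b c \<in> hom F F"
proof -
  have "(\<lambda>x. if x = b then b \<otimes> c else x) ` B \<subseteq> carrier F" using assms by auto
  from extend_hom_hom[OF is_group this] show ?thesis by (simp add: transvection_def hom_def Pi_def)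
qed

lemma transvection_basis:
  assumes "b \<in> B" "c \<in> carrier F" "x \<in> B"
  shows "transvection b c x = (if x = b then b \<otimes> c else x)"
proof -
  have "(\<lambda>x. if x = b then b \<otimes> c else x) ` B \<subseteq> carrier F" using assms by auto
  from extend_hom_basis[OF is_group this assms(3)] show ?thesis using assms(3) by (simp add: transvection_def)
qed

text \<open>Two cases are treated at once, as transvections by \<open>c\<close> and by \<open>c\<^sup>-\<^sup>1\<close> are inverse to each other.\<close>

lemma transvection_inverse:
  assumes b: "b \<in> B" and c: "c \<in> B" "c \<noteq> b" and g: "g \<in> carrier F" and sign: "c' = c \<or> c' = inv c"
  shows "transvection b (inv c') (transvection b c' g) = g"
proof -
  have c': "c' \<in> carrier F" using sign c by auto
  note hom = transvection_hom[OF b c'] transvection_hom[OF b inv_closed[OF c']]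
  have fix_c: "transvection b (inv c') c' = c'"
  proof -
    have fc: "transvection b (inv c') c = c" using transvection_basis[OF b inv_closed[OF c'] c(1)] c by simp
    have "group_hom F F (transvection b (inv c'))"
      using hom(2) is_group by (simp add: group_hom_def group_hom_axioms_def)
    from group_hom.hom_inv[OF this, of c] fc c show ?thesis using sign by auto
  qed
  have "(transvection b (inv c') \<circ> transvection b c') g = id g"
  proof (rule hom_eqI[OF is_group _ _ _ g])
    show "transvection b (inv c') \<circ> transvection b c' \<in> hom F F"
      using hom by (auto simp: hom_def Pi_def)
    show "id \<in> hom F F" by (auto simp: hom_def)
    fix x assume x: "x \<in> B"
    have "transvection b (inv c') (b \<otimes> c') = b"
      using hom(2) b c' fix_c transvection_basis[OF b inv_closed[OF c'] b]
      by (simp add: hom_mult m_assoc)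
    then show "(transvection b (inv c') \<circ> transvection b c') x = id x"
      using x transvection_basis[OF b c' x] transvection_basis[OF b inv_closed[OF c'] x] by auto
  qed
  then show ?thesis by simp
qed

lemma transvection_auto:
  assumes b: "b \<in> B" and c: "c \<in> B" "c \<noteq> b"
  shows "transvection b c \<in> auto F"
proof -
  have cF: "c \<in> carrier F" using c by simp
  note hom = transvection_hom[OF b cF] transvection_hom[OF b inv_closed[OF cF]]
  have "bij_betw (transvection b c) (carrier F) (carrier F)"
  proof (rule bij_betwI[where g = "transvection b (inv c)"])
    show "transvection b c \<in> carrier F \<rightarrow> carrier F" "transvection b (inv c) \<in> carrier F \<rightarrow> carrier F"
      using hom by (auto simp: hom_def)
    show "transvection b (inv c) (transvection b c x) = x" if "x \<in> carrier F" for x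
      using transvection_inverse[OF b c that, of c] by simp
    show "transvection b c (transvection b (inv c) x) = x" if "x \<in> carrier F" for x
      using transvection_inverse[OF b c that, of "inv c"] cF by simp
  qed
  then show ?thesis using hom(1) by (auto simp: auto_def Bij_def transvection_def extensional_def)
qed

text \<open>The homomorphism to the integers with value \<open>1\<close> on every basis element sends an \<open>m\<close>-th power to a
  multiple of \<open>m\<close>.\<close>

lemma basis_not_proper_power:
  assumes a: "a \<in> B"
  shows "\<not> proper_power F a"
proof
  assume "proper_power F a"
  then obtain f m where f: "f \<in> carrier F" "m > (1::nat)" "a = f [^] m" by (auto simp: proper_power_def)
  define e where "e = extend_hom integer_group (\<lambda>_. 1)"
  have e: "e \<in> hom F integer_group" by (simp add: e_def extend_hom_hom)
  then have "group_hom F integer_group e" using is_group by (simp add: group_hom_def group_hom_axioms_def)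
  from group_hom.hom_nat_pow[OF this f(1), of m] have "e a = int m * e f" by (simp add: f(3))
  moreover have "e a = 1" using extend_hom_basis[of integer_group "\<lambda>_. 1" a] a by (simp add: e_def)
  ultimately have "int m * e f = 1" by simp
  then have "int m dvd 1" by (metis dvd_triv_left)
  then show False using f(2) by simp
qed

lemma eval_replicate:
  assumes "fst l \<in> B"
  shows "eval_word F (replicate n l) = eval_letter F l [^] n"
proof (induction n)
  case (Suc n)
  then show ?case using assms nat_pow_Suc2[of "eval_letter F l" n] by simp
qed simp

lemma conj_pow:
  assumes "u \<in> carrier F" "a \<in> carrier F"
  shows "(u \<otimes> a \<otimes> inv u) [^] (n::nat) = u \<otimes> a [^] n \<otimes> inv u"
proof (induction n)
  case (Suc n)
  have "(u \<otimes> a [^] n \<otimes> inv u) \<otimes> (u \<otimes> a \<otimes> inv u) = u \<otimes> (a [^] n \<otimes> a) \<otimes> inv u"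
    using assms by (simp add: m_assoc inv_solve_left')
  then show ?case using Suc by simp
qed (use assms in simp)

text \<open>If the reduced word of \<open>u\<close> ended in the letter \<open>a\<close> or its inverse, this letter could be dropped
  without changing \<open>u a u\<^sup>-\<^sup>1\<close>. For a shortest conjugator \<open>u\<close> there is therefore no cancellation at
  all in \<open>u a\<^sup>n u\<^sup>-\<^sup>1\<close>. The two values of \<open>e\<close> cover the positive and the negative powers.\<close>

lemma conjugate_normal_form:
  assumes a: "a \<in> B" and h: "h \<in> conj_class F a"
  obtains u where "u \<in> carrier F" "h = u \<otimes> a \<otimes> inv u"
    "\<And>n e. n > 0 \<Longrightarrow> nf (u \<otimes> eval_letter F (a, e) [^] (n::nat) \<otimes> inv u)
       = nf u @ replicate n (a, e) @ inv_word (nf u)"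
proof -
  define P where "P n \<longleftrightarrow> (\<exists>u\<in>carrier F. h = u \<otimes> a \<otimes> inv u \<and> wl u = n)" for n
  have "\<exists>n. P n" using h by (auto simp: P_def conj_class_def)
  then have "P (LEAST n. P n)" by (rule LeastI_ex)
  then obtain u where u: "u \<in> carrier F" "h = u \<otimes> a \<otimes> inv u" "wl u = (LEAST n. P n)"
    by (auto simp: P_def)
  have min: "wl u \<le> wl v" if "v \<in> carrier F" "h = v \<otimes> a \<otimes> inv v" for v
    unfolding u(3) by (rule Least_le) (use that P_def in blast)
  note nfu = nf_props[OF u(1)]
  have last: "fst (last (nf u)) \<noteq> a" if ne: "nf u \<noteq> []"
  proof
    assume eq: "fst (last (nf u)) = a"
    define v where "v = eval_word F (butlast (nf u))"
    have bw: "butlast (nf u) \<in> words B" "reduced (butlast (nf u))"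
      using nfu(1,2) ne append_butlast_last_id[OF ne] words_append reduced_append by metis+
    then have v: "v \<in> carrier F" "nf v = butlast (nf u)" by (auto simp: v_def nf_eval)
    define l where "l = eval_letter F (last (nf u))"
    have l: "l \<in> carrier F" using eq a by (simp add: l_def)
    have "eval_word F (butlast (nf u) @ [last (nf u)]) = v \<otimes> l"
      using bw eq a by (simp add: eval_word_append words_F v_def l_def)
    then have uv: "u = v \<otimes> l" using nfu(3) ne by simp
    have la: "l \<otimes> a \<otimes> inv l = a" using eq a unfolding l_def
      by (cases "snd (last (nf u))") (simp_all add: eval_letter_def, simp add: m_assoc)
    have "(v \<otimes> l) \<otimes> a \<otimes> inv (v \<otimes> l) = v \<otimes> (l \<otimes> a \<otimes> inv l) \<otimes> inv v"
      using v(1) a l by (simp add: inv_mult_group m_assoc)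
    then have "h = v \<otimes> a \<otimes> inv v" using u(2) unfolding la uv[symmetric] by simp
    then have "wl u \<le> wl v" using min v by blast
    then have "length (nf u) \<le> length (butlast (nf u))"
      by (simp only: word_length_nf[OF u(1)] word_length_nf[OF v(1)] v(2))
    then show False using ne by (cases "nf u" rule: rev_cases) auto
  qed
  have "nf (u \<otimes> eval_letter F (a, e) [^] n \<otimes> inv u) = nf u @ replicate n (a, e) @ inv_word (nf u)"
    if n: "n > 0" for n :: nat and e
  proof -
    have w: "nf u @ replicate n (a, e) @ inv_word (nf u) \<in> words B" using nfu a by auto
    have "reduced (nf u @ replicate n (a, e) @ inv_word (nf u))"
      using nfu(2) last n by (auto simp: reduced_append hd_inv_word flip_def prod_eq_iff)
    moreover have "eval_word F (nf u @ replicate n (a, e) @ inv_word (nf u))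
        = u \<otimes> eval_letter F (a, e) [^] n \<otimes> inv u"
      using nfu a u by (simp add: eval_word_append words_F eval_inv_word eval_replicate m_assoc)
    ultimately show ?thesis using nf_eval w by metis
  qed
  then show ?thesis using that u by blast
qed

end

section \<open>The boundary of a free group\<close>

lemma common_prefix_length_replicate_ge: "min n m \<le> common_prefix_length (replicate n l @ s) (replicate m l @ t)"
proof (induction n arbitrary: m)
  case (Suc n)
  then show ?case by (cases m) auto
qed simp

context free_group
begin

abbreviation seqs where "seqs \<equiv> gromov_seqs F B"
abbreviation bdry where "bdry \<equiv> gboundary F B"
abbreviation lim where "lim \<equiv> boundary_limit F B"
abbreviation ends_map where "ends_map \<equiv> boundary_map F B"

lemma asymp_iff:
  "gromov_asymp F B x y \<longleftrightarrow> (\<forall>r. \<exists>N. \<forall>i\<ge>N. \<forall>j\<ge>N. r \<le> gprod (x i) (y j))"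
  unfolding gromov_asymp_def filterlim_at_top eventually_prod_sequentially by (simp, blast)

lemma seq_carrier: "x \<in> seqs \<Longrightarrow> x i \<in> carrier F"
  by (auto simp: gromov_seqs_def)

lemma eventually_ultrametric:
  fixes x y z :: "nat \<Rightarrow> 'a"
  assumes "\<And>i. x i \<in> carrier F" "\<And>i. y i \<in> carrier F" "\<And>i. z i \<in> carrier F"
    and "\<exists>N. \<forall>i\<ge>N. \<forall>j\<ge>N. r \<le> gprod (x i) (y j)" "\<exists>N. \<forall>i\<ge>N. \<forall>j\<ge>N. r \<le> gprod (y i) (z j)"
  shows "\<exists>N. \<forall>i\<ge>N. \<forall>j\<ge>N. r \<le> gprod (x i) (z j)"
proof -
  obtain M where M: "\<And>i j. i \<ge> M \<Longrightarrow> j \<ge> M \<Longrightarrow> r \<le> gprod (x i) (y j)"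
    using assms(4) by auto
  obtain N where N: "\<And>i j. i \<ge> N \<Longrightarrow> j \<ge> N \<Longrightarrow> r \<le> gprod (y i) (z j)"
    using assms(5) by auto
  have "r \<le> gprod (x i) (z j)" if "i \<ge> max M N" "j \<ge> max M N" for i j
  proof -
    have "min (gprod (x i) (y (max M N))) (gprod (y (max M N)) (z j)) \<le> gprod (x i) (z j)"
      by (rule gprod_ultrametric) (rule assms)+
    moreover have "r \<le> gprod (x i) (y (max M N))" using that by (intro M) auto
    moreover have "r \<le> gprod (y (max M N)) (z j)" using that by (intro N) auto
    ultimately show ?thesis by linarith
  qed
  then show ?thesis by blast
qed

lemma asymp_sym:
  assumes "\<And>i. x i \<in> carrier F" "\<And>i. y i \<in> carrier F" "gromov_asymp F B x y"
  shows "gromov_asymp F B y x"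
proof -
  have "gprod (y i) (x j) = gprod (x j) (y i)" for i j by (rule gprod_commute) (rule assms)+
  then show ?thesis using assms(3) unfolding asymp_iff by (simp, blast)
qed

lemma asymp_trans:
  assumes "\<And>i. x i \<in> carrier F" "\<And>i. y i \<in> carrier F" "\<And>i. z i \<in> carrier F"
    and "gromov_asymp F B x y" "gromov_asymp F B y z"
  shows "gromov_asymp F B x z"
  unfolding asymp_iff
proof
  fix r
  show "\<exists>N. \<forall>i\<ge>N. \<forall>j\<ge>N. r \<le> gprod (x i) (z j)"
    by (rule eventually_ultrametric[of x y z]) (use assms in \<open>auto simp: asymp_iff\<close>)
qed

lemma equiv_boundary_rel: "equiv seqs (boundary_rel F B)"
proof (rule equivI)
  show "boundary_rel F B \<subseteq> seqs \<times> seqs" by (auto simp: boundary_rel_def)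
  show "refl_on seqs (boundary_rel F B)"
    by (auto simp: refl_on_def boundary_rel_def gromov_seqs_def)
  show "sym (boundary_rel F B)"
    unfolding boundary_rel_def using asymp_sym seq_carrier by (auto intro!: symI)
  show "trans (boundary_rel F B)"
    unfolding boundary_rel_def using asymp_trans seq_carrier by (auto intro!: transI) blast
qed

lemma lim_in [simp]: "x \<in> seqs \<Longrightarrow> lim x \<in> bdry"
  by (simp add: gboundary_def boundary_limit_def quotientI)

lemma lim_eq_iff: "x \<in> seqs \<Longrightarrow> y \<in> seqs \<Longrightarrow> lim x = lim y \<longleftrightarrow> gromov_asymp F B x y"
  using eq_equiv_class_iff[OF equiv_boundary_rel, of x y] by (auto simp: boundary_limit_def boundary_rel_def)

lemma bdry_cases:
  assumes "p \<in> bdry" obtains x where "x \<in> seqs" "p = lim x"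
  using assms unfolding gboundary_def boundary_limit_def by (auto elim: quotientE)

lemma mem_lim_iff: "x \<in> seqs \<Longrightarrow> y \<in> lim x \<longleftrightarrow> y \<in> seqs \<and> gromov_asymp F B x y"
  by (auto simp: boundary_limit_def boundary_rel_def)

lemma lim_self: "x \<in> seqs \<Longrightarrow> x \<in> lim x"
  by (auto simp: mem_lim_iff gromov_seqs_def)

text \<open>For each \<open>r\<close> this is an equivalence relation on the boundary; its classes are the balls of an
  ultrametric.\<close>

definition near :: "real \<Rightarrow> 'a bpoint \<Rightarrow> 'a bpoint \<Rightarrow> bool" where
  "near r p q \<longleftrightarrow> ereal r \<le> boundary_product F B p q"

text \<open>The supremum and the limit inferior in the definition of the product of boundary points can be
  dropped: by ultrametricity the limit does not depend on the representing sequences, and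
  since Gromov products in the Cayley tree are integers, a lower bound that holds in the
  limit is eventually attained.\<close>

lemma near_iff:
  assumes x: "x \<in> seqs" and y: "y \<in> seqs"
  shows "near r (lim x) (lim y) \<longleftrightarrow> (\<exists>N. \<forall>i\<ge>N. \<forall>j\<ge>N. r \<le> gprod (x i) (y j))"
proof
  assume R: "\<exists>N. \<forall>i\<ge>N. \<forall>j\<ge>N. r \<le> gprod (x i) (y j)"
  have "ereal r \<le> Liminf (sequentially \<times>\<^sub>F sequentially) (\<lambda>(i, j). ereal (gprod (x i) (y j)))"
    by (rule Liminf_bounded) (use R in \<open>auto simp: eventually_prod_sequentially\<close>)
  also have "\<dots> \<le> boundary_product F B (lim x) (lim y)"
    unfolding boundary_product_def using lim_self[OF x] lim_self[OF y]
    by (intro SUP_upper2[of x] SUP_upper2[of y]) auto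
  finally show "near r (lim x) (lim y)" by (simp add: near_def)
next
  assume L: "near r (lim x) (lim y)"
  \<comment> \<open>any bound strictly between \<open>\<lceil>r\<rceil> - 1\<close> and \<open>r\<close>, so that integers above it are at least \<open>r\<close>\<close>
  define s where "s = (r + (of_int \<lceil>r\<rceil> - 1)) / 2"
  have s: "s < r" "of_int \<lceil>r\<rceil> - 1 < s" using ceiling_correct[of r] unfolding s_def by (auto simp: field_simps)
  have int_gap: "r \<le> real n" if "s < real n" for n
  proof -
    have "real_of_int (\<lceil>r\<rceil> - 1) < real_of_int (int n)" using that s(2) by simp
    then have "\<lceil>r\<rceil> \<le> int n" unfolding of_int_less_iff by simp
    then show ?thesis by (simp add: ceiling_le_iff)
  qed
  have "ereal s < boundary_product F B (lim x) (lim y)"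
    using L s(1) unfolding near_def by (meson ereal_less_eq(3) less_ereal.simps(1) less_le_trans)
  then obtain x' y' where xy': "x' \<in> lim x" "y' \<in> lim y"
    and gt: "ereal s < Liminf (sequentially \<times>\<^sub>F sequentially) (\<lambda>(i, j). ereal (gprod (x' i) (y' j)))"
    unfolding boundary_product_def less_SUP_iff by blast
  have x': "x' \<in> seqs" "gromov_asymp F B x x'" and y': "y' \<in> seqs" "gromov_asymp F B y y'"
    using xy' x y by (auto simp: mem_lim_iff)
  have "\<forall>\<^sub>F (i, j) in sequentially \<times>\<^sub>F sequentially. ereal s < ereal (gprod (x' i) (y' j))"
    using less_LiminfD[OF gt] by (simp add: case_prod_unfold)
  then have "\<exists>N. \<forall>i\<ge>N. \<forall>j\<ge>N. r \<le> gprod (x' i) (y' j)"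
    unfolding eventually_prod_sequentially using int_gap x'(1) y'(1)
    by (auto simp: gprod_cpl seq_carrier)
  moreover have "\<exists>N. \<forall>i\<ge>N. \<forall>j\<ge>N. r \<le> gprod (x i) (x' j)" using x' by (simp add: asymp_iff)
  moreover have "\<exists>N. \<forall>i\<ge>N. \<forall>j\<ge>N. r \<le> gprod (y' i) (y j)"
    using asymp_sym[of y y'] y' y seq_carrier by (simp add: asymp_iff)
  ultimately show "\<exists>N. \<forall>i\<ge>N. \<forall>j\<ge>N. r \<le> gprod (x i) (y j)"
    using eventually_ultrametric[of x x' y'] eventually_ultrametric[of x y' y] seq_carrier x y x' y' by blast
qed

lemma near_refl: "p \<in> bdry \<Longrightarrow> near r p p"
  by (elim bdry_cases) (auto simp: near_iff gromov_seqs_def asymp_iff)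

lemma near_sym: "p \<in> bdry \<Longrightarrow> q \<in> bdry \<Longrightarrow> near r p q \<Longrightarrow> near r q p"
proof (elim bdry_cases)
  fix x y assume *: "near r p q" "x \<in> seqs" "y \<in> seqs" "p = lim x" "q = lim y"
  have "gprod (x i) (y j) = gprod (y j) (x i)" for i j
    using * by (intro gprod_commute) (auto simp: seq_carrier)
  then show "near r q p" using * by (simp add: near_iff) blast
qed

lemma near_trans:
  assumes "p \<in> bdry" "q \<in> bdry" "s \<in> bdry" "near r p q" "near r q s"
  shows "near r p s"
proof -
  obtain x y z where "x \<in> seqs" "y \<in> seqs" "z \<in> seqs" "p = lim x" "q = lim y" "s = lim z"
    using assms(1-3) by (elim bdry_cases)
  then show ?thesis using assms(4,5) eventually_ultrametric[of x y z r] by (simp add: near_iff seq_carrier)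
qed

lemma near_mono: "near r p q \<Longrightarrow> r' \<le> r \<Longrightarrow> near r' p q"
  unfolding near_def by (meson ereal_less_eq(3) order_trans)

lemma not_near: "p \<in> bdry \<Longrightarrow> q \<in> bdry \<Longrightarrow> p \<noteq> q \<Longrightarrow> \<exists>r. \<not> near r p q"
  by (elim bdry_cases) (auto simp: near_iff lim_eq_iff asymp_iff)

lemma open_iff: "openin (boundary_top F B) U \<longleftrightarrow>
    U \<subseteq> bdry \<and> (\<forall>p\<in>U. \<exists>r. {q \<in> bdry. near r p q} \<subseteq> U)"
  by (simp add: openin_boundary_top boundary_open_def near_def)

lemma topspace_bdry [simp]: "topspace (boundary_top F B) = bdry"
proof -
  have "openin (boundary_top F B) bdry" by (auto simp: open_iff)
  then show ?thesis by (metis open_iff openin_subset openin_topspace subset_antisym)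
qed

lemma open_ball: "p \<in> bdry \<Longrightarrow> openin (boundary_top F B) {q \<in> bdry. near r p q}"
  unfolding open_iff using near_trans by blast

lemma topspace_double [simp]: "topspace (double_boundary_top F B) = {(p, q). p \<in> bdry \<and> q \<in> bdry \<and> p \<noteq> q}"
  by (auto simp: double_boundary_top_def)

text \<open>The condition under which a map extends continuously to the boundary: points whose Gromov product
  is large have images whose Gromov product is large.\<close>

definition visual :: "('a \<Rightarrow> 'a) \<Rightarrow> bool" where
  "visual f \<longleftrightarrow> f \<in> carrier F \<rightarrow> carrier F \<and>
     (\<forall>r. \<exists>s. \<forall>g\<in>carrier F. \<forall>h\<in>carrier F. s \<le> gprod g h \<longrightarrow> r \<le> gprod (f g) (f h))"

lemma visual_eventually:
  assumes "visual f" obtains s where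
    "\<And>x y :: nat \<Rightarrow> 'a. \<lbrakk>\<And>i. x i \<in> carrier F; \<And>i. y i \<in> carrier F; \<exists>N. \<forall>i\<ge>N. \<forall>j\<ge>N. s \<le> gprod (x i) (y j)\<rbrakk> \<Longrightarrow>
       \<exists>N. \<forall>i\<ge>N. \<forall>j\<ge>N. r \<le> gprod ((f \<circ> x) i) ((f \<circ> y) j)"
  using assms unfolding visual_def by (metis comp_apply)

lemma visual_asymp:
  assumes f: "visual f" and xy: "\<And>i. x i \<in> carrier F" "\<And>i. y i \<in> carrier F" "gromov_asymp F B x y"
  shows "gromov_asymp F B (f \<circ> x) (f \<circ> y)"
  unfolding asymp_iff
proof
  fix r
  obtain s where "\<And>x y :: nat \<Rightarrow> 'a. \<lbrakk>\<And>i. x i \<in> carrier F; \<And>i. y i \<in> carrier F; \<exists>N. \<forall>i\<ge>N. \<forall>j\<ge>N. s \<le> gprod (x i) (y j)\<rbrakk> \<Longrightarrow>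
       \<exists>N. \<forall>i\<ge>N. \<forall>j\<ge>N. r \<le> gprod ((f \<circ> x) i) ((f \<circ> y) j)"
    using visual_eventually[OF f, of r] by blast
  from this[OF xy(1,2)] show "\<exists>N. \<forall>i\<ge>N. \<forall>j\<ge>N. r \<le> gprod ((f \<circ> x) i) ((f \<circ> y) j)"
    using xy(3) by (simp add: asymp_iff)
qed

lemma visual_seqs:
  assumes f: "visual f" and x: "x \<in> seqs"
  shows "f \<circ> x \<in> seqs"
proof -
  have "gromov_asymp F B (f \<circ> x) (f \<circ> x)"
    by (rule visual_asymp[OF f]) (use x seq_carrier[OF x] in \<open>auto simp: gromov_seqs_def\<close>)
  then show ?thesis using f seq_carrier[OF x] by (auto simp: gromov_seqs_def visual_def)
qed

text \<open>Asymptotic sequences have asymptotic images, so all the sequences in a boundary point yield the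
  same limit.\<close>

lemma ends_map_lim:
  assumes f: "visual f" and x: "x \<in> seqs"
  shows "ends_map f (lim x) = lim (f \<circ> x)"
proof -
  have "lim (f \<circ> y) = lim (f \<circ> x)" if "y \<in> lim x" for y
  proof -
    have y: "y \<in> seqs" "gromov_asymp F B x y" using that x by (auto simp: mem_lim_iff)
    then show ?thesis
      using visual_asymp[OF f, of x y] visual_seqs[OF f] x lim_eq_iff[of "f \<circ> x" "f \<circ> y"]
      by (simp add: seq_carrier)
  qed
  then show ?thesis using lim_self[OF x] unfolding boundary_map_def by blast
qed

lemma ends_map_bdry: "visual f \<Longrightarrow> p \<in> bdry \<Longrightarrow> ends_map f p \<in> bdry"
  by (elim bdry_cases) (simp add: ends_map_lim visual_seqs)

lemma ends_map_near:
  assumes f: "visual f"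
  shows "\<exists>s. \<forall>p\<in>bdry. \<forall>q\<in>bdry. near s p q \<longrightarrow> near r (ends_map f p) (ends_map f q)"
proof -
  obtain s where s: "\<And>x y :: nat \<Rightarrow> 'a. \<lbrakk>\<And>i. x i \<in> carrier F; \<And>i. y i \<in> carrier F; \<exists>N. \<forall>i\<ge>N. \<forall>j\<ge>N. s \<le> gprod (x i) (y j)\<rbrakk> \<Longrightarrow>
       \<exists>N. \<forall>i\<ge>N. \<forall>j\<ge>N. r \<le> gprod ((f \<circ> x) i) ((f \<circ> y) j)"
    using visual_eventually[OF f, of r] by blast
  have "near r (ends_map f p) (ends_map f q)" if pq: "p \<in> bdry" "q \<in> bdry" "near s p q" for p q
  proof -
    obtain x y where xy: "x \<in> seqs" "y \<in> seqs" "p = lim x" "q = lim y" using pq by (elim bdry_cases)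
    then show ?thesis using pq(3) s[of x y]
      by (simp add: ends_map_lim[OF f] near_iff visual_seqs[OF f] seq_carrier)
  qed
  then show ?thesis by blast
qed

lemma ends_map_continuous:
  assumes f: "visual f"
  shows "continuous_map (boundary_top F B) (boundary_top F B) (ends_map f)"
  unfolding continuous_map_def
proof (intro conjI allI impI)
  show "ends_map f \<in> topspace (boundary_top F B) \<rightarrow> topspace (boundary_top F B)"
    using ends_map_bdry[OF f] by simp
  fix U assume U: "openin (boundary_top F B) U"
  show "openin (boundary_top F B) {x \<in> topspace (boundary_top F B). ends_map f x \<in> U}"
    unfolding open_iff
  proof (intro conjI ballI)
    fix p assume p: "p \<in> {x \<in> topspace (boundary_top F B). ends_map f x \<in> U}"
    then obtain r where r: "{q \<in> bdry. near r (ends_map f p) q} \<subseteq> U" using U by (auto simp: open_iff)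
    obtain s where "\<forall>p\<in>bdry. \<forall>q\<in>bdry. near s p q \<longrightarrow> near r (ends_map f p) (ends_map f q)"
      using ends_map_near[OF f] by blast
    then show "\<exists>r. {q \<in> bdry. near r p q} \<subseteq> {x \<in> topspace (boundary_top F B). ends_map f x \<in> U}"
      using r p ends_map_bdry[OF f] by (intro exI[of _ s]) auto
  qed auto
qed

lemma ends_map_inverse:
  assumes f: "visual f" and g: "visual g" and inv: "\<And>x. x \<in> carrier F \<Longrightarrow> g (f x) = x" and p: "p \<in> bdry"
  shows "ends_map g (ends_map f p) = p"
proof -
  obtain x where x: "x \<in> seqs" "p = lim x" using p by (rule bdry_cases)
  have "g \<circ> (f \<circ> x) = x" using inv seq_carrier[OF x(1)] by auto
  then show ?thesis using x by (simp add: ends_map_lim f g visual_seqs)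
qed

text \<open>An inverse is needed to keep distinct boundary points distinct.\<close>

lemma double_map_continuous:
  assumes f: "visual f" and g: "visual g" and inv: "\<And>x. x \<in> carrier F \<Longrightarrow> g (f x) = x"
  shows "continuous_map (double_boundary_top F B) (double_boundary_top F B) (double_boundary_map F B f)"
proof -
  have "continuous_map (prod_topology (boundary_top F B) (boundary_top F B))
      (prod_topology (boundary_top F B) (boundary_top F B)) (double_boundary_map F B f)"
    using ends_map_continuous[OF f] unfolding double_boundary_map_def map_prod_def
    by (simp add: continuous_map_prod_top)
  moreover have "double_boundary_map F B f z \<in> {(p, q). p \<noteq> q}" if z: "z \<in> topspace (double_boundary_top F B)" for z
  proof -
    obtain p q where pq: "z = (p, q)" "p \<in> bdry" "q \<in> bdry" "p \<noteq> q" using z by auto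
    then have "ends_map f p \<noteq> ends_map f q"
      using ends_map_inverse[OF f g inv pq(2)] ends_map_inverse[OF f g inv pq(3)] by metis
    then show ?thesis using pq(1) by (simp add: double_boundary_map_def)
  qed
  ultimately show ?thesis
    unfolding double_boundary_top_def
    by (intro continuous_map_into_subtopology continuous_map_from_subtopology)
      (auto simp: double_boundary_top_def)
qed

lemma visual_translation:
  assumes u: "u \<in> carrier F"
  shows "visual (\<lambda>x. u \<otimes> x)"
proof -
  have bound: "gprod g h - wl u \<le> gprod (u \<otimes> g) (u \<otimes> h)" if gh: "g \<in> carrier F" "h \<in> carrier F" for g h
  proof -
    have i: "inv (u \<otimes> g) \<otimes> (u \<otimes> h) = inv g \<otimes> h" using u gh by (simp add: inv_mult_group m_assoc inv_solve_left')
    have "wl x \<le> wl u + wl (u \<otimes> x)" if "x \<in> carrier F" for x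
      using wl_mult[of "inv u" "u \<otimes> x"] u that by (simp add: wl_inv m_assoc[symmetric])
    then have "real (wl g) \<le> wl u + wl (u \<otimes> g)" "real (wl h) \<le> wl u + wl (u \<otimes> h)"
      using gh by (metis of_nat_add of_nat_mono)+
    then show ?thesis
      using gprod_alt[OF gh] gprod_alt[of "u \<otimes> g" "u \<otimes> h"] i u gh by (simp add: field_simps)
  qed
  show ?thesis
    unfolding visual_def
  proof (intro conjI allI)
    show "(\<otimes>) u \<in> carrier F \<rightarrow> carrier F" using u by auto
    fix r :: real
    have "r \<le> gprod (u \<otimes> g) (u \<otimes> h)" if "g \<in> carrier F" "h \<in> carrier F" "r + wl u \<le> gprod g h" for g h
      using that(3) bound[OF that(1,2)] by linarith
    then show "\<exists>s. \<forall>g\<in>carrier F. \<forall>h\<in>carrier F. s \<le> gprod g h \<longrightarrow> r \<le> gprod (u \<otimes> g) (u \<otimes> h)"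
      by (intro exI[of _ "r + wl u"]) auto
  qed
qed

text \<open>A form of bounded cancellation. Let \<open>x\<close> and \<open>y\<close> have a long common prefix. All vertices on the
  geodesic from \<open>x\<close> to \<open>y\<close> are far from the identity, and so are their images, because the inverse
  automorphism lengthens words by a bounded factor only. Consecutive vertices have images at
  distance at most \<open>K1\<close>, hence consecutive images have a large Gromov product, and by ultrametricity
  so do the images of \<open>x\<close> and \<open>y\<close>.\<close>

lemma visual_automorphism:
  assumes fin: "finite B" and f: "f \<in> hom F F" and g: "g \<in> hom F F"
    and inv: "\<And>x. x \<in> carrier F \<Longrightarrow> g (f x) = x"
  shows "visual f"
proof -
  have lip: "\<exists>K. \<forall>x\<in>carrier F. wl (\<phi> x) \<le> K * wl x" if \<phi>: "\<phi> \<in> hom F F" for \<phi>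
  proof -
    have gh: "group_hom F F \<phi>" using \<phi> is_group by (simp add: group_hom_def group_hom_axioms_def)
    have \<phi>c: "\<phi> x \<in> carrier F" if "x \<in> carrier F" for x using \<phi> that by (auto simp: hom_def)
    define K where "K = (\<Sum>b\<in>B. wl (\<phi> b))"
    have "wl (\<phi> (eval_word F w)) \<le> K * length w" if "w \<in> words B" for w
      using that
    proof (induction w)
      case Nil
      have "wl \<one> = 0" using wl_mult[of \<one> \<one>] nf_eval[of "[]"] by (simp add: word_length_nf reduced_def)
      then show ?case using group_hom.hom_one[OF gh] by simp
    next
      case (Cons l w)
      have "wl (\<phi> (fst l)) \<le> K" unfolding K_def using fin Cons.prems by (intro member_le_sum) auto
      then have "wl (\<phi> (eval_letter F l)) \<le> K"
        using Cons.prems group_hom.hom_inv[OF gh] \<phi>c by (auto simp: eval_letter_def wl_inv)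
      moreover have "\<phi> (eval_word F (l # w)) = \<phi> (eval_letter F l) \<otimes> \<phi> (eval_word F w)"
        using Cons.prems \<phi> by (simp add: hom_mult)
      ultimately show ?case
        using Cons wl_mult[of "\<phi> (eval_letter F l)" "\<phi> (eval_word F w)"] \<phi>c by auto
    qed
    then have "wl (\<phi> x) \<le> K * wl x" if "x \<in> carrier F" for x
      using nf_props[OF that] word_length_nf[OF that] by metis
    then show ?thesis by blast
  qed
  obtain K1 where K1: "\<And>x. x \<in> carrier F \<Longrightarrow> wl (f x) \<le> K1 * wl x" using lip[OF f] by blast
  obtain K2 where K2: "\<And>x. x \<in> carrier F \<Longrightarrow> wl (g x) \<le> K2 * wl x" using lip[OF g] by blast
  have fc: "f x \<in> carrier F" if "x \<in> carrier F" for x using f that by (auto simp: hom_def)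
  have gh: "group_hom F F f" using f is_group by (simp add: group_hom_def group_hom_axioms_def)
  have prefix: "r \<le> gprod (f (eval_word F (p @ s))) (f (eval_word F p))"
    if ps: "p @ s \<in> words B" "reduced (p @ s)" and big: "(real K2 + 1) * (r + K1) \<le> length p" and "0 \<le> r"
    for p s and r :: real
    using ps
  proof (induction s rule: rev_induct)
    have far: "r + K1 \<le> wl (f z)" if "z \<in> carrier F" "length p \<le> wl z" for z
    proof -
      have "real (wl z) \<le> (real K2 + 1) * wl (f z)"
        using K2[OF fc[OF that(1)]] inv[OF that(1)] by (simp add: algebra_simps flip: of_nat_mult of_nat_add)
      then have "(real K2 + 1) * (r + K1) \<le> (real K2 + 1) * wl (f z)" using big that(2) by linarith
      then show ?thesis by (simp add: mult_le_cancel_left_pos add_pos_nonneg)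
    qed
    {
      case Nil
      then show ?case using far[of "eval_word F p"] fc \<open>0 \<le> r\<close>
        by (simp add: gprod_self word_length_nf[of "eval_word F p"] nf_eval)
    next
      case (snoc l s)
      define z where "z = eval_word F (p @ s)"
      have w: "p @ s \<in> words B" "reduced (p @ s)" "fst l \<in> B"
        using snoc.prems by (auto simp: reduced_append)
      have z: "z \<in> carrier F" "length p \<le> wl z"
        using w by (auto simp: z_def word_length_nf nf_eval simp del: words_append)
      have l: "eval_letter F l \<in> carrier F" using w by simp
      have zl: "eval_word F (p @ s @ [l]) = z \<otimes> eval_letter F l"
        using eval_word_append[of "p @ s" "[l]"] w by (simp add: words_F z_def del: words_append)
      have "wl (eval_letter F l) = 1" using w(3) by (auto simp: eval_letter_def wl_inv wl_basis)
      then have small: "wl (f (eval_letter F l)) \<le> K1" using K1[OF l] by simp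
      have "inv (f z) \<otimes> f (z \<otimes> eval_letter F l) = f (eval_letter F l)"
        using z(1) l f fc by (simp add: hom_mult m_assoc[symmetric])
      then have dist: "gprod (f z) (f (z \<otimes> eval_letter F l))
          = (real (wl (f z)) + real (wl (f (z \<otimes> eval_letter F l))) - real (wl (f (eval_letter F l)))) / 2"
        using z(1) l fc by (simp add: gprod_alt)
      have "f z = f (z \<otimes> eval_letter F l) \<otimes> inv (f (eval_letter F l))"
        using z(1) l f fc by (simp add: hom_mult m_assoc)
      then have "wl (f z) \<le> wl (f (z \<otimes> eval_letter F l)) + wl (f (eval_letter F l))"
        using wl_mult[of "f (z \<otimes> eval_letter F l)" "inv (f (eval_letter F l))"] z(1) l fc by (simp add: wl_inv)
      then have "r \<le> gprod (f (z \<otimes> eval_letter F l)) (f z)"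
        using dist far[OF z] small gprod_commute[of "f z" "f (z \<otimes> eval_letter F l)"] z(1) l fc by simp
      moreover have "r \<le> gprod (f z) (f (eval_word F p))"
        using snoc.IH w by (simp add: z_def)
      ultimately show ?case
        using gprod_ultrametric[of "f (z \<otimes> eval_letter F l)" "f z" "f (eval_word F p)"] z(1) l fc w zl by simp
    }
  qed
  have main: "r \<le> gprod (f x) (f y)"
    if xy: "x \<in> carrier F" "y \<in> carrier F" and big: "(real K2 + 1) * (r + K1) \<le> gprod x y" "0 \<le> r" for x y and r :: real
  proof -
    obtain p s s' where ps: "nf x = p @ s" "nf y = p @ s'" "common_prefix_length (nf x) (nf y) = length p"
      by (rule common_prefix_length_split)
    have len: "(real K2 + 1) * (r + K1) \<le> length p" using big(1) xy ps(3) by (simp add: gprod_cpl)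
    have w: "p @ s \<in> words B" "reduced (p @ s)" "eval_word F (p @ s) = x"
        "p @ s' \<in> words B" "reduced (p @ s')" "eval_word F (p @ s') = y"
      using nf_props[OF xy(1)] nf_props[OF xy(2)] ps(1,2) by auto
    then have p: "eval_word F p \<in> carrier F" by simp
    have "r \<le> gprod (f x) (f (eval_word F p))" "r \<le> gprod (f y) (f (eval_word F p))"
      using prefix[OF w(1,2) len big(2)] prefix[OF w(4,5) len big(2)] w by auto
    then show ?thesis
      using gprod_ultrametric[of "f x" "f (eval_word F p)" "f y"] gprod_commute[of "f y" "f (eval_word F p)"]
        fc xy p by simp
  qed
  show ?thesis
    unfolding visual_def
  proof (intro conjI allI)
    show "f \<in> carrier F \<rightarrow> carrier F" using fc by auto
    fix r
    show "\<exists>s. \<forall>g\<in>carrier F. \<forall>h\<in>carrier F. s \<le> gprod g h \<longrightarrow> r \<le> gprod (f g) (f h)"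
      using main[of _ _ "max 0 r"] by (intro exI[of _ "(real K2 + 1) * (max 0 r + K1)"]) auto
  qed
qed

text \<open>A perturbation of a sequence by steps of bounded length does not change its limit.\<close>

lemma lim_cong:
  assumes "\<And>i. x i \<in> carrier F" "\<And>i. y i \<in> carrier F" "x \<in> seqs" "y \<in> seqs"
    and "\<And>i. real (wl (x i)) - C \<le> gprod (x i) (y i)"
  shows "lim x = lim y"
proof -
  have "\<exists>N. \<forall>i\<ge>N. \<forall>j\<ge>N. r \<le> gprod (x i) (y j)" for r
  proof -
    have "gromov_asymp F B x x" using assms(3) by (simp add: gromov_seqs_def)
    then obtain M where "\<forall>i\<ge>M. \<forall>j\<ge>M. r + \<bar>C\<bar> \<le> gprod (x i) (x j)"
      unfolding asymp_iff by (elim allE[of _ "r + \<bar>C\<bar>"]) auto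
    then have M: "r + \<bar>C\<bar> \<le> gprod (x i) (x j)" if "i \<ge> M" "j \<ge> M" for i j using that by auto
    have "r \<le> gprod (x i) (y j)" if "i \<ge> M" "j \<ge> M" for i j
    proof -
      have "r + \<bar>C\<bar> \<le> wl (x j)" using M[of j j] that assms(1) by (simp add: gprod_self)
      then have "r \<le> gprod (x j) (y j)" using assms(5)[of j] by linarith
      moreover have "r \<le> gprod (x i) (x j)" using M[OF that] by linarith
      ultimately show ?thesis using gprod_ultrametric[of "x i" "x j" "y j"] assms(1,2) by force
    qed
    then show ?thesis by blast
  qed
  then show ?thesis using assms(3,4) by (simp add: lim_eq_iff asymp_iff)
qed

lemma conj_class_closed: "a \<in> carrier F \<Longrightarrow> h \<in> conj_class F a \<Longrightarrow> h \<in> carrier F"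
  by (auto simp: conj_class_def)

section \<open>Ends of conjugates of a basis element\<close>

context
  fixes a assumes a: "a \<in> B"
begin

text \<open>The reduced words of \<open>h\<^sup>n\<close> and \<open>h\<^sup>-\<^sup>n\<close> for \<open>n > 0\<close> share exactly the word of the reduced
  conjugator \<open>u\<close>, whose length is the distance of the axis of \<open>h\<close> from the identity.\<close>

lemma conj_class_ends:
  assumes h: "h \<in> conj_class F a"
  obtains u where "u \<in> carrier F" "h = u \<otimes> a \<otimes> inv u"
    "(\<lambda>n. h [^] (n::nat)) \<in> seqs" "(\<lambda>n. inv h [^] (n::nat)) \<in> seqs"
    "\<And>r. near r (neg_end F B h) (pos_end F B h) \<longleftrightarrow> r \<le> wl u"
proof -
  obtain u where u: "u \<in> carrier F" "h = u \<otimes> a \<otimes> inv u"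
    and nfu: "\<And>n e. n > 0 \<Longrightarrow> nf (u \<otimes> eval_letter F (a, e) [^] (n::nat) \<otimes> inv u)
       = nf u @ replicate n (a, e) @ inv_word (nf u)"
    using conjugate_normal_form[OF a h] by blast
  have ih: "inv h = u \<otimes> inv a \<otimes> inv u" using u a by (simp add: inv_mult_group m_assoc)
  have hc: "h \<in> carrier F" using u a by simp
  have p: "nf (h [^] n) = nf u @ replicate n (a, True) @ inv_word (nf u)" if "n > 0" for n :: nat
    using nfu[OF that, of True] u a by (simp add: conj_pow eval_letter_def)
  have m: "nf (inv h [^] n) = nf u @ replicate n (a, False) @ inv_word (nf u)" if "n > 0" for n :: nat
    using nfu[OF that, of False] conj_pow[OF u(1), of "inv a" n] a unfolding ih by (simp add: eval_letter_def)
  have seq: "x \<in> seqs" if "\<And>n. x n \<in> carrier F" "\<And>n. n > 0 \<Longrightarrow> nf (x n) = nf u @ replicate n l @ inv_word (nf u)" for x l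
  proof -
    have "\<exists>N. \<forall>i\<ge>N. \<forall>j\<ge>N. r \<le> gprod (x i) (x j)" for r
    proof (intro exI[of _ "nat \<lceil>r\<rceil> + 1"] allI impI)
      fix i j assume ij: "nat \<lceil>r\<rceil> + 1 \<le> i" "nat \<lceil>r\<rceil> + 1 \<le> j"
      have "min i j \<le> common_prefix_length (replicate i l @ inv_word (nf u)) (replicate j l @ inv_word (nf u))"
        by (rule common_prefix_length_replicate_ge)
      moreover have "r \<le> min i j" using ij by linarith
      ultimately show "r \<le> gprod (x i) (x j)" using that ij by (simp add: gprod_cpl)
    qed
    then show ?thesis using that(1) by (auto simp: gromov_seqs_def asymp_iff)
  qed
  have s1: "(\<lambda>n. h [^] (n::nat)) \<in> seqs" by (rule seq[OF _ p]) (use hc in auto)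
  have s2: "(\<lambda>n. inv h [^] (n::nat)) \<in> seqs" by (rule seq[OF _ m]) (use hc in auto)
  have val: "gprod (inv h [^] i) (h [^] j) = wl u" if "i > 0" "j > 0" for i j :: nat
  proof -
    have "common_prefix_length (replicate i (a, False) @ v) (replicate j (a, True) @ v) = 0" for v
      using that by (cases i; cases j) auto
    then show ?thesis using that p m hc u(1) by (simp add: gprod_cpl word_length_nf)
  qed
  have "near r (neg_end F B h) (pos_end F B h) \<longleftrightarrow> r \<le> wl u" for r
    unfolding neg_end_def pos_end_def near_iff[OF s2 s1]
  proof
    assume "\<exists>N::nat. \<forall>i\<ge>N. \<forall>j\<ge>N. r \<le> gprod (inv h [^] i) (h [^] j)"
    then obtain N :: nat where "\<forall>i\<ge>N. \<forall>j\<ge>N. r \<le> gprod (inv h [^] i) (h [^] j)" by blast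
    then have "r \<le> gprod (inv h [^] Suc N) (h [^] Suc N)" by (meson Suc_n_not_le_n nat_le_linear)
    then show "r \<le> wl u" using val[of "Suc N" "Suc N"] by simp
  next
    assume "r \<le> wl u"
    then show "\<exists>N::nat. \<forall>i\<ge>N. \<forall>j\<ge>N. r \<le> gprod (inv h [^] i) (h [^] j)"
      using val by (intro exI[of _ 1]) auto
  qed
  then show ?thesis using that u s1 s2 by blast
qed

lemma ends_in_bdry:
  assumes h: "h \<in> conj_class F a"
  shows "pos_end F B h \<in> bdry" "neg_end F B h \<in> bdry" "neg_end F B h \<noteq> pos_end F B h"
proof -
  obtain u where u: "(\<lambda>n. h [^] (n::nat)) \<in> seqs" "(\<lambda>n. inv h [^] (n::nat)) \<in> seqs"
    "\<And>r. near r (neg_end F B h) (pos_end F B h) \<longleftrightarrow> r \<le> wl u"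
    using conj_class_ends[OF h] by metis
  show "pos_end F B h \<in> bdry" "neg_end F B h \<in> bdry"
    using u(1,2) by (simp_all add: pos_end_def neg_end_def)
  then show "neg_end F B h \<noteq> pos_end F B h"
    using u(3)[of "real (wl u) + 1"] near_refl by force
qed

lemma finite_short: "finite B \<Longrightarrow> finite {u \<in> carrier F. wl u \<le> n}"
proof -
  assume "finite B"
  then have "finite {w. set w \<subseteq> B \<times> (UNIV :: bool set) \<and> length w \<le> n}"
    by (intro finite_lists_length_le) auto
  moreover have "{u \<in> carrier F. wl u \<le> n} \<subseteq> eval_word F ` {w. set w \<subseteq> B \<times> UNIV \<and> length w \<le> n}"
  proof
    fix u assume "u \<in> {u \<in> carrier F. wl u \<le> n}"
    then have u: "u \<in> carrier F" "wl u \<le> n" by auto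
    then have "nf u \<in> {w. set w \<subseteq> B \<times> UNIV \<and> length w \<le> n}"
      using nf_props(1)[OF u(1)] by (auto simp: words_def word_length_nf lists_eq_set)
    then show "u \<in> eval_word F ` {w. set w \<subseteq> B \<times> UNIV \<and> length w \<le> n}"
      using nf_props(3)[OF u(1)] by (intro image_eqI[of _ _ "nf u"]) auto
  qed
  ultimately show ?thesis by (meson finite_imageI finite_subset)
qed

text \<open>Only finitely many axes meet a given ball around the identity. This is the source of the
  finiteness of the rational current on compact sets.\<close>

lemma finite_axes:
  assumes fin: "finite B"
  shows "finite {h \<in> conj_class F a. \<not> near r (neg_end F B h) (pos_end F B h)}"
proof -
  have "{h \<in> conj_class F a. \<not> near r (neg_end F B h) (pos_end F B h)}
      \<subseteq> (\<lambda>u. u \<otimes> a \<otimes> inv u) ` {u \<in> carrier F. wl u \<le> nat \<lceil>r\<rceil>}"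
  proof
    fix h assume h: "h \<in> {h \<in> conj_class F a. \<not> near r (neg_end F B h) (pos_end F B h)}"
    then obtain u where u: "u \<in> carrier F" "h = u \<otimes> a \<otimes> inv u"
        "\<And>r. near r (neg_end F B h) (pos_end F B h) \<longleftrightarrow> r \<le> wl u"
      using conj_class_ends by (metis (no_types, lifting) mem_Collect_eq)
    then have "wl u \<le> nat \<lceil>r\<rceil>" using h by simp linarith
    then show "h \<in> (\<lambda>u. u \<otimes> a \<otimes> inv u) ` {u \<in> carrier F. wl u \<le> nat \<lceil>r\<rceil>}" using u by blast
  qed
  then show ?thesis using finite_short[OF fin] finite_subset by blast
qed

text \<open>The sequences \<open>u h\<^sup>n\<close> and \<open>(u h u\<^sup>-\<^sup>1)\<^sup>n = u h\<^sup>n u\<^sup>-\<^sup>1\<close> stay at bounded distance.\<close>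

lemma translate_ends:
  assumes h: "h \<in> conj_class F a" and u: "u \<in> carrier F"
  shows "u \<otimes> h \<otimes> inv u \<in> conj_class F a"
    "ends_map (\<lambda>x. u \<otimes> x) (pos_end F B h) = pos_end F B (u \<otimes> h \<otimes> inv u)"
    "ends_map (\<lambda>x. u \<otimes> x) (neg_end F B h) = neg_end F B (u \<otimes> h \<otimes> inv u)"
proof -
  obtain v where v: "v \<in> carrier F" "h = v \<otimes> a \<otimes> inv v" using h by (auto simp: conj_class_def)
  have aF: "a \<in> carrier F" using a by simp
  have "u \<otimes> h \<otimes> inv u = (u \<otimes> v) \<otimes> a \<otimes> inv (u \<otimes> v)" using u v aF by (simp add: inv_mult_group m_assoc)
  then show k: "u \<otimes> h \<otimes> inv u \<in> conj_class F a" using u v unfolding conj_class_def by blast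
  have hF: "h \<in> carrier F" using v aF by simp
  have ends: "ends_map (\<lambda>x. u \<otimes> x) (pos_end F B g) = pos_end F B (u \<otimes> g \<otimes> inv u)"
    if g: "g \<in> carrier F" and s: "(\<lambda>n. g [^] (n::nat)) \<in> seqs" "(\<lambda>n. (u \<otimes> g \<otimes> inv u) [^] (n::nat)) \<in> seqs" for g
  proof -
    let ?x = "\<lambda>n::nat. u \<otimes> g [^] n" and ?y = "\<lambda>n. (u \<otimes> g \<otimes> inv u) [^] (n::nat)"
    have x: "?x \<in> seqs" using visual_seqs[OF visual_translation[OF u] s(1)] by (simp add: o_def)
    have "lim ?x = lim ?y"
    proof (rule lim_cong[where C = "real (wl u)", OF _ _ x s(2)])
      fix i
      have y: "?y i = ?x i \<otimes> inv u" using conj_pow[OF u g] by simp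
      have "inv X \<otimes> (X \<otimes> inv u) = inv u" if "X \<in> carrier F" for X
        using that u by (simp flip: m_assoc)
      then have "inv (?x i) \<otimes> ?y i = inv u" unfolding y using u g by simp
      moreover have "wl (?x i) \<le> wl (?y i) + wl u"
        using wl_mult[of "?y i" u] u g unfolding y by (simp add: m_assoc)
      ultimately show "real (wl (?x i)) - real (wl u) \<le> gprod (?x i) (?y i)"
        using u g by (simp add: gprod_alt wl_inv)
    qed (use u g in auto)
    then show ?thesis using ends_map_lim[OF visual_translation[OF u] s(1)] by (simp add: pos_end_def o_def)
  qed
  show "ends_map (\<lambda>x. u \<otimes> x) (pos_end F B h) = pos_end F B (u \<otimes> h \<otimes> inv u)"
    using ends[OF hF] conj_class_ends[OF h] conj_class_ends[OF k] by metis
  have "inv (u \<otimes> h \<otimes> inv u) = u \<otimes> inv h \<otimes> inv u" using u hF by (simp add: inv_mult_group m_assoc)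
  then show "ends_map (\<lambda>x. u \<otimes> x) (neg_end F B h) = neg_end F B (u \<otimes> h \<otimes> inv u)"
    using ends[of "inv h"] conj_class_ends[OF h] conj_class_ends[OF k] hF unfolding neg_end_def
    by (metis inv_closed)
qed

lemma automorphism_ends:
  assumes h: "h \<in> conj_class F a" and f: "f \<in> hom F F" "visual f"
  shows "ends_map f (pos_end F B h) = pos_end F B (f h)" "ends_map f (neg_end F B h) = neg_end F B (f h)"
proof -
  have hF: "h \<in> carrier F" using conj_class_closed[OF _ h] a by simp
  have gh: "group_hom F F f" using f is_group by (simp add: group_hom_def group_hom_axioms_def)
  have pow: "f (g [^] (n::nat)) = f g [^] n" if "g \<in> carrier F" for g n
    using group_hom.hom_nat_pow[OF gh that] by simp
  have s: "(\<lambda>n. h [^] (n::nat)) \<in> seqs" "(\<lambda>n. inv h [^] (n::nat)) \<in> seqs" using conj_class_ends[OF h] by metis+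
  show "ends_map f (pos_end F B h) = pos_end F B (f h)"
    using ends_map_lim[OF f(2) s(1)] pow[OF hF] by (simp add: pos_end_def o_def)
  show "ends_map f (neg_end F B h) = neg_end F B (f h)"
    using ends_map_lim[OF f(2) s(2)] pow[of "inv h"] hF group_hom.hom_inv[OF gh hF]
    by (simp add: neg_end_def pos_end_def o_def)
qed

end

end

section \<open>Rational currents\<close>

lemma topspace_quotient_topology [simp]: "topspace (quotient_topology X q) = q ` topspace X"
proof -
  have "{x \<in> topspace X. q x \<in> q ` topspace X} = topspace X" by auto
  then have "openin (quotient_topology X q) (q ` topspace X)"
    by (simp add: openin_quotient_topology)
  then show ?thesis
    using openin_quotient_topology[of X q "topspace (quotient_topology X q)"] openin_subset by fastforce
qed

lemma sigma_algebra_borel_sets: "sigma_algebra (topspace X) (borel_sets X)"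
  unfolding borel_sets_def by (rule sigma_algebra_sigma_sets) (auto dest: openin_subset)

lemma borel_sets_open: "openin X U \<Longrightarrow> U \<in> borel_sets X"
  by (simp add: borel_sets_def)

lemma borel_sets_subset: "S \<in> borel_sets X \<Longrightarrow> S \<subseteq> topspace X"
  unfolding borel_sets_def by (rule sigma_sets_into_sp) (auto dest: openin_subset)

lemma borel_sets_closed:
  assumes "closedin X A" shows "A \<in> borel_sets X"
proof -
  have "topspace X - (topspace X - A) \<in> borel_sets X"
    unfolding borel_sets_def using assms by (intro sigma_sets.Compl sigma_sets.Basic) auto
  moreover have "topspace X - (topspace X - A) = A" using closedin_subset[OF assms] by auto
  ultimately show ?thesis by simp
qed

lemma space_borel_space [simp]: "space (borel_space X) = topspace X"
  unfolding borel_space_def by (rule space_measure_of) (auto dest: openin_subset)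

lemma sets_borel_space [simp]: "sets (borel_space X) = borel_sets X"
  unfolding borel_space_def borel_sets_def by (rule sets_measure_of) (auto dest: openin_subset)

lemma continuous_map_borel_vimage:
  assumes f: "continuous_map X Y f" and S: "S \<in> borel_sets Y"
  shows "f -` S \<inter> topspace X \<in> borel_sets X"
proof -
  have "f \<in> measurable (borel_space X) (borel_space Y)"
    unfolding borel_space_def[of Y]
  proof (rule measurable_measure_of)
    show "{U. openin Y U} \<subseteq> Pow (topspace Y)" by (auto dest: openin_subset)
    show "f \<in> space (borel_space X) \<rightarrow> topspace Y"
      using continuous_map_funspace[OF f] by simp
    fix U assume "U \<in> {U. openin Y U}"
    then have "openin X {x \<in> topspace X. f x \<in> U}" using f by (auto simp: continuous_map_def)
    moreover have "{x \<in> topspace X. f x \<in> U} = f -` U \<inter> space (borel_space X)" by auto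
    ultimately show "f -` U \<inter> space (borel_space X) \<in> sets (borel_space X)"
      using borel_sets_open by auto
  qed
  from measurable_sets[OF this, of S] S show ?thesis by simp
qed

context free_group
begin

abbreviation DB where "DB \<equiv> double_boundary_top F B"

lemma Hausdorff_boundary: "Hausdorff_space (boundary_top F B)"
  unfolding Hausdorff_space_def
proof (intro allI impI)
  fix p q assume pq: "p \<in> topspace (boundary_top F B) \<and> q \<in> topspace (boundary_top F B) \<and> p \<noteq> q"
  then obtain r where r: "\<not> near r p q" using not_near by auto
  have "disjnt {s \<in> bdry. near r p s} {s \<in> bdry. near r q s}"
    unfolding disjnt_iff
  proof (intro allI notI)
    fix s assume s: "s \<in> {s \<in> bdry. near r p s} \<and> s \<in> {s \<in> bdry. near r q s}"
    then have "near r s q" using pq near_sym[of q s r] by simp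
    then show False using r s pq near_trans[of p s q r] by simp
  qed
  then show "\<exists>U V. openin (boundary_top F B) U \<and> openin (boundary_top F B) V \<and> p \<in> U \<and> q \<in> V \<and> disjnt U V"
    using pq open_ball[of p r] open_ball[of q r] near_refl[of p r] near_refl[of q r] by (intro exI[of _ "{s \<in> bdry. near r p s}"] exI[of _ "{s \<in> bdry. near r q s}"]) auto
qed

lemma Hausdorff_double: "Hausdorff_space DB"
  unfolding double_boundary_top_def
  by (intro Hausdorff_space_subtopology) (simp add: Hausdorff_space_prod_topology Hausdorff_boundary)

lemma double_map_inverse:
  assumes "visual f" "visual g" "\<And>x. x \<in> carrier F \<Longrightarrow> g (f x) = x" "z \<in> topspace DB"
  shows "double_boundary_map F B g (double_boundary_map F B f z) = z"
  using assms ends_map_inverse[OF assms(1-3)] by (auto simp: double_boundary_map_def)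

lemma double_map_image:
  assumes f: "visual f" and g: "visual g" and gf: "\<And>x. x \<in> carrier F \<Longrightarrow> g (f x) = x"
    and fg: "\<And>x. x \<in> carrier F \<Longrightarrow> f (g x) = x" and S: "S \<subseteq> topspace DB"
  shows "double_boundary_map F B f ` S = double_boundary_map F B g -` S \<inter> topspace DB"
proof -
  have 1: "double_boundary_map F B f z \<in> topspace DB" if "z \<in> topspace DB" for z
    using continuous_map_funspace[OF double_map_continuous[OF f g gf]] that by blast
  have 2: "double_boundary_map F B g z \<in> topspace DB" if "z \<in> topspace DB" for z
    using continuous_map_funspace[OF double_map_continuous[OF g f fg]] that by blast
  show ?thesis
  proof (intro equalityI subsetI)
    fix z assume "z \<in> double_boundary_map F B f ` S"
    then obtain y where "y \<in> S" "z = double_boundary_map F B f y" by blast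
    then show "z \<in> double_boundary_map F B g -` S \<inter> topspace DB"
      using 1[of y] double_map_inverse[OF f g gf, of y] S by (auto simp del: topspace_double)
  next
    fix z assume "z \<in> double_boundary_map F B g -` S \<inter> topspace DB"
    then have z: "double_boundary_map F B g z \<in> S" "z \<in> topspace DB" by auto
    show "z \<in> double_boundary_map F B f ` S"
      using z(1) double_map_inverse[OF g f fg z(2)] by (metis imageI)
  qed
qed

context
  fixes a assumes a: "a \<in> B" and fin: "finite B"
begin

abbreviation conjs where "conjs \<equiv> conj_class F a"
abbreviation axis_ends where "axis_ends h \<equiv> (neg_end F B h, pos_end F B h)"
abbreviation flipped_axis_ends where "flipped_axis_ends h \<equiv> (pos_end F B h, neg_end F B h)"
abbreviation \<mu> where "\<mu> \<equiv> counting_current F B a"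

definition weight :: "('a bpoint \<times> 'a bpoint) set \<Rightarrow> ennreal" where
  "weight S = (\<integral>\<^sup>+ h. (indicator S (axis_ends h) + indicator S (flipped_axis_ends h)) \<partial>count_space conjs)"

lemma axis_in: "h \<in> conjs \<Longrightarrow> axis_ends h \<in> topspace DB" "h \<in> conjs \<Longrightarrow> flipped_axis_ends h \<in> topspace DB"
  using ends_in_bdry[OF a] by fastforce+

lemma space_counting_current [simp]: "space \<mu> = topspace DB"
  unfolding counting_current_def by (rule space_measure_of) (use borel_sets_subset in blast)

lemma sets_counting_current [simp]: "sets \<mu> = borel_sets DB"
  unfolding counting_current_def using sigma_algebra_borel_sets by (rule sigma_algebra.sets_measure_of_eq)

lemma emeasure_counting_current:
  assumes "S \<in> borel_sets DB" shows "emeasure \<mu> S = weight S"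
  unfolding counting_current_def weight_def
proof (rule emeasure_measure_of_sigma[OF sigma_algebra_borel_sets _ _ assms])
  let ?w = "\<lambda>S. \<integral>\<^sup>+ h. (indicator S (axis_ends h) + indicator S (flipped_axis_ends h)) \<partial>count_space conjs"
  show "positive (borel_sets DB) ?w" by (simp add: positive_def)
  show "countably_additive (borel_sets DB) ?w"
  proof (rule countably_additiveI)
    fix A :: "nat \<Rightarrow> ('a bpoint \<times> 'a bpoint) set" assume "disjoint_family A"
    then have "(\<Sum>i. indicator (A i) z) = (indicator (\<Union>i. A i) z :: ennreal)" for z
      by (rule suminf_indicator)
    then have "(\<Sum>i. indicator (A i) (axis_ends h) + indicator (A i) (flipped_axis_ends h))
        = (indicator (\<Union>i. A i) (axis_ends h) + indicator (\<Union>i. A i) (flipped_axis_ends h) :: ennreal)" for h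
      by (subst suminf_add[symmetric]) auto
    then show "(\<Sum>i. ?w (A i)) = ?w (\<Union>i. A i)"
      by (simp flip: nn_integral_suminf)
  qed
qed

lemma weight_cong:
  assumes "bij_betw \<sigma> conjs conjs"
    and "\<And>h. h \<in> conjs \<Longrightarrow> indicator S (axis_ends h) + indicator S (flipped_axis_ends h)
           = (indicator S' (axis_ends (\<sigma> h)) + indicator S' (flipped_axis_ends (\<sigma> h)) :: ennreal)"
  shows "weight S = weight S'"
proof -
  have "weight S = (\<integral>\<^sup>+ h. (indicator S' (axis_ends (\<sigma> h)) + indicator S' (flipped_axis_ends (\<sigma> h))) \<partial>count_space conjs)"
    unfolding weight_def by (rule nn_integral_cong) (use assms(2) in simp)
  also have "\<dots> = weight S'" unfolding weight_def by (rule nn_integral_bij_count_space[OF assms(1)])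
  finally show ?thesis .
qed

lemma weight_vimage:
  assumes "bij_betw \<sigma> conjs conjs"
    and "\<And>h. h \<in> conjs \<Longrightarrow> \<theta> (axis_ends h) = axis_ends (\<sigma> h)" "\<And>h. h \<in> conjs \<Longrightarrow> \<theta> (flipped_axis_ends h) = flipped_axis_ends (\<sigma> h)"
  shows "weight (\<theta> -` S \<inter> topspace DB) = weight S"
  by (rule weight_cong[OF assms(1)]) (use assms(2,3) axis_in in \<open>auto simp: indicator_def\<close>)

text \<open>If the boundary points \<open>p\<close> and \<open>q\<close> diverge before distance \<open>r\<close>, then so do the two ends of any
  geodesic with ends close to \<open>p\<close> and \<open>q\<close>, by ultrametricity.\<close>

lemma finite_axes_nbhd:
  assumes z: "z \<in> topspace DB"
  obtains U where "openin DB U" "z \<in> U" "finite {h \<in> conjs. axis_ends h \<in> U \<or> flipped_axis_ends h \<in> U}"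
proof -
  obtain p q where pq: "z = (p, q)" "p \<in> bdry" "q \<in> bdry" "p \<noteq> q" using z by auto
  obtain r where r: "\<not> near r p q" using not_near[OF pq(2-4)] by blast
  define U where "U = topspace DB \<inter> ({s \<in> bdry. near r p s} \<times> {s \<in> bdry. near r q s})"
  have "openin DB U"
    unfolding U_def double_boundary_top_def using open_ball pq
    by (auto simp: openin_subtopology openin_prod_Times_iff intro!: exI[of _ "{s \<in> bdry. near r p s} \<times> {s \<in> bdry. near r q s}"])
  moreover have "z \<in> U" using z pq near_refl by (auto simp: U_def)
  moreover have "{h \<in> conjs. axis_ends h \<in> U \<or> flipped_axis_ends h \<in> U} \<subseteq> {h \<in> conjs. \<not> near r (neg_end F B h) (pos_end F B h)}"
  proof
    fix h assume h: "h \<in> {h \<in> conjs. axis_ends h \<in> U \<or> flipped_axis_ends h \<in> U}"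
    then have e: "pos_end F B h \<in> bdry" "neg_end F B h \<in> bdry" using ends_in_bdry[OF a] by auto
    have "\<not> near r (neg_end F B h) (pos_end F B h)"
    proof
      assume n: "near r (neg_end F B h) (pos_end F B h)"
      consider "near r p (neg_end F B h)" "near r q (pos_end F B h)"
        | "near r p (pos_end F B h)" "near r q (neg_end F B h)" using h by (auto simp: U_def)
      then show False
      proof cases
        case 1
        have "near r p (pos_end F B h)" by (rule near_trans[OF _ e(2,1) 1(1) n]) (rule pq)
        from near_trans[OF pq(2) e(1) pq(3) this near_sym[OF pq(3) e(1) 1(2)]] show ?thesis using r by simp
      next
        case 2
        have "near r p (neg_end F B h)" by (rule near_trans[OF pq(2) e(1,2) 2(1) near_sym[OF e(2,1) n]])
        from near_trans[OF pq(2) e(2) pq(3) this near_sym[OF pq(3) e(2) 2(2)]] show ?thesis using r by simp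
      qed
    qed
    then show "h \<in> {h \<in> conjs. \<not> near r (neg_end F B h) (pos_end F B h)}" using h by simp
  qed
  ultimately show ?thesis using that finite_axes[OF a fin] finite_subset by blast
qed

lemma compact_finite_axes:
  assumes K: "compactin DB K"
  shows "finite {h \<in> conjs. axis_ends h \<in> K \<or> flipped_axis_ends h \<in> K}"
proof -
  let ?\<U> = "{U. openin DB U \<and> finite {h \<in> conjs. axis_ends h \<in> U \<or> flipped_axis_ends h \<in> U}}"
  have "K \<subseteq> \<Union>?\<U>"
  proof
    fix z assume "z \<in> K"
    then have "z \<in> topspace DB" using compactin_subset_topspace[OF K] by blast
    then obtain U where "openin DB U" "z \<in> U" "finite {h \<in> conjs. axis_ends h \<in> U \<or> flipped_axis_ends h \<in> U}"
      by (rule finite_axes_nbhd)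
    then show "z \<in> \<Union>?\<U>" by auto
  qed
  then obtain \<F> where F: "finite \<F>" "\<F> \<subseteq> ?\<U>" "K \<subseteq> \<Union>\<F>"
    using compactinD[OF K, of ?\<U>] by auto
  have "finite (\<Union>U\<in>\<F>. {h \<in> conjs. axis_ends h \<in> U \<or> flipped_axis_ends h \<in> U})" using F(1,2) by blast
  moreover have "{h \<in> conjs. axis_ends h \<in> K \<or> flipped_axis_ends h \<in> K} \<subseteq> (\<Union>U\<in>\<F>. {h \<in> conjs. axis_ends h \<in> U \<or> flipped_axis_ends h \<in> U})"
    using F(3) by blast
  ultimately show ?thesis by (rule rev_finite_subset)
qed

lemma counting_current_compact_finite:
  assumes K: "compactin DB K"
  shows "emeasure \<mu> K < \<infinity>"
proof (cases "K \<in> borel_sets DB")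
  case True
  let ?H = "{h \<in> conjs. axis_ends h \<in> K \<or> flipped_axis_ends h \<in> K}"
  have "weight K \<le> (\<integral>\<^sup>+ h. 2 * indicator ?H h \<partial>count_space conjs)"
    unfolding weight_def
  proof (rule nn_integral_mono)
    fix h assume "h \<in> space (count_space conjs)"
    then show "indicator K (axis_ends h) + indicator K (flipped_axis_ends h) \<le> (2 * indicator ?H h :: ennreal)"
      by (auto simp: indicator_def)
  qed
  also have "\<dots> = 2 * emeasure (count_space conjs) ?H"
    by (subst nn_integral_cmult_indicator) auto
  also have "\<dots> = 2 * of_nat (card ?H)"
    using compact_finite_axes[OF K] by (subst emeasure_count_space_finite) auto
  also have "\<dots> < \<infinity>" using of_nat_less_top[of "card ?H"] by (simp add: ennreal_mult_less_top)
  finally show ?thesis using emeasure_counting_current[OF True] by simp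
next
  case False
  then show ?thesis by (simp add: emeasure_notin_sets)
qed

text \<open>The current is carried by countably many atoms. They are exhausted by the finite, hence compact,
  sets of atoms whose axes come within distance \<open>n\<close> of the identity.\<close>

lemma counting_current_inner_regular:
  assumes S: "S \<in> borel_sets DB"
  shows "emeasure \<mu> S = (SUP K \<in> {K. compactin DB K \<and> K \<subseteq> S}. emeasure \<mu> K)"
proof (rule antisym)
  show "(SUP K \<in> {K. compactin DB K \<and> K \<subseteq> S}. emeasure \<mu> K) \<le> emeasure \<mu> S"
    using S by (intro SUP_least emeasure_mono) auto
  \<comment> \<open>the axes that come within distance \<open>n\<close> of the identity\<close>
  define Y where "Y n = {h \<in> conjs. \<not> near (real n) (neg_end F B h) (pos_end F B h)}" for n :: nat
  define A where "A n = S \<inter> (axis_ends ` Y n \<union> flipped_axis_ends ` Y n)" for n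
  have Y: "finite (Y n)" for n using finite_axes[OF a fin] by (simp add: Y_def)
  have finA: "finite (A n)" for n using Y by (simp add: A_def)
  have ASD: "A n \<subseteq> S" "S \<subseteq> topspace DB" for n using borel_sets_subset[OF S] by (auto simp: A_def)
  have meas: "A n \<in> borel_sets DB" for n
    using Hausdorff_double finA ASD by (intro borel_sets_closed closedin_Hausdorff_finite) auto
  have inc: "incseq A"
  proof (rule incseq_SucI)
    fix n
    have "Y n \<subseteq> Y (Suc n)" unfolding Y_def using near_mono by force
    then show "A n \<subseteq> A (Suc n)" by (auto simp: A_def)
  qed
  have ex: "\<exists>n. h \<in> Y n" if h: "h \<in> conjs" for h
  proof -
    obtain r where "\<not> near r (neg_end F B h) (pos_end F B h)"
      using not_near[OF ends_in_bdry(2,1,3)[OF a h]] by blast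
    moreover obtain n :: nat where "r \<le> real n" using real_arch_simple by blast
    ultimately have "\<not> near (real n) (neg_end F B h) (pos_end F B h)" using near_mono by blast
    then show ?thesis using h by (auto simp: Y_def)
  qed
  have "emeasure \<mu> S = weight S" by (rule emeasure_counting_current[OF S])
  also have "\<dots> = weight (\<Union>n. A n)"
    by (rule weight_cong[of id]) (use ex in \<open>auto simp: A_def indicator_def\<close>)
  also have "\<dots> = emeasure \<mu> (\<Union>n. A n)"
    using meas sigma_algebra_borel_sets[of DB] emeasure_counting_current sets.countable_UN[of A UNIV \<mu>] by (simp add: image_subset_iff)
  also have "\<dots> = (SUP n. emeasure \<mu> (A n))"
    using meas inc by (intro SUP_emeasure_incseq[symmetric]) auto
  also have "\<dots> \<le> (SUP K \<in> {K. compactin DB K \<and> K \<subseteq> S}. emeasure \<mu> K)"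
  proof (rule SUP_least)
    fix n
    have "compactin DB (A n)" using finA ASD by (intro finite_imp_compactin) auto
    then show "emeasure \<mu> (A n) \<le> (SUP K \<in> {K. compactin DB K \<and> K \<subseteq> S}. emeasure \<mu> K)"
      using ASD by (intro SUP_upper) auto
  qed
  finally show "emeasure \<mu> S \<le> (SUP K \<in> {K. compactin DB K \<and> K \<subseteq> S}. emeasure \<mu> K)" .
qed

lemma conjs_conj: "h \<in> conjs \<Longrightarrow> u \<in> carrier F \<Longrightarrow> u \<otimes> h \<otimes> inv u \<in> conjs"
  by (rule translate_ends(1)[OF a])

lemma conjs_closed: "h \<in> conjs \<Longrightarrow> h \<in> carrier F"
  using conj_class_closed[of a h] a by simp

lemma counting_current_translation_invariant:
  assumes u: "u \<in> carrier F" and S: "S \<in> borel_sets DB"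
  shows "emeasure \<mu> (double_boundary_map F B (\<lambda>x. u \<otimes> x) ` S) = emeasure \<mu> S"
proof -
  note c = visual_translation[OF u] visual_translation[OF inv_closed[OF u]]
  have i: "\<And>x. x \<in> carrier F \<Longrightarrow> inv u \<otimes> (u \<otimes> x) = x" "\<And>x. x \<in> carrier F \<Longrightarrow> u \<otimes> (inv u \<otimes> x) = x"
    using u by (simp_all flip: m_assoc)
  have im: "double_boundary_map F B (\<lambda>x. u \<otimes> x) ` S = double_boundary_map F B (\<lambda>x. inv u \<otimes> x) -` S \<inter> topspace DB"
    by (rule double_map_image[OF c i borel_sets_subset[OF S]])
  have "double_boundary_map F B (\<lambda>x. inv u \<otimes> x) -` S \<inter> topspace DB \<in> borel_sets DB"
    by (rule continuous_map_borel_vimage[OF double_map_continuous[OF c(2,1) i(2)] S])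
  moreover have "weight (double_boundary_map F B (\<lambda>x. inv u \<otimes> x) -` S \<inter> topspace DB) = weight S"
  proof (rule weight_vimage)
    show "bij_betw (\<lambda>h. inv u \<otimes> h \<otimes> inv (inv u)) conjs conjs"
    proof (rule bij_betwI[where g = "\<lambda>h. u \<otimes> h \<otimes> inv u"])
      show "(\<lambda>h. inv u \<otimes> h \<otimes> inv (inv u)) \<in> conjs \<rightarrow> conjs" "(\<lambda>h. u \<otimes> h \<otimes> inv u) \<in> conjs \<rightarrow> conjs"
        using conjs_conj[OF _ u] conjs_conj[OF _ inv_closed[OF u]] by auto
      show "u \<otimes> (inv u \<otimes> h \<otimes> inv (inv u)) \<otimes> inv u = h" if "h \<in> conjs" for h
        using conjs_closed[OF that] u i by (simp add: m_assoc)
      show "inv u \<otimes> (u \<otimes> h \<otimes> inv u) \<otimes> inv (inv u) = h" if "h \<in> conjs" for h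
        using conjs_closed[OF that] u i by (simp add: m_assoc)
    qed
    show "double_boundary_map F B (\<lambda>x. inv u \<otimes> x) (axis_ends h) = axis_ends (inv u \<otimes> h \<otimes> inv (inv u))"
      "double_boundary_map F B (\<lambda>x. inv u \<otimes> x) (flipped_axis_ends h) = flipped_axis_ends (inv u \<otimes> h \<otimes> inv (inv u))" if "h \<in> conjs" for h
      unfolding double_boundary_map_def using translate_ends(2,3)[OF a that inv_closed[OF u]] by simp_all
  qed
  ultimately show ?thesis using im S by (simp add: emeasure_counting_current)
qed

lemma counting_current_flip_invariant:
  assumes S: "S \<in> borel_sets DB"
  shows "emeasure \<mu> (prod.swap ` S) = emeasure \<mu> S"
proof -
  have "continuous_map (prod_topology (boundary_top F B) (boundary_top F B))
      (prod_topology (boundary_top F B) (boundary_top F B)) prod.swap"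
    by (simp add: prod.swap_def continuous_map_pairwise o_def continuous_map_fst continuous_map_snd)
  then have "continuous_map DB DB prod.swap"
    unfolding double_boundary_top_def
    by (intro continuous_map_into_subtopology continuous_map_from_subtopology) auto
  from continuous_map_borel_vimage[OF this S]
  have "prod.swap -` S \<inter> topspace DB \<in> borel_sets DB" .
  moreover have "prod.swap ` S = prod.swap -` S \<inter> topspace DB"
    using borel_sets_subset[OF S] by (force simp: image_iff)
  moreover have "weight (prod.swap -` S \<inter> topspace DB) = weight S"
    by (rule weight_cong[of id]) (use axis_in in \<open>auto simp: indicator_def\<close>)
  ultimately show ?thesis using S by (simp add: emeasure_counting_current)
qed

lemma counting_current_in_currents: "\<mu> \<in> currents F B"
  unfolding currents_def radon_measure_def
  using counting_current_compact_finite counting_current_inner_regular counting_current_translation_invariant counting_current_flip_invariant by simp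

lemma counting_current_nonzero: "nonzero_measure \<mu>"
proof -
  have "a \<in> conjs" using a unfolding conj_class_def by (force intro: exI[of _ \<one>])
  have top: "topspace DB \<in> borel_sets DB" by (rule borel_sets_open[OF openin_topspace])
  have "weight (topspace DB) \<noteq> 0"
  proof
    assume "weight (topspace DB) = 0"
    then have "AE h in count_space conjs. indicator (topspace DB) (axis_ends h) + indicator (topspace DB) (flipped_axis_ends h) = (0 :: ennreal)"
      unfolding weight_def by (subst (asm) nn_integral_0_iff_AE) auto
    then have "indicator (topspace DB) (axis_ends a) = (0 :: ennreal)" using \<open>a \<in> conjs\<close> by (simp add: AE_count_space)
    then show False using axis_in(1)[OF \<open>a \<in> conjs\<close>] by (simp add: indicator_def)
  qed
  then show ?thesis using top by (simp add: nonzero_measure_def emeasure_counting_current)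
qed

text \<open>An automorphism that sends \<open>a\<close> to a conjugate of \<open>a\<close> permutes the conjugates of \<open>a\<close>, and thereby
  the atoms.\<close>

lemma counting_current_automorphism_invariant:
  assumes \<phi>: "\<phi> \<in> auto F" "\<phi> a \<in> conjs"
  shows "aut_current F B \<phi> (scale_measure c \<mu>) = scale_measure c \<mu>"
proof -
  define \<psi> where "\<psi> = restrict (inv_into (carrier F) \<phi>) (carrier F)"
  have hom: "\<phi> \<in> hom F F" and Bij: "\<phi> \<in> Bij (carrier F)" using \<phi>(1) by (auto simp: auto_def)
  have bij: "bij_betw \<phi> (carrier F) (carrier F)" using Bij by (simp add: Bij_def)
  have psi: "\<psi> \<in> hom F F" unfolding \<psi>_def by (rule restrict_inv_into_hom[OF hom Bij])
  have inv: "\<And>x. x \<in> carrier F \<Longrightarrow> \<psi> (\<phi> x) = x" "\<And>x. x \<in> carrier F \<Longrightarrow> \<phi> (\<psi> x) = x"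
    using bij by (auto simp: \<psi>_def bij_betw_def inv_into_f_f f_inv_into_f)
  note visual = visual_automorphism[OF fin hom psi inv(1)] visual_automorphism[OF fin psi hom inv(2)]
  have gh: "group_hom F F \<phi>" "group_hom F F \<psi>" using hom psi is_group by (simp_all add: group_hom_def group_hom_axioms_def)
  have cl: "\<phi> x \<in> carrier F" "\<psi> x \<in> carrier F" if "x \<in> carrier F" for x using hom psi that by (auto simp: hom_def)
  have aF: "a \<in> carrier F" using a by simp
  have conj: "f h \<in> conjs" if hf: "h \<in> conjs" "f a \<in> conjs" "group_hom F F f" "\<And>x. x \<in> carrier F \<Longrightarrow> f x \<in> carrier F" for f h
  proof -
    obtain u where u: "u \<in> carrier F" "h = u \<otimes> a \<otimes> inv u" using hf(1) by (auto simp: conj_class_def)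
    have "f h = f u \<otimes> f a \<otimes> inv (f u)"
      using u aF hf(4) group_hom.hom_inv[OF hf(3)] hom_mult[OF group_hom.homh[OF hf(3)]] by simp
    then show ?thesis using conjs_conj[OF hf(2)] hf(4)[OF u(1)] by simp
  qed
  have psia: "\<psi> a \<in> conjs"
  proof -
    obtain v where v: "v \<in> carrier F" "\<phi> a = v \<otimes> a \<otimes> inv v" using \<phi>(2) by (auto simp: conj_class_def)
    then have "a = \<psi> v \<otimes> \<psi> a \<otimes> inv (\<psi> v)"
      using inv(1)[OF aF] aF gh(2) psi by (metis group_hom.hom_inv hom_mult inv_closed m_closed)
    then have "\<psi> a = inv (\<psi> v) \<otimes> a \<otimes> inv (inv (\<psi> v))"
      using cl v(1) aF by (metis inv_closed inv_inv inv_solve_left inv_solve_right m_assoc m_closed)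
    moreover have "a \<in> conjs" using a unfolding conj_class_def by (force intro: exI[of _ \<one>])
    ultimately show ?thesis using conjs_conj[of a "inv (\<psi> v)"] cl v(1) by simp
  qed
  have bijC: "bij_betw \<phi> conjs conjs"
    by (rule bij_betwI[where g = \<psi>]) (use conj gh cl psia \<phi>(2) inv conjs_closed in auto)
  have cont: "continuous_map DB DB (double_boundary_map F B \<phi>)"
    by (rule double_map_continuous[OF visual inv(1)])
  have w: "weight (double_boundary_map F B \<phi> -` S \<inter> topspace DB) = weight S" for S
    by (rule weight_vimage[OF bijC])
      (use automorphism_ends[OF a _ hom visual(1)] in \<open>auto simp: double_boundary_map_def\<close>)
  have meas: "double_boundary_map F B \<phi> \<in> measurable (scale_measure c \<mu>) (borel_space DB)"
    using continuous_map_borel_vimage[OF cont] continuous_map_funspace[OF cont]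
    by (intro measurableI) (auto simp: space_scale_measure simp del: topspace_double)
  show ?thesis
    unfolding aut_current_def
  proof (rule measure_eqI)
    show "sets (distr (scale_measure c \<mu>) (borel_space DB) (double_boundary_map F B \<phi>)) = sets (scale_measure c \<mu>)"
      by simp
    fix S assume "S \<in> sets (distr (scale_measure c \<mu>) (borel_space DB) (double_boundary_map F B \<phi>))"
    then have S: "S \<in> borel_sets DB" by simp
    then show "emeasure (distr (scale_measure c \<mu>) (borel_space DB) (double_boundary_map F B \<phi>)) S
        = emeasure (scale_measure c \<mu>) S"
      using meas w[of S] continuous_map_borel_vimage[OF cont S]
      by (simp add: emeasure_distr emeasure_counting_current space_scale_measure)
  qed
qed

definition rational_class :: "'a current set" where "rational_class = proj_measure \<mu>"

lemma rational_class_eq: "rational_class = proj_measure (rational_current F B a)"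
  using basis_not_proper_power[OF a] by (simp add: rational_class_def rational_current_def)

lemma rational_class_in_PCurr: "rational_class \<in> topspace (PCurr F B)"
proof -
  have "\<mu> \<in> topspace (Curr F B)"
    unfolding Curr_def topspace_pullback_topology using counting_current_in_currents by auto
  then show ?thesis using counting_current_nonzero by (auto simp: PCurr_def rational_class_def)
qed

lemma rational_class_in_M: "rational_class \<in> M_PCurr F B"
proof -
  have "primitive_elt F a" using a basis by (auto simp: primitive_elt_def)
  then have "rational_class \<in> {proj_measure (rational_current F B g) | g. primitive_elt F g}"
    by (auto simp: rational_class_eq)
  then show ?thesis
    unfolding M_PCurr_def
    by (intro subsetD[OF closure_of_subset_Int] IntI rational_class_in_PCurr)
qed

lemma rational_class_fixed:
  assumes "\<Phi> \<noteq> {}" "\<And>\<phi>. \<phi> \<in> \<Phi> \<Longrightarrow> \<phi> \<in> auto F \<and> \<phi> a \<in> conjs"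
  shows "out_PCurr F B \<Phi> rational_class = rational_class"
proof -
  have "aut_current F B \<phi> ` rational_class = rational_class" if "\<phi> \<in> \<Phi>" for \<phi>
    using counting_current_automorphism_invariant assms(2)[OF that]
    unfolding rational_class_def proj_measure_def by (force simp: image_iff)
  then show ?thesis using assms(1) by (simp add: out_PCurr_def class_action_def)
qed

end

end

section \<open>Length functions in the closure of outer space\<close>

definition nonzero_functions :: "('a, 'b) monoid_scheme \<Rightarrow> ('a \<Rightarrow> real) topology" where
  "nonzero_functions F = subtopology (product_topology (\<lambda>_. euclideanreal) (carrier F)) (- {\<lambda>w \<in> carrier F. 0})"

lemma PR_alt: "PR F = quotient_topology (nonzero_functions F) (proj_function F)"
  by (simp add: PR_def nonzero_functions_def)

lemma topspace_nonzero_functions: "topspace (nonzero_functions F) = extensional (carrier F) - {\<lambda>w \<in> carrier F. 0}"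
  by (auto simp: nonzero_functions_def PiE_UNIV_domain PiE_def)

lemma proj_function_self: "f \<in> extensional (carrier F) \<Longrightarrow> f \<in> proj_function F f"
  unfolding proj_function_def by (auto intro!: exI[of _ 1] simp: extensional_restrict fun_eq_iff extensional_def)

text \<open>The scale-invariant closed condition \<open>R\<close> defines a saturated closed set of non-zero functions,
  whose image in the quotient is closed and contains outer space.\<close>

lemma closed_condition_on_closure:
  assumes closed: "closedin (nonzero_functions F) {f \<in> topspace (nonzero_functions F). R f}"
    and scale: "\<And>f c. c \<noteq> 0 \<Longrightarrow> R f \<Longrightarrow> R (\<lambda>w \<in> carrier F. c * f w)"
    and cv: "\<And>l. l \<in> cv F \<Longrightarrow> R l"
    and f: "f \<in> topspace (nonzero_functions F)" "proj_function F f \<in> PR F closure_of CV F"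
  shows "R f"
proof -
  define Y where "Y = topspace (nonzero_functions F)"
  define P where "P = {Z \<in> topspace (PR F). \<forall>f\<in>Y. proj_function F f = Z \<longrightarrow> R f}"
  have inv: "R g" if "R h" "proj_function F g = proj_function F h" "g \<in> Y" for g h
  proof -
    have "g \<in> proj_function F h" using that(2,3) proj_function_self[of g F] by (auto simp: Y_def topspace_nonzero_functions)
    then show ?thesis using scale that(1) by (auto simp: proj_function_def)
  qed
  have top: "topspace (PR F) = proj_function F ` Y" by (simp add: PR_alt Y_def)
  have "openin (PR F) (topspace (PR F) - P)"
    unfolding PR_alt openin_quotient_topology
  proof
    show "topspace (quotient_topology (nonzero_functions F) (proj_function F)) - P \<subseteq> proj_function F ` topspace (nonzero_functions F)"
      by auto
    have "{x \<in> topspace (nonzero_functions F). proj_function F x \<in> topspace (quotient_topology (nonzero_functions F) (proj_function F)) - P}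
        = topspace (nonzero_functions F) - {f \<in> topspace (nonzero_functions F). R f}"
      using inv by (auto simp: P_def PR_alt Y_def)
    then show "openin (nonzero_functions F) {x \<in> topspace (nonzero_functions F).
        proj_function F x \<in> topspace (quotient_topology (nonzero_functions F) (proj_function F)) - P}"
      using closed by (simp add: closedin_def)
  qed
  then have "closedin (PR F) P" by (auto simp: closedin_def P_def)
  moreover have "topspace (PR F) \<inter> CV F \<subseteq> P"
    using inv cv by (auto simp: P_def CV_def)
  ultimately have "PR F closure_of CV F \<subseteq> P"
    using closure_of_minimal[of "topspace (PR F) \<inter> CV F" P "PR F"] closure_of_restrict[of "PR F" "CV F"] by simp
  then show ?thesis using f by (auto simp: P_def Y_def)
qed

lemma closedin_le:
  assumes "continuous_map X euclideanreal f" "continuous_map X euclideanreal g"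
  shows "closedin X {x \<in> topspace X. f x \<le> g x}"
proof -
  have "closedin X {x \<in> topspace X. (\<lambda>x. g x - f x) x \<in> {0..}}"
    by (rule closedin_continuous_map_preimage[of _ euclideanreal]) (use assms in \<open>auto intro: continuous_map_diff\<close>)
  then show ?thesis by simp
qed

lemma continuous_evaluation:
  assumes "w \<in> carrier F" shows "continuous_map (nonzero_functions F) euclideanreal (\<lambda>f. f w)"
  unfolding nonzero_functions_def using assms
  by (intro continuous_map_from_subtopology) (auto intro: continuous_map_product_projection)

lemma cv_tree_action:
  assumes "group F" "l \<in> cv F"
  obtains T :: "real set" and d \<rho> where "tree_action F T d \<rho>" "free_action F T \<rho>" "l = translation_length F T d \<rho>"
  using assms unfolding cv_def tree_action_def tree_action_axioms_def by blast

context free_group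
begin

text \<open>A sum rather than a maximum, to have continuity in \<open>l\<close> at hand. The minimum expresses that only
  one of the two products of a pair has to be controlled.\<close>

definition pair_bound :: "('a \<Rightarrow> real) \<Rightarrow> real" where
  "pair_bound l = (\<Sum>x\<in>B. \<bar>l x\<bar>) + (\<Sum>(x, y) \<in> {(x, y). x \<in> B \<and> y \<in> B \<and> x \<noteq> y}. min \<bar>l (x \<otimes> y)\<bar> \<bar>l (y \<otimes> x)\<bar>)"

lemma closure_product_max:
  assumes f: "f \<in> topspace (nonzero_functions F)" "proj_function F f \<in> PR F closure_of CV F"
    and gh: "g \<in> carrier F" "h \<in> carrier F"
  shows "\<bar>f g\<bar> + \<bar>f h\<bar> \<le> max \<bar>f (g \<otimes> h)\<bar> \<bar>f (g \<otimes> inv h)\<bar>"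
proof (rule closed_condition_on_closure[OF _ _ _ f, where R = "\<lambda>f. \<bar>f g\<bar> + \<bar>f h\<bar> \<le> max \<bar>f (g \<otimes> h)\<bar> \<bar>f (g \<otimes> inv h)\<bar>"])
  show "closedin (nonzero_functions F) {f \<in> topspace (nonzero_functions F). \<bar>f g\<bar> + \<bar>f h\<bar> \<le> max \<bar>f (g \<otimes> h)\<bar> \<bar>f (g \<otimes> inv h)\<bar>}"
    using gh by (intro closedin_le continuous_map_add continuous_map_real_max continuous_map_real_abs continuous_evaluation) auto
next
  fix f :: "'a \<Rightarrow> real" and c :: real assume "\<bar>f g\<bar> + \<bar>f h\<bar> \<le> max \<bar>f (g \<otimes> h)\<bar> \<bar>f (g \<otimes> inv h)\<bar>"
  from mult_left_mono[OF this abs_ge_zero[of c]]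
  show "\<bar>(\<lambda>w\<in>carrier F. c * f w) g\<bar> + \<bar>(\<lambda>w\<in>carrier F. c * f w) h\<bar>
      \<le> max \<bar>(\<lambda>w\<in>carrier F. c * f w) (g \<otimes> h)\<bar> \<bar>(\<lambda>w\<in>carrier F. c * f w) (g \<otimes> inv h)\<bar>"
    using gh by (simp add: abs_mult distrib_left max_mult_distrib_left)
next
  fix l assume "l \<in> cv F"
  then obtain T :: "real set" and d \<rho> where t: "tree_action F T d \<rho>" "free_action F T \<rho>" "l = translation_length F T d \<rho>"
    using cv_tree_action[OF is_group] by blast
  interpret tree_action F T d \<rho> by (rule t(1))
  have "l = tlen" by (simp add: tlen_def t(3))
  then show "\<bar>l g\<bar> + \<bar>l h\<bar> \<le> max \<bar>l (g \<otimes> h)\<bar> \<bar>l (g \<otimes> inv h)\<bar>"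
    using tlen_product_max_if_free[OF t(2) gh] tlen_nonneg gh by simp
qed

lemma closure_word_bound:
  assumes fin: "finite B"
    and f: "f \<in> topspace (nonzero_functions F)" "proj_function F f \<in> PR F closure_of CV F"
    and w: "w \<in> words B"
  shows "\<bar>f (eval_word F w)\<bar> \<le> 4 * length w * pair_bound f"
proof (rule closed_condition_on_closure[OF _ _ _ f, where R = "\<lambda>f. \<bar>f (eval_word F w)\<bar> \<le> 4 * length w * pair_bound f"])
  have finp: "finite {(x, y). x \<in> B \<and> y \<in> B \<and> x \<noteq> y}"
    by (rule finite_subset[of _ "B \<times> B"]) (use fin in auto)
  show "closedin (nonzero_functions F) {f \<in> topspace (nonzero_functions F). \<bar>f (eval_word F w)\<bar> \<le> 4 * length w * pair_bound f}"
    unfolding pair_bound_def using w fin finp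
    by (intro closedin_le continuous_map_real_abs continuous_evaluation continuous_map_real_mult_left
        continuous_map_add continuous_map_sum)
      (auto intro!: continuous_map_real_abs continuous_map_real_min continuous_evaluation simp: case_prod_unfold)
  fix f :: "'a \<Rightarrow> real" and c :: real assume *: "\<bar>f (eval_word F w)\<bar> \<le> 4 * length w * pair_bound f"
  have "pair_bound (\<lambda>w\<in>carrier F. c * f w) = \<bar>c\<bar> * pair_bound f"
    unfolding pair_bound_def distrib_left sum_distrib_left
    by (intro arg_cong2[where f = "(+)"] sum.cong) (auto simp: abs_mult min_mult_distrib_left)
  then show "\<bar>(\<lambda>w\<in>carrier F. c * f w) (eval_word F w)\<bar> \<le> 4 * length w * pair_bound (\<lambda>w\<in>carrier F. c * f w)"
    using mult_left_mono[OF * abs_ge_zero[of c]] w by (simp add: abs_mult mult.left_commute)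
next
  have finp: "finite {(x, y). x \<in> B \<and> y \<in> B \<and> x \<noteq> y}"
    by (rule finite_subset[of _ "B \<times> B"]) (use fin in auto)
  fix l assume "l \<in> cv F"
  then obtain T :: "real set" and d \<rho> where t: "tree_action F T d \<rho>" "free_action F T \<rho>" "l = translation_length F T d \<rho>"
    using cv_tree_action[OF is_group] by blast
  interpret tree_action F T d \<rho> by (rule t(1))
  have l: "l = tlen" by (simp add: tlen_def t(3))
  have sums: "0 \<le> (\<Sum>x\<in>B. \<bar>l x\<bar>)"
     "0 \<le> (\<Sum>(x, y) \<in> {(x, y). x \<in> B \<and> y \<in> B \<and> x \<noteq> y}. min \<bar>l (x \<otimes> y)\<bar> \<bar>l (y \<otimes> x)\<bar>)"
    by (auto intro!: sum_nonneg)
  have "tlen (eval_word F w) \<le> 4 * length w * pair_bound l"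
  proof (rule tlen_word_bound[OF fin B_carrier _ _ _ w])
    show "0 \<le> pair_bound l" using sums by (simp add: pair_bound_def)
    show "tlen x \<le> pair_bound l" if "x \<in> B" for x
    proof -
      have "\<bar>l x\<bar> \<le> (\<Sum>x\<in>B. \<bar>l x\<bar>)" by (rule member_le_sum) (use that fin in auto)
      then show ?thesis using sums l by (simp add: pair_bound_def)
    qed
    show "tlen (x \<otimes> y) \<le> pair_bound l \<or> tlen (y \<otimes> x) \<le> pair_bound l" if "x \<in> B" "y \<in> B" "x \<noteq> y" for x y
    proof -
      have "(case (x, y) of (x, y) \<Rightarrow> min \<bar>l (x \<otimes> y)\<bar> \<bar>l (y \<otimes> x)\<bar>)
          \<le> (\<Sum>(x, y) \<in> {(x, y). x \<in> B \<and> y \<in> B \<and> x \<noteq> y}. min \<bar>l (x \<otimes> y)\<bar> \<bar>l (y \<otimes> x)\<bar>)"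
        by (rule member_le_sum) (use that finp in auto)
      then have "min \<bar>l (x \<otimes> y)\<bar> \<bar>l (y \<otimes> x)\<bar> \<le> pair_bound l"
        using sums(1) unfolding pair_bound_def case_prod_conv by linarith
      then show ?thesis unfolding l by linarith
    qed
  qed
  then show "\<bar>l (eval_word F w)\<bar> \<le> 4 * length w * pair_bound l" using l w tlen_nonneg by simp
qed

text \<open>The transvections that fix \<open>a\<close> make \<open>f\<close> vanish on the basis, because of the product
  inequality, then on products of two basis elements in one of the orders, and finally, by the bound for words,
  everywhere.\<close>

lemma no_invariant_function:
  assumes fin: "finite B" and card: "card B \<ge> 3" and a: "a \<in> B"
    and f: "f \<in> topspace (nonzero_functions F)" "proj_function F f \<in> PR F closure_of CV F"
    and fixed: "\<And>\<phi>. \<phi> \<in> auto F \<Longrightarrow> \<phi> a = a \<Longrightarrow> \<exists>c. \<forall>w\<in>carrier F. f (\<phi> w) = c * f w"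
  shows False
proof -
  have basis0: "f y = 0" if y: "y \<in> B" for y
  proof (rule ccontr)
    assume ne: "f y \<noteq> 0"
    have "card {a, y} \<le> 2" by (simp add: card_insert_if)
    then have "\<not> B \<subseteq> {a, y}" using card card_mono[of "{a, y}" B] by force
    then obtain b where b: "b \<in> B" "b \<noteq> a" "b \<noteq> y" by blast
    let ?\<phi> = "transvection b y"
    have auto: "?\<phi> \<in> auto F" using transvection_auto b y by auto
    have tb: "?\<phi> x = (if x = b then b \<otimes> y else x)" if "x \<in> B" for x
      using transvection_basis[of b y x] b y that by simp
    obtain c where c: "\<forall>w\<in>carrier F. f (?\<phi> w) = c * f w"
      using fixed[OF auto] tb[OF a] b by auto
    \<comment> \<open>the transvection fixes \<open>y\<close>, so its factor is \<open>1\<close>\<close>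
    have "f y = c * f y" using c tb[OF y] b(3) y by (metis B_closed)
    then have c1: "c = 1" using ne by simp
    have "f (b \<otimes> y) = f b" using c tb[OF b(1)] b(1) c1 by (metis B_closed mult_1)
    moreover have "f (b \<otimes> inv y) = f b"
    proof -
      have hom: "?\<phi> \<in> hom F F" using auto by (simp add: auto_def)
      have "group_hom F F ?\<phi>" using hom is_group by (simp add: group_hom_def group_hom_axioms_def)
      then have "?\<phi> (inv y) = inv y" using group_hom.hom_inv[of F F ?\<phi> y] b y tb[OF y] by simp
      then have "?\<phi> (b \<otimes> inv y) = b"
        using hom_mult[OF hom, of b "inv y"] b y tb[OF b(1)] by (simp add: m_assoc)
      moreover have "b \<otimes> inv y \<in> carrier F" using b y by simp
      ultimately show ?thesis using c c1 by (metis mult_1)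
    qed
    ultimately show False using closure_product_max[OF f, of b y] b y ne by simp
  qed
  have pairs0: "f (x \<otimes> y) = 0 \<or> f (y \<otimes> x) = 0" if xy: "x \<in> B" "y \<in> B" "x \<noteq> y" for x y
  proof -
    have "f (x \<otimes> y) = 0" if xy: "x \<in> B" "y \<in> B" "x \<noteq> y" "x \<noteq> a" for x y
    proof -
      have "transvection x y a = a" "transvection x y x = x \<otimes> y"
        using transvection_basis[of x y] xy a by auto
      moreover obtain c where "\<forall>w\<in>carrier F. f (transvection x y w) = c * f w"
        using fixed[of "transvection x y"] transvection_auto[of x y] xy calculation by auto
      ultimately show ?thesis using basis0[OF xy(1)] xy by (metis B_closed mult_zero_right)
    qed
    then show ?thesis using xy by metis
  qed
  have "pair_bound f = 0"
  proof -
    have "min \<bar>f (x \<otimes> y)\<bar> \<bar>f (y \<otimes> x)\<bar> = 0" if "x \<in> B" "y \<in> B" "x \<noteq> y" for x y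
      using pairs0[OF that] by auto
    then show ?thesis unfolding pair_bound_def using basis0 by (auto intro!: sum.neutral)
  qed
  then have "f g = 0" if "g \<in> carrier F" for g
    using closure_word_bound[OF fin f nf_props(1)[OF that]] nf_props(3)[OF that] by simp
  then have "f = (\<lambda>w\<in>carrier F. 0)" using f(1) by (auto simp: topspace_nonzero_functions extensional_def)
  then show False using f(1) by (simp add: topspace_nonzero_functions)
qed

end

section \<open>Outer automorphisms\<close>

context group
begin

definition conj_by where "conj_by h = (\<lambda>x \<in> carrier G. h \<otimes> x \<otimes> inv h)"

lemma inner_auts_alt: "inner_auts G = conj_by ` carrier G"
  by (auto simp: inner_auts_def conj_by_def)

lemma conj_by_compose:
  "h \<in> carrier G \<Longrightarrow> k \<in> carrier G \<Longrightarrow> compose (carrier G) (conj_by h) (conj_by k) = conj_by (h \<otimes> k)"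
  by (auto simp: compose_def conj_by_def fun_eq_iff inv_mult_group m_assoc)

lemma conj_by_one: "conj_by \<one> = (\<lambda>x \<in> carrier G. x)"
  by (auto simp: conj_by_def fun_eq_iff)

lemma conj_by_auto: assumes h: "h \<in> carrier G" shows "conj_by h \<in> auto G"
proof -
  have cancel: "inv h \<otimes> (h \<otimes> x) = x" "h \<otimes> (inv h \<otimes> x) = x" if "x \<in> carrier G" for x
    using h that by (simp_all flip: m_assoc)
  have "bij_betw (conj_by h) (carrier G) (carrier G)"
    by (rule bij_betwI[where g = "conj_by (inv h)"])
      (use h cancel in \<open>auto simp: conj_by_def m_assoc\<close>)
  moreover have "conj_by h \<in> hom G G"
    using h cancel by (auto simp: hom_def conj_by_def m_assoc)
  ultimately show ?thesis by (auto simp: auto_def Bij_def conj_by_def)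
qed

lemma AutoGroup_simps [simp]:
  "carrier (AutoGroup G) = auto G" "\<one>\<^bsub>AutoGroup G\<^esub> = (\<lambda>x \<in> carrier G. x)"
  by (simp_all add: AutoGroup_def BijGroup_def)

lemma AutoGroup_mult: "\<phi> \<in> auto G \<Longrightarrow> \<psi> \<in> auto G \<Longrightarrow> \<phi> \<otimes>\<^bsub>AutoGroup G\<^esub> \<psi> = compose (carrier G) \<phi> \<psi>"
  by (simp add: AutoGroup_def BijGroup_def auto_def)

lemma AutoGroup_inv:
  assumes "\<phi> \<in> auto G"
  shows "inv\<^bsub>AutoGroup G\<^esub> \<phi> = (\<lambda>x \<in> carrier G. inv_into (carrier G) \<phi> x)"
  using assms group.m_inv_consistent[OF group_BijGroup subgroup_auto] inv_BijGroup
  by (auto simp: AutoGroup_def auto_def)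

lemma inner_auts_normal: "inner_auts G \<lhd> AutoGroup G"
proof -
  interpret A: group "AutoGroup G" by (rule AutoGroup)
  have inv: "inv\<^bsub>AutoGroup G\<^esub> (conj_by h) = conj_by (inv h)" if "h \<in> carrier G" for h
    using that conj_by_auto conj_by_compose[of "inv h" h]
    by (intro A.inv_equality) (auto simp: AutoGroup_mult conj_by_one)
  show ?thesis
  proof (rule A.normal_invI)
    show "subgroup (inner_auts G) (AutoGroup G)"
    proof (rule A.subgroupI)
      show "inner_auts G \<subseteq> carrier (AutoGroup G)" by (auto simp: inner_auts_alt conj_by_auto)
      show "inner_auts G \<noteq> {}" by (auto simp: inner_auts_alt)
    qed (auto simp: inner_auts_alt inv AutoGroup_mult conj_by_auto conj_by_compose)
    fix \<phi> \<iota> assume \<phi>: "\<phi> \<in> carrier (AutoGroup G)" and "\<iota> \<in> inner_auts G"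
    then obtain h where h: "h \<in> carrier G" "\<iota> = conj_by h" by (auto simp: inner_auts_alt)
    have p: "\<phi> \<in> auto G" "\<phi> \<in> hom G G" using \<phi> by (auto simp: auto_def)
    have pc: "\<phi> x \<in> carrier G" if "x \<in> carrier G" for x using p(2) that by (auto simp: hom_def)
    have gh: "group_hom G G \<phi>" using p(2) is_group by (simp add: group_hom_def group_hom_axioms_def)
    have "compose (carrier G) \<phi> (conj_by h) = compose (carrier G) (conj_by (\<phi> h)) \<phi>"
      using h(1) pc hom_mult[OF p(2)] group_hom.hom_inv[OF gh]
      by (auto simp: compose_def fun_eq_iff conj_by_def)
    then have "\<phi> \<otimes>\<^bsub>AutoGroup G\<^esub> \<iota> = conj_by (\<phi> h) \<otimes>\<^bsub>AutoGroup G\<^esub> \<phi>"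
      using h p(1) pc conj_by_auto by (simp add: AutoGroup_mult)
    then have "\<phi> \<otimes>\<^bsub>AutoGroup G\<^esub> \<iota> \<otimes>\<^bsub>AutoGroup G\<^esub> inv\<^bsub>AutoGroup G\<^esub> \<phi> = conj_by (\<phi> h)"
    proof -
      have "conj_by (\<phi> h) \<in> carrier (AutoGroup G)" using h pc conj_by_auto by simp
      then show ?thesis
        using \<phi> \<open>\<phi> \<otimes>\<^bsub>AutoGroup G\<^esub> \<iota> = conj_by (\<phi> h) \<otimes>\<^bsub>AutoGroup G\<^esub> \<phi>\<close>
        by (metis A.inv_closed A.m_assoc A.r_inv A.r_one)
    qed
    then show "\<phi> \<otimes>\<^bsub>AutoGroup G\<^esub> \<iota> \<otimes>\<^bsub>AutoGroup G\<^esub> inv\<^bsub>AutoGroup G\<^esub> \<phi> \<in> inner_auts G"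
      using h pc by (auto simp: inner_auts_alt)
  qed
qed

definition outer_class where "outer_class \<phi> = inner_auts G #>\<^bsub>AutoGroup G\<^esub> \<phi>"

lemma outer_class_Out: "\<phi> \<in> auto G \<Longrightarrow> outer_class \<phi> \<in> carrier (Out G)"
  by (auto simp: outer_class_def Out_def carrier_FactGroup)

lemma mem_outer_class:
  assumes "\<phi> \<in> auto G"
  shows "\<psi> \<in> outer_class \<phi> \<longleftrightarrow> (\<exists>h\<in>carrier G. \<psi> = compose (carrier G) (conj_by h) \<phi>)"
  using assms by (auto simp: outer_class_def r_coset_def inner_auts_alt AutoGroup_mult conj_by_auto)

lemma outer_class_self:
  assumes "\<phi> \<in> auto G" shows "\<phi> \<in> outer_class \<phi>"
proof -
  have "compose (carrier G) (conj_by \<one>) \<phi> = \<phi>"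
    using assms by (simp add: conj_by_one auto_def Bij_def Id_compose bij_betw_imp_funcset)
  then show ?thesis using assms mem_outer_class by (metis one_closed)
qed

lemma inverse_outer_class:
  assumes "\<phi> \<in> auto G"
  shows "(\<lambda>x \<in> carrier G. inv_into (carrier G) \<phi> x) \<in> inv\<^bsub>Out G\<^esub> (outer_class \<phi>)"
proof -
  interpret N: normal "inner_auts G" "AutoGroup G" by (rule inner_auts_normal)
  have "inv\<^bsub>Out G\<^esub> (outer_class \<phi>) = set_inv\<^bsub>AutoGroup G\<^esub> (outer_class \<phi>)"
    using N.inv_FactGroup outer_class_Out[OF assms] unfolding Out_def by blast
  then show ?thesis using outer_class_self[OF assms] AutoGroup_inv[OF assms] by (force simp: SET_INV_def)
qed

end

section \<open>Equivariant maps\<close>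

text \<open>The class of the rational current of \<open>a\<close> is fixed by the outer class of any automorphism \<open>\<phi>\<close>
  that fixes \<open>a\<close>, so its image is a projective class of functions \<open>f\<close> for which \<open>f \<circ> \<phi>\<close> is a
  multiple of \<open>f\<close>. For an anti-equivariant map the inverse of \<open>\<phi>\<close> acts, with the same effect.\<close>

lemma (in free_group) no_equivariant_map:
  assumes fin: "finite B" and card: "card B \<ge> 3" and a: "a \<in> B"
    and X: "rational_class a \<in> X"
    and \<tau>: "\<tau> (rational_class a) \<in> boundary_CV F"
    and eq: "equivariant (Out F) (out_PCurr F B) (out_PR F) X \<tau> \<or>
             anti_equivariant (Out F) (out_PCurr F B) (out_PR F) X \<tau>"
  shows False
proof -
  let ?x = "rational_class a"
  have cl: "\<tau> ?x \<in> PR F closure_of CV F" using \<tau> by (simp add: boundary_CV_def)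
  then have "\<tau> ?x \<in> topspace (PR F)" by (rule subsetD[OF closure_of_subset_topspace])
  then obtain f where f: "f \<in> topspace (nonzero_functions F)" "proj_function F f = \<tau> ?x" by (auto simp: PR_alt)
  have ext: "f \<in> extensional (carrier F)" using f(1) by (simp add: topspace_nonzero_functions)
  have f_mem: "f \<in> \<tau> ?x" using proj_function_self[OF ext] f(2) by simp
  have "\<exists>c. \<forall>w\<in>carrier F. f (\<phi> w) = c * f w" if \<phi>: "\<phi> \<in> auto F" "\<phi> a = a" for \<phi>
  proof -
    have bij: "bij_betw \<phi> (carrier F) (carrier F)" using \<phi>(1) by (simp add: auto_def Bij_def)
    have pc: "\<phi> w \<in> carrier F" if "w \<in> carrier F" for w using bij that by (auto simp: bij_betw_def)
    let ?\<Phi> = "outer_class \<phi>"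
    have fixed: "out_PCurr F B ?\<Phi> ?x = ?x"
    proof (rule rational_class_fixed[OF a fin])
      show "?\<Phi> \<noteq> {}" using outer_class_self[OF \<phi>(1)] by blast
      fix \<psi> assume "\<psi> \<in> ?\<Phi>"
      then obtain h where h: "h \<in> carrier F" "\<psi> = compose (carrier F) (conj_by h) \<phi>"
        using mem_outer_class[OF \<phi>(1)] by blast
      have "\<psi> = conj_by h \<otimes>\<^bsub>AutoGroup F\<^esub> \<phi>" using h \<phi>(1) conj_by_auto by (simp add: AutoGroup_mult)
      then have "\<psi> \<in> auto F"
        using monoid.m_closed[OF group.is_monoid[OF AutoGroup]] conj_by_auto[OF h(1)] \<phi>(1) by auto
      moreover have "\<psi> a = h \<otimes> a \<otimes> inv h" using h \<phi>(2) a by (simp add: compose_def conj_by_def)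
      ultimately show "\<psi> \<in> auto F \<and> \<psi> a \<in> conj_class F a" using h(1) by (auto simp: conj_class_def)
    qed
    have Out: "?\<Phi> \<in> carrier (Out F)" by (rule outer_class_Out[OF \<phi>(1)])
    from eq show ?thesis
    proof
      assume "equivariant (Out F) (out_PCurr F B) (out_PR F) X \<tau>"
      then have "\<tau> (out_PCurr F B ?\<Phi> ?x) = out_PR F ?\<Phi> (\<tau> ?x)"
        using Out X unfolding equivariant_def by blast
      then have "\<tau> ?x = out_PR F ?\<Phi> (\<tau> ?x)" using fixed by simp
      moreover have "aut_function F \<phi> f \<in> out_PR F ?\<Phi> (\<tau> ?x)"
        using outer_class_self[OF \<phi>(1)] f_mem by (auto simp: out_PR_def class_action_def)
      ultimately have "aut_function F \<phi> f \<in> proj_function F f" using f(2) by simp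
      then obtain c where c: "c \<noteq> 0" "aut_function F \<phi> f = (\<lambda>w\<in>carrier F. c * f w)" by (auto simp: proj_function_def)
      have "f (\<phi> w) = 1 / c * f w" if w: "w \<in> carrier F" for w
      proof -
        have "aut_function F \<phi> f (\<phi> w) = c * f (\<phi> w)" using c(2) pc[OF w] by simp
        moreover have "aut_function F \<phi> f (\<phi> w) = f w"
          using bij w pc[OF w] by (simp add: aut_function_def bij_betw_def inv_into_f_f)
        ultimately show ?thesis using c(1) by simp
      qed
      then show ?thesis by blast
    next
      assume "anti_equivariant (Out F) (out_PCurr F B) (out_PR F) X \<tau>"
      then have "\<tau> (out_PCurr F B ?\<Phi> ?x) = out_PR F (inv\<^bsub>Out F\<^esub> ?\<Phi>) (\<tau> ?x)"
        using Out X unfolding anti_equivariant_def by blast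
      then have "\<tau> ?x = out_PR F (inv\<^bsub>Out F\<^esub> ?\<Phi>) (\<tau> ?x)" using fixed by simp
      moreover define \<psi> where "\<psi> = (\<lambda>x \<in> carrier F. inv_into (carrier F) \<phi> x)"
      moreover have "aut_function F \<psi> f \<in> out_PR F (inv\<^bsub>Out F\<^esub> ?\<Phi>) (\<tau> ?x)"
        using inverse_outer_class[OF \<phi>(1)] f_mem by (auto simp: out_PR_def class_action_def \<psi>_def)
      ultimately have "aut_function F \<psi> f \<in> proj_function F f" using f(2) by simp
      then obtain c where c: "aut_function F \<psi> f = (\<lambda>w\<in>carrier F. c * f w)" by (auto simp: proj_function_def)
      have "f (\<phi> w) = c * f w" if w: "w \<in> carrier F" for w
      proof -
        have "\<psi> (\<phi> w) = w" using bij w pc[OF w] by (simp add: \<psi>_def bij_betw_def inv_into_f_f)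
        moreover have "bij_betw \<psi> (carrier F) (carrier F)"
          unfolding \<psi>_def using bij_betw_inv_into[OF bij] by (simp cong: bij_betw_cong)
        ultimately have "inv_into (carrier F) \<psi> w = \<phi> w"
          using pc[OF w] by (metis bij_betw_def inv_into_f_f)
        then have "aut_function F \<psi> f w = f (\<phi> w)" using w by (simp add: aut_function_def)
        then show ?thesis using c w by simp
      qed
      then show ?thesis by blast
    qed
  qed
  then show False using no_invariant_function[OF fin card a f(1)] cl f(2) by simp
qed

theorem theorem4:
  fixes F :: "('a, 'b) monoid_scheme" and B :: "'a set" and k :: nat
  assumes "group F"
    and "free_basis F B"
    and "finite B"
    and "card B = k"
    and "k \<ge> 3"
  shows "(\<nexists>\<tau>. continuous_map (subtopology (PCurr F B) (M_PCurr F B))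
                             (subtopology (PR F) (boundary_CV F)) \<tau> \<and>
               (equivariant (Out F) (out_PCurr F B) (out_PR F) (M_PCurr F B) \<tau> \<or>
                anti_equivariant (Out F) (out_PCurr F B) (out_PR F) (M_PCurr F B) \<tau>)) \<and>
         (\<nexists>\<tau>. continuous_map (PCurr F B) (subtopology (PR F) (boundary_CV F)) \<tau> \<and>
               (equivariant (Out F) (out_PCurr F B) (out_PR F) (topspace (PCurr F B)) \<tau> \<or>
                anti_equivariant (Out F) (out_PCurr F B) (out_PR F) (topspace (PCurr F B)) \<tau>))"
proof -
  interpret free_group F B using assms(1,2) by (simp add: free_group_def free_group_axioms_def)
  have card: "card B \<ge> 3" using assms(4,5) by simp
  then have "B \<noteq> {}" by auto
  then obtain a where a: "a \<in> B" by blast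
  note top = rational_class_in_PCurr[OF a assms(3)]
  note M = rational_class_in_M[OF a assms(3)]
  note no_map = no_equivariant_map[OF assms(3) card a]
  show ?thesis
  proof (intro conjI notI; elim exE conjE)
    fix \<tau>
    assume "continuous_map (subtopology (PCurr F B) (M_PCurr F B)) (subtopology (PR F) (boundary_CV F)) \<tau>"
      and "equivariant (Out F) (out_PCurr F B) (out_PR F) (M_PCurr F B) \<tau> \<or>
           anti_equivariant (Out F) (out_PCurr F B) (out_PR F) (M_PCurr F B) \<tau>"
    then show False using continuous_map_funspace top M by (intro no_map[of "M_PCurr F B" \<tau>]) fastforce+
  next
    fix \<tau>
    assume "continuous_map (PCurr F B) (subtopology (PR F) (boundary_CV F)) \<tau>"
      and "equivariant (Out F) (out_PCurr F B) (out_PR F) (topspace (PCurr F B)) \<tau> \<or>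
           anti_equivariant (Out F) (out_PCurr F B) (out_PR F) (topspace (PCurr F B)) \<tau>"
    then show False using continuous_map_funspace top by (intro no_map[of "topspace (PCurr F B)" \<tau>]) fastforce+
  qed
qed

end
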